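(* Let $R=(r,H,N)$ be a state in the grand-potential resource theory defined by $(\beta,\mu)$, with associated equilibrium state $G_R=(g_R,H,N)$, and let $\epsilon\in(0,1)$. Then $$\lim_{n\to\infty}\frac1{\sqrt n}\left[\frac n\beta D(r\|g_R)-W^\epsilon_{\rm gain}(R^{\otimes n})\right]=\frac1\beta\,s(r\|g_R)\,\Phi^{-1}(1-\epsilon)$$ and $$\lim_{n\to\infty}\frac1{\sqrt n}\left[W^\epsilon_{\rm cost}(R^{\otimes n})-\frac n\beta D(r\|g_R)\right]=\frac1\beta\,s(r\|g_R)\,\Phi^{-1}(1-\epsilon).$$
   Context: Fix $\beta>0$ and $\mu\in\mathbb R$. A state is $R=(\rho,H,N)$: a density operator, Hamiltonian and number operator on a finite-dimensional Hilbert space, pairwise commuting; equivalently $R=(r,H,N)$ with $r$ the vector of eigenvalues of $\rho$ in a common eigenbasis of $H,N$. Composition: $R+S=(\rho\otimes\sigma,\,H_R\otimes\mathbb 1+\mathbb 1\otimes H_S,\,N_R\otimes\mathbb 1+\mathbb 1\otimes N_S)$; $R^{\otimes n}=(r^{\otimes n},\sum_{i=1}^nH_i,\sum_{i=1}^nN_i)$ is the composition of $n$ copies of $R$. Free states are $(\gamma,H,N)$ with $\gamma=e^{-\beta(H-\mu N)}/Z$; $G_R=(g_R,H,N)$ is the free state with the same $H,N$ as $R$, and $g_R$ is its vector of eigenvalues. Equilibrating operation on $R=(\rho,H_R,N_R)$: draw any free state $G=(\gamma,H_G,N_G)$; apply to $R+G$ a unitary $U$ commuting with $H_R+H_G$ and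 $N_R+N_G$; trace out any subsystem with its own Hamiltonian and number operator. Existence of such an operation from $X$ to $Y$ is written $X\xmapsto{\beta,\mu}Y$; it is characterized by equimajorization: $X=(x,\cdot,\cdot)$ can be mapped to $Y=(y,\cdot,\cdot)$ iff there is a column-stochastic matrix $M$ with $Mx=y$, $Mg_X=g_Y$. Write $X\xmapsto{\beta,\mu}_\epsilon Y$, for $Y=(\sigma,H,N)$, if $X\xmapsto{\beta,\mu}Y'$ for some $Y'=(\sigma',H,N)$ with $\tfrac12\|\sigma'-\sigma\|_1\le\epsilon$. Battery: a battery is any system whose energies, in the range accessed by the agent, are finely spaced (so the energies $E$, $E+W$ used below are available levels), and which occupies an energy eigenstate. $B_E=(|E\rangle\langle E|,H_B,N_B)$ denotes the battery in the eigenstate of energy $E$. The equilibrium state of the battery assigns weight $e^{-\beta E}/Z$ to the level $|E\rangle$. It is assumed that $\beta E\gg1$. Work quantities: $W^\epsilon_{\rm gain}(R)=\max\{W: R+B_E\xmapsto{\beta,\mu}_\epsilon B_{E+W},\ \beta E\gg1\}$, $W^\epsilon_{\rm cost}(R)=\min\{W: B_{E+W}\xmapsto{\beta,\mu}_\epsilon R+B_E,\ \beta E\gg1\}$. Relative entropy: $D(r\|s)=\sum_ir_i\ln(r_i/s_i)$ with $0\ln0=0$. Square root of the relative entropy variance: $s(r\|g)=\sqrt{\sum_ir_i(\ln r_i-\ln g_i)^2-D(r\|g)^2}$ (terms with $r_i=0$ omitted). $\Phi^{-1}$ is the inverse of the standard normal cumulative distribution function: $\Phi^{-1}(\epsilon)=\sup\{z\in\mathbb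 R:\frac1{\sqrt{2\pi}}\int_{-\infty}^ze^{-t^2/2}dt\le\epsilon\}$. *)

theory Defs
  imports "HOL-Probability.Probability" "Jordan_Normal_Form.Spectral_Radius"
begin

no_notation Finite_Cartesian_Product.vec_nth (infixl "$" 90)

section \<open>Operators on finite-dimensional Hilbert spaces\<close>

definition hermitian_mat :: "nat \<Rightarrow> complex mat \<Rightarrow> bool" where
  "hermitian_mat n A \<longleftrightarrow> A \<in> carrier_mat n n \<and> mat_adjoint A = A"

definition unitary_mat :: "nat \<Rightarrow> complex mat \<Rightarrow> bool" where
  "unitary_mat n U \<longleftrightarrow> U \<in> carrier_mat n n \<and>
     mat_adjoint U * U = 1\<^sub>m n \<and> U * mat_adjoint U = 1\<^sub>m n"

definition mat_trace :: "complex mat \<Rightarrow> complex" where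
  "mat_trace A = (\<Sum>i<dim_row A. A $$ (i, i))"

definition density_mat :: "nat \<Rightarrow> complex mat \<Rightarrow> bool" where
  "density_mat n A \<longleftrightarrow> hermitian_mat n A \<and>
     (\<forall>v \<in> carrier_vec n. 0 \<le> Re ((A *\<^sub>v v) \<bullet>c v)) \<and> mat_trace A = 1"

definition exp_mat :: "complex mat \<Rightarrow> complex mat" where
  "exp_mat A = Matrix.mat (dim_row A) (dim_row A)
     (\<lambda>ij. \<Sum>k. (A ^\<^sub>m k) $$ ij / of_nat (fact k))"

text \<open>The basis vector of index \<open>a\<close> tensored with the one of index \<open>b\<close> has index
  \<open>a * dim_row B + b\<close>; \<open>partial_trace dY dA\<close> traces out the second factor.\<close>

definition kron :: "complex mat \<Rightarrow> complex mat \<Rightarrow> complex mat" where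
  "kron A B = Matrix.mat (dim_row A * dim_row B) (dim_col A * dim_col B)
     (\<lambda>(i, j). A $$ (i div dim_row B, j div dim_col B) * B $$ (i mod dim_row B, j mod dim_col B))"

definition partial_trace :: "nat \<Rightarrow> nat \<Rightarrow> complex mat \<Rightarrow> complex mat" where
  "partial_trace dY dA M = Matrix.mat dY dY
     (\<lambda>(i, j). \<Sum>k<dA. M $$ (i * dA + k, j * dA + k))"

text \<open>The sum of the singular values of \<open>A\<close>, that is, of the square roots of the eigenvalues of
  \<open>A\<^sup>\<dagger>A\<close> counted with multiplicity.\<close>

definition trace_norm :: "complex mat \<Rightarrow> real" where
  "trace_norm A = (let B = mat_adjoint A * A in
     \<Sum>x \<in> spectrum B. real (order x (char_poly B)) * sqrt (Re x))"

definition outer_self :: "complex Matrix.vec \<Rightarrow> complex mat" where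
  "outer_self v = Matrix.mat (dim_vec v) (dim_vec v) (\<lambda>(i, j). v $ i * cnj (v $ j))"

text \<open>The columns of \<open>P\<close> form an orthonormal eigenbasis of \<open>A\<close>, with eigenvalues
  \<open>a 0, \<dots>, a (n - 1)\<close> in that order (with multiplicity).\<close>

definition has_eigenvalues :: "nat \<Rightarrow> complex mat \<Rightarrow> complex mat \<Rightarrow> (nat \<Rightarrow> real) \<Rightarrow> bool" where
  "has_eigenvalues n P A a \<longleftrightarrow> unitary_mat n P \<and>
     A = P * mat_diag n (\<lambda>i. complex_of_real (a i)) * mat_adjoint P"

section \<open>States, composition and free states\<close>

record qsystem =
  dens :: "complex mat"
  ham :: "complex mat"
  numop :: "complex mat"

definition hdim :: "qsystem \<Rightarrow> nat" where
  "hdim R = dim_row (dens R)"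

definition is_state :: "qsystem \<Rightarrow> bool" where
  "is_state R \<longleftrightarrow> density_mat (hdim R) (dens R) \<and>
     hermitian_mat (hdim R) (ham R) \<and> hermitian_mat (hdim R) (numop R) \<and>
     dens R * ham R = ham R * dens R \<and>
     dens R * numop R = numop R * dens R \<and>
     ham R * numop R = numop R * ham R"

text \<open>\<open>A \<otimes> 1 + 1 \<otimes> B\<close>\<close>

definition kron_sum :: "complex mat \<Rightarrow> complex mat \<Rightarrow> complex mat" where
  "kron_sum A B = kron A (1\<^sub>m (dim_row B)) + kron (1\<^sub>m (dim_row A)) B"

definition compose :: "qsystem \<Rightarrow> qsystem \<Rightarrow> qsystem" where
  "compose R S = \<lparr>dens = kron (dens R) (dens S),
                  ham = kron_sum (ham R) (ham S),
                  numop = kron_sum (numop R) (numop S)\<rparr>"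

text \<open>The composition of no copies is the trivial one-dimensional system.\<close>

fun copies :: "nat \<Rightarrow> qsystem \<Rightarrow> qsystem" where
  "copies 0 R = \<lparr>dens = 1\<^sub>m 1, ham = 0\<^sub>m 1 1, numop = 0\<^sub>m 1 1\<rparr>"
| "copies (Suc 0) R = R"
| "copies (Suc (Suc n)) R = compose (copies (Suc n) R) R"

definition boltzmann :: "real \<Rightarrow> real \<Rightarrow> complex mat \<Rightarrow> complex mat \<Rightarrow> complex mat" where
  "boltzmann \<beta> \<mu> H N = exp_mat (- complex_of_real \<beta> \<cdot>\<^sub>m (H - complex_of_real \<mu> \<cdot>\<^sub>m N))"

definition partition_function :: "real \<Rightarrow> real \<Rightarrow> complex mat \<Rightarrow> complex mat \<Rightarrow> complex" where
  "partition_function \<beta> \<mu> H N = mat_trace (boltzmann \<beta> \<mu> H N)"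

definition gibbs :: "real \<Rightarrow> real \<Rightarrow> complex mat \<Rightarrow> complex mat \<Rightarrow> complex mat" where
  "gibbs \<beta> \<mu> H N = (1 / partition_function \<beta> \<mu> H N) \<cdot>\<^sub>m boltzmann \<beta> \<mu> H N"

definition free_state :: "real \<Rightarrow> real \<Rightarrow> qsystem \<Rightarrow> bool" where
  "free_state \<beta> \<mu> G \<longleftrightarrow> is_state G \<and> dens G = gibbs \<beta> \<mu> (ham G) (numop G)"

definition equilibrium :: "real \<Rightarrow> real \<Rightarrow> qsystem \<Rightarrow> qsystem" where
  "equilibrium \<beta> \<mu> R = R\<lparr>dens := gibbs \<beta> \<mu> (ham R) (numop R)\<rparr>"

section \<open>Equilibrating operations\<close>

text \<open>\<open>T\<close> identifies the Hilbert space of \<open>X + G\<close> with the tensor product of the retained system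
  (that of \<open>Y\<close>) and the discarded one. Each factor has its own Hamiltonian and number operator:
  under the identification the total ones are \<open>H\<^sub>Y \<otimes> 1 + 1 \<otimes> H\<^sub>A\<close> and
  \<open>N\<^sub>Y \<otimes> 1 + 1 \<otimes> N\<^sub>A\<close>.\<close>

definition equilibrating :: "real \<Rightarrow> real \<Rightarrow> qsystem \<Rightarrow> qsystem \<Rightarrow> bool" where
  "equilibrating \<beta> \<mu> X Y \<longleftrightarrow>
    (\<exists>G U T dA HA NA. free_state \<beta> \<mu> G \<and>
      (let XG = compose X G; d = hdim XG in
        unitary_mat d U \<and> U * ham XG = ham XG * U \<and> U * numop XG = numop XG * U \<and>
        d = hdim Y * dA \<and> hermitian_mat dA HA \<and> hermitian_mat dA NA \<and>
        unitary_mat d T \<and>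
        T * ham XG * mat_adjoint T = kron_sum (ham Y) HA \<and>
        T * numop XG * mat_adjoint T = kron_sum (numop Y) NA \<and>
        dens Y = partial_trace (hdim Y) dA
          (T * (U * dens XG * mat_adjoint U) * mat_adjoint T)))"

definition equilibrating_approx :: "real \<Rightarrow> real \<Rightarrow> real \<Rightarrow> qsystem \<Rightarrow> qsystem \<Rightarrow> bool" where
  "equilibrating_approx \<beta> \<mu> \<epsilon> X Y \<longleftrightarrow>
    (\<exists>\<sigma>. is_state (Y\<lparr>dens := \<sigma>\<rparr>) \<and> hdim (Y\<lparr>dens := \<sigma>\<rparr>) = hdim Y \<and>
      equilibrating \<beta> \<mu> X (Y\<lparr>dens := \<sigma>\<rparr>) \<and> trace_norm (\<sigma> - dens Y) / 2 \<le> \<epsilon>)"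

section \<open>Batteries and work\<close>

text \<open>\<open>B\<close> is a battery in an eigenstate of energy \<open>E\<close>, and the equilibrium state of the
  battery gives this level the weight \<open>exp (- \<beta> * E) / Z\<close>.\<close>

definition battery_state :: "real \<Rightarrow> real \<Rightarrow> real \<Rightarrow> qsystem \<Rightarrow> bool" where
  "battery_state \<beta> \<mu> E B \<longleftrightarrow> is_state B \<and>
    (\<exists>v \<in> carrier_vec (hdim B). v \<bullet>c v = 1 \<and> dens B = outer_self v \<and>
      ham B *\<^sub>v v = complex_of_real E \<cdot>\<^sub>v v \<and>
      gibbs \<beta> \<mu> (ham B) (numop B) *\<^sub>v v =
        (complex_of_real (exp (- \<beta> * E)) / partition_function \<beta> \<mu> (ham B) (numop B)) \<cdot>\<^sub>v v)"

text \<open>One battery in its levels \<open>E\<close> and \<open>E + W\<close>.\<close>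

definition battery_pair :: "real \<Rightarrow> real \<Rightarrow> real \<Rightarrow> real \<Rightarrow> qsystem \<Rightarrow> qsystem \<Rightarrow> bool" where
  "battery_pair \<beta> \<mu> E W B B' \<longleftrightarrow>
     battery_state \<beta> \<mu> E B \<and> battery_state \<beta> \<mu> (E + W) B' \<and> ham B' = ham B \<and> numop B' = numop B"

text \<open>The condition \<open>\<beta> * E \<ggreater> 1\<close> is read as: for all sufficiently large \<open>E\<close>. Exact
  operations with finite-dimensional free states need not attain the extremal work, so the
  maximum and the minimum are a supremum and an infimum.\<close>

definition W_gain :: "real \<Rightarrow> real \<Rightarrow> real \<Rightarrow> qsystem \<Rightarrow> real" where
  "W_gain \<beta> \<mu> \<epsilon> R = Sup {W. \<forall>\<^sub>F E in at_top. \<exists>B B'. battery_pair \<beta> \<mu> E W B B' \<and>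
     equilibrating_approx \<beta> \<mu> \<epsilon> (compose R B) B'}"

definition W_cost :: "real \<Rightarrow> real \<Rightarrow> real \<Rightarrow> qsystem \<Rightarrow> real" where
  "W_cost \<beta> \<mu> \<epsilon> R = Inf {W. \<forall>\<^sub>F E in at_top. \<exists>B B'. battery_pair \<beta> \<mu> E W B B' \<and>
     equilibrating_approx \<beta> \<mu> \<epsilon> B' (compose R B)}"

section \<open>Entropic quantities\<close>

definition rel_entropy :: "nat \<Rightarrow> (nat \<Rightarrow> real) \<Rightarrow> (nat \<Rightarrow> real) \<Rightarrow> real" where
  "rel_entropy d r g = (\<Sum>i<d. if r i = 0 then 0 else r i * ln (r i / g i))"

definition rel_entropy_sd :: "nat \<Rightarrow> (nat \<Rightarrow> real) \<Rightarrow> (nat \<Rightarrow> real) \<Rightarrow> real" where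
  "rel_entropy_sd d r g =
     sqrt ((\<Sum>i<d. if r i = 0 then 0 else r i * (ln (r i) - ln (g i))\<^sup>2) - (rel_entropy d r g)\<^sup>2)"

definition Phi_inv :: "real \<Rightarrow> real" where
  "Phi_inv \<epsilon> = Sup {z. cdf std_normal_distribution z \<le> \<epsilon>}"

end

theory Submission
  imports Defs
begin

text \<open>An equilibrating operation is a channel that maps equilibrium states to equilibrium states, so a
  two-outcome measurement after the operation can be pulled back to one before it. For work gain,
  measuring whether the battery has reached its final level yields a test between \<open>r\<close> and \<open>g\<close> that
  accepts \<open>r\<close> with probability at least \<open>1 - \<epsilon>\<close> and \<open>g\<close> with probability at most \<open>exp (- \<beta> * W)\<close>. For
  work cost, one applies the likelihood ratio test to the produced state. In both cases \<open>\<beta> * W\<close> is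
  bounded by a quantile of \<open>ln (r / g)\<close> up to a constant.

  Conversely, let the bath contain \<open>M\<close> copies of the equilibrium state of the system. If
  a level of the system has a high likelihood ratio, then a system that was swapped into a
  random one of the copies can be located again, since \<open>g\<close> rarely shows such levels; the position is
  thus a memory for \<open>ln M\<close> units of entropy, which a ladder of degenerate levels converts
  into the energy \<open>ln M / \<beta>\<close>. The same energy-conserving permutation of levels, run backwards, prepares the
  system by rejection sampling. This matches the bounds up to constants, and for \<open>n\<close>
  copies the central limit theorem gives the quantiles up to \<open>o (sqrt n)\<close>.\<close>

section \<open>Matrices\<close>

text \<open>An operation must conserve energy and number exactly with a finite-dimensional bath, so
  the protocols are built as permutations of joint levels, and one involution serves both
  directions. Its only large parameter is \<open>M\<close>. For gain, \<open>M\<close> is about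
  \<open>\<delta> * exp \<theta>\<close>, small enough that the stored index is rarely obscured by
  an earlier copy showing a high ratio by chance. For cost, \<open>M\<close> is a large multiple of
  \<open>exp \<theta>\<close>, so that some copy is accepted almost surely. In both cases
  \<open>\<beta> * W = ln M\<close> differs from the threshold \<open>\<theta>\<close> by a constant
  that depends only on a slack \<open>\<kappa>\<close> in the success probability, and division by
  \<open>sqrt n\<close> removes it. The slack is available because moving the threshold by a fixed
  multiple of \<open>sqrt n\<close> away from the quantile opens a gap in the limiting probability.
  It also pays for the ends of the ladder, which must be finite and where a letter cannot be pushed
  or popped.\<close>

lemma sum_mult_split:
  fixes f :: "nat \<Rightarrow> 'a::comm_monoid_add"
  shows "(\<Sum>i<n * m. f i) = (\<Sum>a<n. \<Sum>b<m. f (a * m + b))"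
proof -
  have "sum f {a * m..<a * m + m} = (\<Sum>b<m. f (a * m + b))" for a
    using sum.shift_bounds_nat_ivl[of f 0 "a * m" m] by (simp add: lessThan_atLeast0 add.commute)
  then show ?thesis by (simp flip: sum.nat_group)
qed

lemma index_pair_less: "a < n \<Longrightarrow> b < m \<Longrightarrow> a * m + b < n * (m::nat)"
  using mult_le_mono1[of "Suc a" n m] by simp

text \<open>The side conditions are equations between dimensions, which rewriting can decide;
  carrier premises would require the sizes to be guessed.\<close>

lemma mult_assoc_dim:
  "dim_col A = dim_row B \<Longrightarrow> dim_col B = dim_row C \<Longrightarrow>
    A * B * C = A * (B * (C :: 'a::semiring_0 mat))"
  by (rule assoc_mult_mat[of _ "dim_row A" "dim_col A" _ "dim_col B" _ "dim_col C"]) auto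

lemma mult_add_dim:
  "dim_col A = dim_row B \<Longrightarrow> dim_row B = dim_row C \<Longrightarrow> dim_col B = dim_col C \<Longrightarrow>
    A * (B + C) = A * B + A * (C :: 'a::semiring_0 mat)"
  by (rule mult_add_distrib_mat[of _ "dim_row A" "dim_col A" _ "dim_col B"]) auto

lemma add_mult_dim:
  "dim_row A = dim_row B \<Longrightarrow> dim_col A = dim_col B \<Longrightarrow> dim_col A = dim_row C \<Longrightarrow>
    (A + B) * C = A * C + B * (C :: 'a::semiring_0 mat)"
  by (rule add_mult_distrib_mat[of _ "dim_row A" "dim_col A" _ _ "dim_col C"]) auto

lemma mult_minus_dim:
  "dim_col A = dim_row B \<Longrightarrow> dim_row B = dim_row C \<Longrightarrow> dim_col B = dim_col C \<Longrightarrow>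
    A * (B - C) = A * B - A * (C :: 'a::ring mat)"
  by (rule mult_minus_distrib_mat[of _ "dim_row A" "dim_col A" _ "dim_col B"]) auto

lemma minus_mult_dim:
  "dim_row A = dim_row B \<Longrightarrow> dim_col A = dim_col B \<Longrightarrow> dim_col A = dim_row C \<Longrightarrow>
    (A - B) * C = A * C - B * (C :: 'a::ring mat)"
  by (rule minus_mult_distrib_mat[of _ "dim_row A" "dim_col A" _ _ "dim_col C"]) auto

lemma mult_smult_dim:
  "dim_col A = dim_row B \<Longrightarrow> A * (c \<cdot>\<^sub>m B) = c \<cdot>\<^sub>m (A * (B :: 'a::comm_semiring_0 mat))"
  by (rule mult_smult_distrib[of _ "dim_row A" "dim_col A" _ "dim_col B"]) auto

lemma smult_mult_dim:
  "dim_col A = dim_row B \<Longrightarrow> (c \<cdot>\<^sub>m A) * B = c \<cdot>\<^sub>m (A * (B :: 'a::comm_semiring_0 mat))"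
  by (rule mult_smult_assoc_mat[of _ "dim_row A" "dim_col A" _ "dim_col B"]) auto

lemma one_smult_mat: "1 \<cdot>\<^sub>m A = (A :: 'a::semiring_1 mat)"
  by (rule eq_matI) auto

lemma index_mult_mat_sum:
  "i < dim_row A \<Longrightarrow> j < dim_col B \<Longrightarrow> dim_col A = dim_row B \<Longrightarrow>
    (A * B) $$ (i, j) = (\<Sum>k<dim_row B. A $$ (i, k) * B $$ (k, j))"
  by (auto simp: scalar_prod_def atLeast0LessThan intro!: sum.cong)

lemma mat_diag_dims [simp]: "dim_row (mat_diag n f) = n" "dim_col (mat_diag n f) = n"
  by (auto simp: mat_diag_def)

lemma mat_diag_index [simp]:
  "i < n \<Longrightarrow> j < n \<Longrightarrow> mat_diag n f $$ (i, j) = (if i = j then f j else 0)"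
  by (auto simp: mat_diag_def)

lemma mat_diag_cong: "(\<And>i. i < n \<Longrightarrow> f i = g i) \<Longrightarrow> mat_diag n f = mat_diag n g"
  by (rule eq_matI) auto

section \<open>Adjoints and diagonal matrices\<close>

lemma adjoint_dims [simp]:
  "dim_row (mat_adjoint A) = dim_col A" "dim_col (mat_adjoint A) = dim_row A"
  by (auto simp: mat_adjoint_def)

lemma adjoint_carrier [simp]: "A \<in> carrier_mat n m \<Longrightarrow> mat_adjoint A \<in> carrier_mat m n"
  by (rule carrier_matI) auto

lemma adjoint_index [simp]:
  fixes A :: "complex mat"
  shows "i < dim_col A \<Longrightarrow> j < dim_row A \<Longrightarrow> mat_adjoint A $$ (i, j) = cnj (A $$ (j, i))"
  unfolding mat_adjoint_def mat_of_rows_def by simp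

lemma adjoint_adjoint [simp]: "mat_adjoint (mat_adjoint (A :: complex mat)) = A"
  by (rule eq_matI) auto

lemma adjoint_mult:
  fixes A B :: "complex mat"
  shows "dim_col A = dim_row B \<Longrightarrow> mat_adjoint (A * B) = mat_adjoint B * mat_adjoint A"
  by (rule eq_matI) (auto simp: index_mult_mat_sum cnj_sum mult.commute simp del: index_mult_mat(1))

lemma adjoint_minus:
  fixes A B :: "complex mat"
  shows "dim_row A = dim_row B \<Longrightarrow> dim_col A = dim_col B \<Longrightarrow>
    mat_adjoint (A - B) = mat_adjoint A - mat_adjoint B"
  by (rule eq_matI) auto

lemma adjoint_smult:
  fixes A :: "complex mat"
  shows "mat_adjoint (c \<cdot>\<^sub>m A) = cnj c \<cdot>\<^sub>m mat_adjoint A"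
  by (rule eq_matI) auto

lemma adjoint_one [simp]: "mat_adjoint (1\<^sub>m n :: complex mat) = 1\<^sub>m n"
  by (rule eq_matI) auto

lemma adjoint_diag: "mat_adjoint (mat_diag n f :: complex mat) = mat_diag n (\<lambda>i. cnj (f i))"
  by (rule eq_matI) auto

lemma mult_diag_adjoint_index:
  fixes P :: "complex mat"
  assumes "dim_col P = n" "i < dim_row P" "j < dim_row P"
  shows "(P * mat_diag n a * mat_adjoint P) $$ (i, j)
    = (\<Sum>k<n. a k * (P $$ (i, k) * cnj (P $$ (j, k))))"
proof -
  have "P * mat_diag n a = Matrix.mat (dim_row P) n (\<lambda>(i, j). P $$ (i, j) * a j)"
    by (rule mat_diag_mult_right) (use assms in auto)
  then show ?thesis
    using assms
    by (simp add: index_mult_mat_sum ac_simps del: index_mult_mat(1))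
qed

section \<open>Kronecker products\<close>

lemma kron_dims [simp]:
  "dim_row (kron A B) = dim_row A * dim_row B" "dim_col (kron A B) = dim_col A * dim_col B"
  by (auto simp: kron_def)

lemma kron_carrier:
  "A \<in> carrier_mat n m \<Longrightarrow> B \<in> carrier_mat k l \<Longrightarrow> kron A B \<in> carrier_mat (n * k) (m * l)"
  by (rule carrier_matI) auto

lemma kron_index_pair [simp]:
  assumes "dim_row B = p" "dim_col B = q"
    and "i < dim_row A" "k < p" "j < dim_col A" "l < q"
  shows "kron A B $$ (i * p + k, j * q + l) = A $$ (i, j) * B $$ (k, l)"
  using assms by (simp add: kron_def index_pair_less)

text \<open>Matrices on a tensor product are compared at indices \<open>a * k + b\<close>, where
  \<open>kron\<close> has product entries; division and remainder then stay out of the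
  calculations.\<close>

lemma eq_mat_pairI:
  assumes "dim_row X = n * k" "dim_col X = m * l" "dim_row Y = n * k" "dim_col Y = m * l"
    and "\<And>a b c d. a < n \<Longrightarrow> b < k \<Longrightarrow> c < m \<Longrightarrow> d < l \<Longrightarrow>
      X $$ (a * k + b, c * l + d) = Y $$ (a * k + b, c * l + d)"
  shows "X = Y"
proof (rule eq_matI)
  fix i j assume ij: "i < dim_row Y" "j < dim_col Y"
  then have "0 < k" "0 < l" using assms(3,4) by (auto intro: gr0I)
  moreover from this ij have "i div k < n" "j div l < m"
    using assms(3,4) by (auto simp: less_mult_imp_div_less)
  ultimately show "X $$ (i, j) = Y $$ (i, j)"
    using assms(5)[of "i div k" "i mod k" "j div l" "j mod l"] by simp
qed (use assms in auto)

lemma kron_mult: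
  assumes "dim_col A = dim_row C" "dim_col B = dim_row D"
  shows "kron A B * kron C D = kron (A * C) (B * D)"
proof (rule eq_mat_pairI[of _ "dim_row A" "dim_row B" "dim_col C" "dim_col D"])
  fix a b c d
  assume less: "a < dim_row A" "b < dim_row B" "c < dim_col C" "d < dim_col D"
  have "(kron A B * kron C D) $$ (a * dim_row B + b, c * dim_col D + d)
    = (\<Sum>i<dim_row C. \<Sum>j<dim_row D. kron A B $$ (a * dim_row B + b, i * dim_col B + j)
        * kron C D $$ (i * dim_row D + j, c * dim_col D + d))"
    by (subst index_mult_mat_sum) (use less assms in \<open>simp_all add: index_pair_less sum_mult_split\<close>)
  also have "\<dots> = (\<Sum>i<dim_row C. \<Sum>j<dim_row D.
      (A $$ (a, i) * C $$ (i, c)) * (B $$ (b, j) * D $$ (j, d)))"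
    by (intro sum.cong refl) (use less assms in simp)
  also have "\<dots> = (A * C) $$ (a, c) * (B * D) $$ (b, d)"
    using less assms by (simp add: index_mult_mat_sum sum_product del: index_mult_mat(1))
  also have "\<dots> = kron (A * C) (B * D) $$ (a * dim_row B + b, c * dim_col D + d)"
    using less by simp
  finally show "(kron A B * kron C D) $$ (a * dim_row B + b, c * dim_col D + d)
    = kron (A * C) (B * D) $$ (a * dim_row B + b, c * dim_col D + d)" .
qed auto

lemma adjoint_kron: "mat_adjoint (kron A B) = kron (mat_adjoint A) (mat_adjoint B)"
proof (rule eq_mat_pairI[of _ "dim_col A" "dim_col B" "dim_row A" "dim_row B"])
  fix a b c d
  assume "a < dim_col A" "b < dim_col B" "c < dim_row A" "d < dim_row B"
  then show "mat_adjoint (kron A B) $$ (a * dim_col B + b, c * dim_row B + d)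
    = kron (mat_adjoint A) (mat_adjoint B) $$ (a * dim_col B + b, c * dim_row B + d)"
    by (simp add: index_pair_less)
qed auto

lemma pair_eq_iff:
  "b < m \<Longrightarrow> d < m \<Longrightarrow> a * m + b = c * m + d \<longleftrightarrow> a = c \<and> b = (d :: nat)"
  by (metis add.commute div_mult_self1 div_less add_0_right mod_less mod_mult_self1 less_zeroE not_gr_zero)

lemma kron_diag:
  "kron (mat_diag n a) (mat_diag m b) = mat_diag (n * m) (\<lambda>i. a (i div m) * b (i mod m))"
proof (rule eq_mat_pairI[of _ n m n m])
  fix i j k l assume "i < n" "j < m" "k < n" "l < m"
  then show "kron (mat_diag n a) (mat_diag m b) $$ (i * m + j, k * m + l)
    = mat_diag (n * m) (\<lambda>i. a (i div m) * b (i mod m)) $$ (i * m + j, k * m + l)"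
    by (auto simp: index_pair_less pair_eq_iff)
qed auto

lemma kron_one: "kron (1\<^sub>m n) (1\<^sub>m m) = 1\<^sub>m (n * m)"
  using kron_diag[of n "\<lambda>_. 1" m "\<lambda>_. 1"] by simp

lemma kron_add_left:
  "dim_row A = dim_row A' \<Longrightarrow> dim_col A = dim_col A' \<Longrightarrow> kron (A + A') B = kron A B + kron A' B"
  by (rule eq_mat_pairI[of _ "dim_row A" "dim_row B" "dim_col A" "dim_col B"])
    (simp_all add: index_pair_less ring_distribs)

lemma kron_smult_left: "kron (c \<cdot>\<^sub>m A) B = c \<cdot>\<^sub>m kron A B"
  by (rule eq_mat_pairI[of _ "dim_row A" "dim_row B" "dim_col A" "dim_col B"])
    (simp_all add: index_pair_less ring_distribs)

section \<open>Traces and unitary matrices\<close>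

lemma trace_mult_comm:
  assumes "dim_col A = dim_row B" "dim_col B = dim_row A"
  shows "mat_trace (A * B) = mat_trace (B * A)"
proof -
  have "mat_trace (A * B) = (\<Sum>i<dim_row A. \<Sum>k<dim_row B. A $$ (i, k) * B $$ (k, i))"
    unfolding mat_trace_def using assms
    by (simp add: index_mult_mat_sum del: index_mult_mat(1))
  also have "\<dots> = mat_trace (B * A)"
    unfolding mat_trace_def using assms
    by (subst sum.swap) (simp add: index_mult_mat_sum mult.commute del: index_mult_mat(1))
  finally show ?thesis .
qed

lemma trace_kron:
  assumes "dim_row A = dim_col A" "dim_row B = dim_col B"
  shows "mat_trace (kron A B) = mat_trace A * mat_trace B"
proof -
  have "mat_trace (kron A B) = (\<Sum>a<dim_row A. \<Sum>b<dim_row B. A $$ (a, a) * B $$ (b, b))"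
    unfolding mat_trace_def kron_dims sum_mult_split
    by (intro sum.cong refl) (use assms in simp)
  then show ?thesis by (simp add: mat_trace_def sum_product)
qed

lemma trace_diag: "mat_trace (mat_diag n a) = (\<Sum>i<n. a i)"
  by (simp add: mat_trace_def)

lemma unitary_carrier: "unitary_mat n U \<Longrightarrow> U \<in> carrier_mat n n"
  by (simp add: unitary_mat_def)

lemma unitary_dims: "unitary_mat n U \<Longrightarrow> dim_row U = n \<and> dim_col U = n"
  by (auto simp: unitary_mat_def)

text \<open>A left inverse of a square matrix is also a right inverse.\<close>

lemma unitary_matI:
  assumes "U \<in> carrier_mat n n" "mat_adjoint U * U = 1\<^sub>m n"
  shows "unitary_mat n U"
  using assms mat_mult_left_right_inverse[of "mat_adjoint U" n U] by (simp add: unitary_mat_def)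

lemma unitary_adjoint: "unitary_mat n U \<Longrightarrow> unitary_mat n (mat_adjoint U)"
  by (simp add: unitary_mat_def)

lemma unitary_one [simp]: "unitary_mat n (1\<^sub>m n)"
  by (simp add: unitary_mat_def)

lemma isometry_mult:
  fixes U V :: "complex mat"
  assumes "U \<in> carrier_mat n m" "mat_adjoint U * U = 1\<^sub>m m"
    and "V \<in> carrier_mat m k" "mat_adjoint V * V = 1\<^sub>m k"
  shows "mat_adjoint (U * V) * (U * V) = 1\<^sub>m k"
proof -
  have "mat_adjoint (U * V) * (U * V) = mat_adjoint V * (mat_adjoint U * U) * V"
    using carrier_matD[OF assms(1)] carrier_matD[OF assms(3)] by (simp add: adjoint_mult mult_assoc_dim)
  then show ?thesis using assms by simp
qed

lemma unitary_mult: "unitary_mat n U \<Longrightarrow> unitary_mat n V \<Longrightarrow> unitary_mat n (U * V)"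
  by (intro unitary_matI isometry_mult[of _ n n]) (auto simp: unitary_mat_def)

lemma unitary_kron: "unitary_mat n U \<Longrightarrow> unitary_mat m V \<Longrightarrow> unitary_mat (n * m) (kron U V)"
  using unitary_dims[of n U] unitary_dims[of m V]
  by (auto simp: unitary_mat_def adjoint_kron kron_mult kron_one intro: kron_carrier)

lemma trace_unitary_conj:
  assumes "unitary_mat n U" "A \<in> carrier_mat n n"
  shows "mat_trace (U * A * mat_adjoint U) = mat_trace A"
proof -
  have "mat_trace (U * A * mat_adjoint U) = mat_trace (mat_adjoint U * (U * A))"
    by (rule trace_mult_comm) (use assms in \<open>auto simp: unitary_mat_def\<close>)
  also have "mat_adjoint U * (U * A) = mat_adjoint U * U * A"
    using unitary_dims[OF assms(1)] carrier_matD[OF assms(2)] by (simp add: mult_assoc_dim)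
  finally show ?thesis using assms by (simp add: unitary_mat_def)
qed

section \<open>Hermitian matrices\<close>

lemma self_inner_sum:
  fixes v :: "complex Matrix.vec"
  shows "v \<bullet>c v = (\<Sum>k<dim_vec v. (cmod (v $ k))\<^sup>2)"
  by (simp add: scalar_prod_def lessThan_atLeast0 flip: complex_norm_square)

text \<open>Gram-Schmidt makes the completed basis orthogonal and leaves its first vector
  \<open>v\<close> alone. Dividing by the norms makes the matrix of columns unitary and rescales
  \<open>v\<close> by \<open>c\<close>.\<close>

lemma orthonormal_completion:
  fixes v :: "complex Matrix.vec"
  assumes v: "v \<in> carrier_vec n" "v \<noteq> 0\<^sub>v n"
  obtains W c where "unitary_mat n W" "\<And>i. i < n \<Longrightarrow> W $$ (i, 0) = c * v $ i"
proof -
  interpret cof_vec_space n "TYPE(complex)" .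
  define ws where "ws = gram_schmidt n (basis_completion v)"
  note bc = basis_completion[OF v]
  obtain vs where bv: "basis_completion v = v # vs"
    using bc v by (cases "basis_completion v") auto
  have ws: "set ws \<subseteq> carrier_vec n" "corthogonal ws" "length ws = n"
    using gram_schmidt_result[OF _ _ _ ws_def] bc by auto
  have hd: "hd ws = v"
    unfolding ws_def bv using v by simp
  have n: "0 < n" using v by (auto intro: gr0I)
  have ws0: "ws ! 0 = v" using hd ws n by (cases ws) auto
  define a where "a i = complex_of_real (1 / sqrt (Re (ws ! i \<bullet>c ws ! i)))" for i
  have wsc: "ws ! i \<in> carrier_vec n" if "i < n" for i using ws that by auto
  define W where "W = Matrix.mat n n (\<lambda>(i, j). a j * ws ! j $ i)"
  have "mat_adjoint W * W = 1\<^sub>m n"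
  proof (rule eq_matI)
    fix i j assume ij: "i < dim_row (1\<^sub>m n :: complex mat)" "j < dim_col (1\<^sub>m n :: complex mat)"
    then have "(mat_adjoint W * W) $$ (i, j) = (\<Sum>k<n. cnj (a i * ws ! i $ k) * (a j * ws ! j $ k))"
      by (subst index_mult_mat_sum) (auto simp: W_def)
    also have "\<dots> = cnj (a i) * a j * (ws ! j \<bullet>c ws ! i)"
      using ij wsc[of i] wsc[of j]
      by (simp add: scalar_prod_def lessThan_atLeast0 sum_distrib_left ac_simps)
    also have "\<dots> = (if i = j then 1 else 0)"
    proof (cases "i = j")
      case True
      have "ws ! i \<bullet>c ws ! i \<noteq> 0"
        using corthogonalD[OF ws(2), of i i] ij ws by auto
      then have "0 < Re (ws ! i \<bullet>c ws ! i)" "Im (ws ! i \<bullet>c ws ! i) = 0"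
        by (auto simp: self_inner_sum less_le complex_eq_iff intro!: sum_nonneg)
      then have "cnj (a i) * a i * (ws ! i \<bullet>c ws ! i)
          = complex_of_real ((1 / sqrt (Re (ws ! i \<bullet>c ws ! i)))\<^sup>2 * Re (ws ! i \<bullet>c ws ! i))"
        by (simp add: a_def power2_eq_square complex_eq_iff)
      also have "\<dots> = 1" using \<open>0 < Re _\<close> by (simp add: power_divide)
      finally show ?thesis using True by simp
    next
      case False
      then show ?thesis using corthogonalD[OF ws(2), of j i] ij ws by auto
    qed
    finally show "(mat_adjoint W * W) $$ (i, j) = 1\<^sub>m n $$ (i, j)" using ij by simp
  qed (auto simp: W_def)
  then have "unitary_mat n W" by (intro unitary_matI) (auto simp: W_def)
  moreover have "W $$ (i, 0) = a 0 * v $ i" if "i < n" for i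
    using that n ws0 by (simp add: W_def)
  ultimately show thesis by (rule that)
qed

lemma has_eigenvalues_carrier:
  "has_eigenvalues n P A a \<Longrightarrow> A \<in> carrier_mat n n"
  by (auto simp: has_eigenvalues_def unitary_mat_def intro!: mult_carrier_mat[of _ n n])

text \<open>The spectral decomposition into rank-one projections, written entrywise, so that sums
  and series of matrices with a common eigenbasis reduce to scalars.\<close>

lemma has_eigenvalues_index:
  assumes "has_eigenvalues n P A a" "i < n" "j < n"
  shows "A $$ (i, j) = (\<Sum>k<n. complex_of_real (a k) * (P $$ (i, k) * cnj (P $$ (j, k))))"
  using assms mult_diag_adjoint_index[of P n i j "\<lambda>i. complex_of_real (a i)"]
  by (auto simp: has_eigenvalues_def dest: unitary_dims)

lemma has_eigenvalues_hermitian: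
  assumes "has_eigenvalues n P A a"
  shows "hermitian_mat n A"
  unfolding hermitian_mat_def
proof
  show A: "A \<in> carrier_mat n n" by (rule has_eigenvalues_carrier[OF assms])
  show "mat_adjoint A = A"
    by (rule eq_matI) (use A assms in \<open>auto simp: has_eigenvalues_index cnj_sum mult.commute\<close>)
qed

lemma has_eigenvaluesI:
  assumes "unitary_mat n P" "A \<in> carrier_mat n n"
    and "\<And>i j. i < n \<Longrightarrow> j < n \<Longrightarrow>
      A $$ (i, j) = (\<Sum>k<n. complex_of_real (a k) * (P $$ (i, k) * cnj (P $$ (j, k))))"
  shows "has_eigenvalues n P A a"
  unfolding has_eigenvalues_def
proof
  show "A = P * mat_diag n (\<lambda>i. complex_of_real (a i)) * mat_adjoint P"
    by (rule eq_matI)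
      (use assms unitary_dims[OF assms(1)] in
        \<open>auto simp: mult_diag_adjoint_index simp del: index_mult_mat(1)\<close>)
qed fact

text \<open>Deflation: in a unitary basis whose first vector is an eigenvector, the first column is
  zero below the eigenvalue. Hermiticity makes the eigenvalue real and clears the first row as well,
  and the remaining block is hermitian and one size smaller.\<close>

theorem spectral_theorem:
  assumes "hermitian_mat n A"
  shows "\<exists>P a. has_eigenvalues n P A a"
  using assms
proof (induction n arbitrary: A)
  case 0
  then have "has_eigenvalues 0 (1\<^sub>m 0) A (\<lambda>_. 0)"
    by (intro has_eigenvaluesI) (auto simp: hermitian_mat_def)
  then show ?case by blast
next
  case (Suc n)
  then have A: "A \<in> carrier_mat (Suc n) (Suc n)" "mat_adjoint A = A"
    by (auto simp: hermitian_mat_def)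
  obtain e where "eigenvalue A e"
    using spectrum_non_empty[OF A(1)] by (auto simp: spectrum_def)
  then obtain v where v: "v \<in> carrier_vec (Suc n)" "v \<noteq> 0\<^sub>v (Suc n)" "A *\<^sub>v v = e \<cdot>\<^sub>v v"
    using A by (auto simp: eigenvalue_def eigenvector_def)
  obtain W c where W: "unitary_mat (Suc n) W" and W0: "\<And>i. i < Suc n \<Longrightarrow> W $$ (i, 0) = c * v $ i"
    using orthonormal_completion[OF v(1,2)] by blast
  note Wd = unitary_dims[OF W] and Ad = carrier_matD[OF A(1)]
  define B where "B = mat_adjoint W * A * W"
  have B: "B \<in> carrier_mat (Suc n) (Suc n)" using Wd Ad by (auto simp: B_def)
  have Bh: "mat_adjoint B = B"
    unfolding B_def using Wd Ad A(2) by (simp add: adjoint_mult mult_assoc_dim)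
  have AB: "A = W * B * mat_adjoint W"
  proof -
    have "W * B * mat_adjoint W = (W * mat_adjoint W) * A * (W * mat_adjoint W)"
      unfolding B_def using Wd Ad by (simp add: mult_assoc_dim)
    then show ?thesis using W A by (simp add: unitary_mat_def)
  qed
  have AW: "(A * W) $$ (i, 0) = e * W $$ (i, 0)" if i: "i < Suc n" for i
  proof -
    have "(A * W) $$ (i, 0) = c * (A *\<^sub>v v) $ i"
      using Ad Wd W0 v(1) i
      by (simp add: index_mult_mat_sum scalar_prod_def lessThan_atLeast0 sum_distrib_left ac_simps
          del: index_mult_mat(1) sum.op_ivl_Suc)
    then show ?thesis using v W0 i by simp
  qed
  have B0: "B $$ (i, 0) = (if i = 0 then e else 0)" if i: "i < Suc n" for i
  proof -
    have "B $$ (i, 0) = (\<Sum>k<Suc n. mat_adjoint W $$ (i, k) * (A * W) $$ (k, 0))"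
      unfolding B_def using Wd Ad i
      by (simp only: mult_assoc_dim adjoint_dims, subst index_mult_mat_sum) auto
    also have "\<dots> = e * (\<Sum>k<Suc n. mat_adjoint W $$ (i, k) * W $$ (k, 0))"
      unfolding sum_distrib_left by (intro sum.cong) (use AW in auto)
    also have "\<dots> = e * (mat_adjoint W * W) $$ (i, 0)"
      using Wd i by (subst index_mult_mat_sum) auto
    finally show ?thesis using W i by (simp add: unitary_mat_def)
  qed
  have Bsym: "B $$ (i, j) = cnj (B $$ (j, i))" if "i < Suc n" "j < Suc n" for i j
    using that B Bh adjoint_index[of i B j] by auto
  have "e = cnj e" using Bsym[of 0 0] B0[of 0] by simp
  then have e: "complex_of_real (Re e) = e" by (simp add: complex_eq_iff)
  have B0': "B $$ (0, i) = (if i = 0 then e else 0)" if i: "i < Suc n" for i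
    using Bsym[of 0 i] B0[of i] i \<open>e = cnj e\<close> by auto
  define C where "C = Matrix.mat n n (\<lambda>(i, j). B $$ (Suc i, Suc j))"
  have "hermitian_mat n C"
    unfolding hermitian_mat_def C_def by (auto intro!: eq_matI simp: Bsym[symmetric])
  then obtain Q q where Q: "has_eigenvalues n Q C q" using Suc.IH by blast
  then have Qu: "unitary_mat n Q" by (simp add: has_eigenvalues_def)
  note Qd = unitary_dims[OF Qu]
  \<comment> \<open>The direct sum of 1 and \<open>Q\<close>: it diagonalizes the block
    \<open>C\<close> and fixes the first vector.\<close>
  define Q' where "Q' = Matrix.mat (Suc n) (Suc n) (\<lambda>(i, j). case (i, j) of
    (0, 0) \<Rightarrow> 1 | (Suc i, Suc j) \<Rightarrow> Q $$ (i, j) | _ \<Rightarrow> 0)"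
  have "mat_adjoint Q' * Q' = 1\<^sub>m (Suc n)"
  proof (rule eq_matI)
    fix i j assume ij: "i < dim_row (1\<^sub>m (Suc n) :: complex mat)" "j < dim_col (1\<^sub>m (Suc n) :: complex mat)"
    have QQ: "(\<Sum>k<n. cnj (Q $$ (k, i')) * Q $$ (k, j')) = (if i' = j' then 1 else 0)"
      if "i' < n" "j' < n" for i' j'
    proof -
      have "(mat_adjoint Q * Q) $$ (i', j') = (\<Sum>k<n. cnj (Q $$ (k, i')) * Q $$ (k, j'))"
        using Qd that by (subst index_mult_mat_sum) auto
      then show ?thesis using Qu that by (simp add: unitary_mat_def)
    qed
    have "(mat_adjoint Q' * Q') $$ (i, j) = (\<Sum>k<Suc n. cnj (Q' $$ (k, i)) * Q' $$ (k, j))"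
      using ij by (subst index_mult_mat_sum) (auto simp: Q'_def)
    also have "\<dots> = 1\<^sub>m (Suc n) $$ (i, j)"
      using ij by (cases i; cases j) (auto simp: Q'_def sum.lessThan_Suc_shift QQ simp del: sum.lessThan_Suc)
    finally show "(mat_adjoint Q' * Q') $$ (i, j) = 1\<^sub>m (Suc n) $$ (i, j)" .
  qed (auto simp: Q'_def)
  then have Q'u: "unitary_mat (Suc n) Q'" by (intro unitary_matI) (auto simp: Q'_def)
  define a where "a = (\<lambda>i. case i of 0 \<Rightarrow> Re e | Suc i \<Rightarrow> q i)"
  have Bq: "has_eigenvalues (Suc n) Q' B a"
  proof (rule has_eigenvaluesI[OF Q'u B])
    fix i j assume ij: "i < Suc n" "j < Suc n"
    show "B $$ (i, j) = (\<Sum>k<Suc n. complex_of_real (a k) * (Q' $$ (i, k) * cnj (Q' $$ (j, k))))"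
    proof (cases "i = 0 \<or> j = 0")
      case True
      then show ?thesis using ij B0 B0' e
        by (cases i; cases j) (auto simp: Q'_def a_def sum.lessThan_Suc_shift simp del: sum.lessThan_Suc)
    next
      case False
      then obtain i' j' where "i = Suc i'" "j = Suc j'" "i' < n" "j' < n"
        using ij by (metis Suc_less_eq not0_implies_Suc)
      then show ?thesis using has_eigenvalues_index[OF Q, of i' j']
        by (auto simp: C_def Q'_def a_def sum.lessThan_Suc_shift simp del: sum.lessThan_Suc)
    qed
  qed
  have "has_eigenvalues (Suc n) (W * Q') A a"
    unfolding has_eigenvalues_def
  proof
    show "unitary_mat (Suc n) (W * Q')" by (rule unitary_mult[OF W Q'u])
    show "A = W * Q' * mat_diag (Suc n) (\<lambda>i. complex_of_real (a i)) * mat_adjoint (W * Q')"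
      using AB Bq Wd unitary_dims[OF Q'u]
      by (simp add: has_eigenvalues_def adjoint_mult mult_assoc_dim)
  qed
  then show ?case by blast
qed

section \<open>Calculus of eigenvalues in a fixed eigenbasis\<close>

lemma has_eigenvaluesD:
  assumes "has_eigenvalues n P A a"
  shows "unitary_mat n P" "A = P * mat_diag n (\<lambda>i. complex_of_real (a i)) * mat_adjoint P"
    "dim_row A = n" "dim_col A = n"
  using assms has_eigenvalues_carrier[OF assms] by (auto simp: has_eigenvalues_def)

lemma has_eigenvalues_cong:
  "has_eigenvalues n P A a \<Longrightarrow> (\<And>i. i < n \<Longrightarrow> a i = b i) \<Longrightarrow> has_eigenvalues n P A b"
  unfolding has_eigenvalues_def
  using mat_diag_cong[of n "\<lambda>i. complex_of_real (a i)" "\<lambda>i. complex_of_real (b i)"] by simp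

lemma has_eigenvalues_conj:
  assumes "unitary_mat n V" "has_eigenvalues n P A a"
  shows "has_eigenvalues n (V * P) (V * A * mat_adjoint V) a"
  using assms unitary_dims[OF assms(1)] unitary_dims[OF has_eigenvaluesD(1)[OF assms(2)]]
  by (auto simp: has_eigenvalues_def unitary_mult adjoint_mult mult_assoc_dim)

lemma has_eigenvalues_diag: "has_eigenvalues n (1\<^sub>m n) (mat_diag n (\<lambda>i. complex_of_real (a i))) a"
  by (simp add: has_eigenvalues_def right_mult_one_mat[of _ n n] left_mult_one_mat[of _ n n])

lemma has_eigenvalues_mult:
  assumes "has_eigenvalues n P A a" "has_eigenvalues n P B b"
  shows "has_eigenvalues n P (A * B) (\<lambda>i. a i * b i)"
proof -
  note P = has_eigenvaluesD(1)[OF assms(1)]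
  have "A * B = P * mat_diag n (\<lambda>i. complex_of_real (a i)) * (mat_adjoint P * P)
      * (mat_diag n (\<lambda>i. complex_of_real (b i)) * mat_adjoint P)"
    using has_eigenvaluesD(2)[OF assms(1)] has_eigenvaluesD(2)[OF assms(2)] unitary_dims[OF P]
    by (simp add: mult_assoc_dim)
  also have "\<dots> = P * (mat_diag n (\<lambda>i. complex_of_real (a i)) * mat_diag n (\<lambda>i. complex_of_real (b i)))
      * mat_adjoint P"
    using P unitary_dims[OF P]
    by (simp add: unitary_mat_def mult_assoc_dim right_mult_one_mat[of _ n n] del: mat_diag_diag)
  finally show ?thesis using P by (simp add: has_eigenvalues_def)
qed

lemma has_eigenvalues_one: "unitary_mat n P \<Longrightarrow> has_eigenvalues n P (1\<^sub>m n) (\<lambda>_. 1)"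
  by (simp add: has_eigenvalues_def unitary_mat_def right_mult_one_mat[of _ n n])

lemma has_eigenvalues_add:
  assumes "has_eigenvalues n P A a" "has_eigenvalues n P B b"
  shows "has_eigenvalues n P (A + B) (\<lambda>i. a i + b i)"
  by (rule has_eigenvaluesI)
    (use assms in \<open>auto simp: has_eigenvaluesD has_eigenvalues_index has_eigenvalues_carrier
      ring_distribs sum.distrib\<close>)

lemma has_eigenvalues_smult:
  assumes "has_eigenvalues n P A a"
  shows "has_eigenvalues n P (complex_of_real c \<cdot>\<^sub>m A) (\<lambda>i. c * a i)"
  by (rule has_eigenvaluesI)
    (use assms in \<open>auto simp: has_eigenvaluesD has_eigenvalues_index has_eigenvalues_carrier
      sum_distrib_left mult.assoc\<close>)

lemma has_eigenvalues_minus: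
  assumes "has_eigenvalues n P A a" "has_eigenvalues n P B b"
  shows "has_eigenvalues n P (A - B) (\<lambda>i. a i - b i)"
  by (rule has_eigenvaluesI)
    (use assms in \<open>auto simp: has_eigenvaluesD has_eigenvalues_index has_eigenvalues_carrier
      ring_distribs sum_subtractf\<close>)

lemma has_eigenvalues_kron:
  assumes "has_eigenvalues n P A a" "has_eigenvalues m Q B b"
  shows "has_eigenvalues (n * m) (kron P Q) (kron A B) (\<lambda>i. a (i div m) * b (i mod m))"
proof -
  note P = has_eigenvaluesD[OF assms(1)] and Q = has_eigenvaluesD[OF assms(2)]
  have "kron A B = kron P Q *
      kron (mat_diag n (\<lambda>i. complex_of_real (a i))) (mat_diag m (\<lambda>i. complex_of_real (b i)))
      * mat_adjoint (kron P Q)"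
    using P(2) Q(2) unitary_dims[OF P(1)] unitary_dims[OF Q(1)]
    by (simp add: kron_mult adjoint_kron)
  then show ?thesis
    using unitary_kron[OF P(1) Q(1)] by (simp add: has_eigenvalues_def kron_diag)
qed

lemma has_eigenvalues_kron_sum:
  assumes "has_eigenvalues n P A a" "has_eigenvalues m Q B b"
  shows "has_eigenvalues (n * m) (kron P Q) (kron_sum A B) (\<lambda>i. a (i div m) + b (i mod m))"
  using has_eigenvalues_add[OF
      has_eigenvalues_kron[OF assms(1) has_eigenvalues_one[OF has_eigenvaluesD(1)[OF assms(2)]]]
      has_eigenvalues_kron[OF has_eigenvalues_one[OF has_eigenvaluesD(1)[OF assms(1)]] assms(2)]]
  by (simp add: kron_sum_def has_eigenvaluesD(3)[OF assms(1)] has_eigenvaluesD(3)[OF assms(2)])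

lemma has_eigenvalues_conj_diag:
  assumes "has_eigenvalues n P A a"
  shows "mat_adjoint P * A * P = mat_diag n (\<lambda>i. complex_of_real (a i))"
proof -
  note P = has_eigenvaluesD[OF assms]
  have "mat_adjoint P * A * P = (mat_adjoint P * P) * mat_diag n (\<lambda>i. complex_of_real (a i)) * (mat_adjoint P * P)"
    by (subst P(2)) (use unitary_dims[OF P(1)] in \<open>simp add: mult_assoc_dim\<close>)
  then show ?thesis
    using P(1) by (simp add: unitary_mat_def left_mult_one_mat[of _ n n] right_mult_one_mat[of _ n n])
qed

lemma has_eigenvalues_unique:
  assumes "has_eigenvalues n P A a" "has_eigenvalues n P A b" "i < n"
  shows "a i = b i"
proof -
  have "mat_diag n (\<lambda>i. complex_of_real (a i)) $$ (i, i) = mat_diag n (\<lambda>i. complex_of_real (b i)) $$ (i, i)"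
    using has_eigenvalues_conj_diag[OF assms(1)] has_eigenvalues_conj_diag[OF assms(2)] by simp
  then show ?thesis using assms(3) by simp
qed

lemma has_eigenvalues_trace:
  assumes "has_eigenvalues n P A a"
  shows "mat_trace A = complex_of_real (\<Sum>i<n. a i)"
  by (subst has_eigenvaluesD(2)[OF assms])
    (simp add: trace_unitary_conj[OF has_eigenvaluesD(1)[OF assms]] trace_diag)

lemma has_eigenvalues_power:
  assumes "has_eigenvalues n P A a"
  shows "has_eigenvalues n P (A ^\<^sub>m k) (\<lambda>i. a i ^ k)"
proof (induction k)
  case 0
  then show ?case
    using has_eigenvalues_one[OF has_eigenvaluesD(1)[OF assms]] has_eigenvaluesD(3)[OF assms] by simp
next
  case (Suc k)
  then show ?case using has_eigenvalues_mult[OF Suc assms] by (simp add: mult.commute)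
qed

text \<open>\<open>exp_mat\<close> is an entrywise series, and in the eigenbasis each entry is a
  finite combination of scalar exponential series.\<close>

lemma has_eigenvalues_exp:
  assumes "has_eigenvalues n P A a"
  shows "has_eigenvalues n P (exp_mat A) (\<lambda>i. exp (a i))"
proof (rule has_eigenvaluesI)
  fix i j assume ij: "i < n" "j < n"
  have "(\<lambda>k. \<Sum>l<n. (complex_of_real (a l)) ^ k /\<^sub>R fact k * (P $$ (i, l) * cnj (P $$ (j, l)))) sums
      (\<Sum>l<n. exp (complex_of_real (a l)) * (P $$ (i, l) * cnj (P $$ (j, l))))"
    by (intro sums_sum sums_mult2 exp_converges)
  moreover have "(\<Sum>l<n. (complex_of_real (a l)) ^ k /\<^sub>R fact k * (P $$ (i, l) * cnj (P $$ (j, l))))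
      = (A ^\<^sub>m k) $$ (i, j) / of_nat (fact k)" for k
    using has_eigenvalues_index[OF has_eigenvalues_power[OF assms] ij, of k]
    by (simp add: sum_divide_distrib scaleR_conv_of_real divide_simps)
  ultimately show "exp_mat A $$ (i, j)
      = (\<Sum>k<n. complex_of_real (exp (a k)) * (P $$ (i, k) * cnj (P $$ (j, k))))"
    using ij has_eigenvaluesD[OF assms] by (simp add: exp_mat_def sums_iff exp_of_real)
qed (use has_eigenvaluesD[OF assms] in \<open>auto simp: exp_mat_def\<close>)

section \<open>Gibbs states\<close>

definition gibbs_weight :: "real \<Rightarrow> nat \<Rightarrow> (nat \<Rightarrow> real) \<Rightarrow> nat \<Rightarrow> real" where
  "gibbs_weight \<beta> n k i = exp (- \<beta> * k i) / (\<Sum>j<n. exp (- \<beta> * k j))"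

lemma has_eigenvalues_grand:
  assumes "has_eigenvalues n P H h" "has_eigenvalues n P N \<nu>"
  shows "has_eigenvalues n P (H - complex_of_real \<mu> \<cdot>\<^sub>m N) (\<lambda>i. h i - \<mu> * \<nu> i)"
  by (intro has_eigenvalues_minus has_eigenvalues_smult assms)

lemma has_eigenvalues_boltzmann:
  assumes "has_eigenvalues n P (H - complex_of_real \<mu> \<cdot>\<^sub>m N) k"
  shows "has_eigenvalues n P (boltzmann \<beta> \<mu> H N) (\<lambda>i. exp (- \<beta> * k i))"
  using has_eigenvalues_exp[OF has_eigenvalues_smult[OF assms, of "- \<beta>"]]
  by (simp add: boltzmann_def)

lemma has_eigenvalues_partition_function:
  assumes "has_eigenvalues n P (H - complex_of_real \<mu> \<cdot>\<^sub>m N) k"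
  shows "partition_function \<beta> \<mu> H N = complex_of_real (\<Sum>i<n. exp (- \<beta> * k i))"
  unfolding partition_function_def
  by (rule has_eigenvalues_trace[OF has_eigenvalues_boltzmann[OF assms]])

lemma has_eigenvalues_gibbs:
  assumes "has_eigenvalues n P (H - complex_of_real \<mu> \<cdot>\<^sub>m N) k"
  shows "has_eigenvalues n P (gibbs \<beta> \<mu> H N) (gibbs_weight \<beta> n k)"
  using has_eigenvalues_smult[OF has_eigenvalues_boltzmann[OF assms],
      of "1 / (\<Sum>i<n. exp (- \<beta> * k i))" \<beta>]
  by (simp add: gibbs_def has_eigenvalues_partition_function[OF assms] gibbs_weight_def[abs_def])

lemma gibbs_weight_pos: "i < n \<Longrightarrow> 0 < gibbs_weight \<beta> n k i"
  unfolding gibbs_weight_def by (intro divide_pos_pos sum_pos) auto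

lemma gibbs_weight_sum: "0 < n \<Longrightarrow> (\<Sum>i<n. gibbs_weight \<beta> n k i) = 1"
  unfolding gibbs_weight_def
  by (simp flip: sum_divide_distrib) (metis exp_gt_zero finite_lessThan lessThan_iff less_irrefl lessThan_empty_iff bot_nat_0.not_eq_extremum sum_pos)

text \<open>Normalization determines \<open>c\<close> as the reciprocal partition function.\<close>

lemma gibbs_weight_eqI:
  assumes "\<And>i. i < n \<Longrightarrow> g i = c * exp (- \<beta> * k i)" "(\<Sum>i<n. g i) = 1" "i < n"
  shows "gibbs_weight \<beta> n k i = g i"
proof -
  have "c * (\<Sum>i<n. exp (- \<beta> * k i)) = 1"
    using assms(1,2) by (simp add: sum_distrib_left)
  moreover from this have "c \<noteq> 0" by auto
  ultimately have "(\<Sum>i<n. exp (- \<beta> * k i)) = 1 / c" by (simp add: field_simps)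
  then show ?thesis using assms(1)[OF assms(3)] by (simp add: gibbs_weight_def)
qed

lemma gibbs_weight_product:
  "i < n * m \<Longrightarrow> gibbs_weight \<beta> (n * m) (\<lambda>i. k (i div m) + l (i mod m)) i
    = gibbs_weight \<beta> n k (i div m) * gibbs_weight \<beta> m l (i mod m)"
  by (simp add: gibbs_weight_def sum_mult_split sum_product distrib_left flip: exp_add)

section \<open>States\<close>

lemma state_dims:
  assumes "is_state R"
  shows "dens R \<in> carrier_mat (hdim R) (hdim R)" "ham R \<in> carrier_mat (hdim R) (hdim R)"
    "numop R \<in> carrier_mat (hdim R) (hdim R)"
  using assms by (auto simp: is_state_def density_mat_def hermitian_mat_def)

lemma psd_eigenvalue_nonneg:
  assumes "has_eigenvalues n P A a" "\<forall>v \<in> carrier_vec n. 0 \<le> Re ((A *\<^sub>v v) \<bullet>c v)" "i < n"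
  shows "0 \<le> a i"
proof -
  note P = has_eigenvaluesD[OF assms(1)]
  have "(A *\<^sub>v col P i) \<bullet>c col P i = (mat_adjoint P * (A * P)) $$ (i, i)"
    using P unitary_dims[OF P(1)] assms(3)
    by (simp add: index_mult_mat_sum scalar_prod_def lessThan_atLeast0 mult.commute del: index_mult_mat(1))
  also have "\<dots> = a i"
    using has_eigenvalues_conj_diag[OF assms(1)] P unitary_dims[OF P(1)] assms(3)
    by (simp add: mult_assoc_dim)
  finally show ?thesis
    using assms(2)[rule_format, of "col P i"] unitary_dims[OF P(1)] assms(3) by auto
qed

lemma density_eigenvalues:
  assumes "density_mat n A" "has_eigenvalues n P A a"
  shows "\<And>i. i < n \<Longrightarrow> 0 \<le> a i" "(\<Sum>i<n. a i) = 1"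
proof -
  show "\<And>i. i < n \<Longrightarrow> 0 \<le> a i"
    using psd_eigenvalue_nonneg[OF assms(2)] assms(1) by (auto simp: density_mat_def)
  have "complex_of_real (\<Sum>i<n. a i) = 1"
    using has_eigenvalues_trace[OF assms(2)] assms(1) by (simp add: density_mat_def)
  then show "(\<Sum>i<n. a i) = 1" using of_real_eq_1_iff by blast
qed

lemma eigenvalues_density:
  assumes "has_eigenvalues n P A a" "\<And>i. i < n \<Longrightarrow> 0 \<le> a i" "(\<Sum>i<n. a i) = 1"
  shows "density_mat n A"
  unfolding density_mat_def
proof (intro conjI ballI)
  note P = has_eigenvaluesD[OF assms(1)]
  show "hermitian_mat n A" by (rule has_eigenvalues_hermitian[OF assms(1)])
  show "mat_trace A = 1" using has_eigenvalues_trace[OF assms(1)] assms(3) by simp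
  fix v :: "complex Matrix.vec" assume v: "v \<in> carrier_vec n"
  have "(A *\<^sub>v v) \<bullet>c v = (\<Sum>i<n. (\<Sum>j<n. A $$ (i, j) * v $ j) * cnj (v $ i))"
    using v P by (simp add: scalar_prod_def lessThan_atLeast0)
  also have "\<dots> = (\<Sum>i<n. \<Sum>j<n. \<Sum>k<n. complex_of_real (a k) * ((cnj (v $ i) * P $$ (i, k)) * (v $ j * cnj (P $$ (j, k)))))"
    by (intro sum.cong refl)
      (simp add: has_eigenvalues_index[OF assms(1)] sum_distrib_left sum_distrib_right ac_simps)
  also have "\<dots> = (\<Sum>i<n. \<Sum>k<n. \<Sum>j<n. complex_of_real (a k) * ((cnj (v $ i) * P $$ (i, k)) * (v $ j * cnj (P $$ (j, k)))))"
    by (intro sum.cong refl sum.swap)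
  also have "\<dots> = (\<Sum>k<n. \<Sum>i<n. \<Sum>j<n. complex_of_real (a k) * ((cnj (v $ i) * P $$ (i, k)) * (v $ j * cnj (P $$ (j, k)))))"
    by (rule sum.swap)
  also have "\<dots> = (\<Sum>k<n. complex_of_real (a k) * ((\<Sum>i<n. cnj (v $ i) * P $$ (i, k)) * cnj (\<Sum>j<n. cnj (v $ j) * P $$ (j, k))))"
    by (intro sum.cong refl) (simp add: sum_product flip: sum_distrib_left)
  also have "\<dots> = complex_of_real (\<Sum>k<n. a k * (cmod (\<Sum>i<n. cnj (v $ i) * P $$ (i, k)))\<^sup>2)"
    by (simp del: cnj_sum flip: complex_norm_square)
  finally show "0 \<le> Re ((A *\<^sub>v v) \<bullet>c v)"
    using assms(2) by (auto intro!: sum_nonneg)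
qed

lemma has_eigenvalues_commute:
  "has_eigenvalues n P A a \<Longrightarrow> has_eigenvalues n P B b \<Longrightarrow> A * B = B * A"
  using has_eigenvaluesD(2)[OF has_eigenvalues_mult[of n P A a B b]]
    has_eigenvaluesD(2)[OF has_eigenvalues_mult[of n P B b A a]]
  by (simp add: mult.commute)

text \<open>A state seen through a joint eigenbasis. Composition then acts on lists of numbers, and
  positivity and unit trace become conditions on \<open>r\<close>.\<close>

definition state_spectrum ::
    "nat \<Rightarrow> complex mat \<Rightarrow> qsystem \<Rightarrow> (nat \<Rightarrow> real) \<Rightarrow> (nat \<Rightarrow> real) \<Rightarrow> (nat \<Rightarrow> real) \<Rightarrow> bool" where
  "state_spectrum n P R r h \<nu> \<longleftrightarrow> has_eigenvalues n P (dens R) r \<and> has_eigenvalues n P (ham R) h \<and>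
    has_eigenvalues n P (numop R) \<nu> \<and> (\<forall>i<n. 0 \<le> r i) \<and> (\<Sum>i<n. r i) = 1"

lemma state_spectrumD:
  assumes "state_spectrum n P R r h \<nu>"
  shows "has_eigenvalues n P (dens R) r" "has_eigenvalues n P (ham R) h"
    "has_eigenvalues n P (numop R) \<nu>" "\<And>i. i < n \<Longrightarrow> 0 \<le> r i" "(\<Sum>i<n. r i) = 1" "hdim R = n"
    "unitary_mat n P" "0 < n"
  using assms by (auto simp: state_spectrum_def hdim_def dest: has_eigenvaluesD intro: gr0I)

lemma state_spectrum_is_state:
  assumes "state_spectrum n P R r h \<nu>"
  shows "is_state R"
proof -
  note R = state_spectrumD[OF assms]
  show ?thesis
    unfolding is_state_def R(6)
    by (intro conjI eigenvalues_density[OF R(1,4,5)] has_eigenvalues_hermitian[OF R(2)]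
        has_eigenvalues_hermitian[OF R(3)] has_eigenvalues_commute[OF R(1,2)]
        has_eigenvalues_commute[OF R(1,3)] has_eigenvalues_commute[OF R(2,3)])
qed

lemma state_spectrumI:
  assumes "is_state R" "has_eigenvalues (hdim R) P (dens R) r" "has_eigenvalues (hdim R) P (ham R) h"
    "has_eigenvalues (hdim R) P (numop R) \<nu>"
  shows "state_spectrum (hdim R) P R r h \<nu>"
  using assms density_eigenvalues[of "hdim R" "dens R" P r] by (simp add: state_spectrum_def is_state_def)

lemma state_spectrum_compose:
  assumes "state_spectrum n P R r h \<nu>" "state_spectrum m Q S s k \<kappa>"
  shows "state_spectrum (n * m) (kron P Q) (compose R S) (\<lambda>i. r (i div m) * s (i mod m))
    (\<lambda>i. h (i div m) + k (i mod m)) (\<lambda>i. \<nu> (i div m) + \<kappa> (i mod m))"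
  unfolding state_spectrum_def
proof (intro conjI allI impI)
  note R = state_spectrumD[OF assms(1)] and S = state_spectrumD[OF assms(2)]
  show "(\<Sum>i<n * m. r (i div m) * s (i mod m)) = 1"
    using R(5) S(5) by (simp add: sum_mult_split flip: sum_product)
  show "0 \<le> r (i div m) * s (i mod m)" if "i < n * m" for i
    using R(4)[of "i div m"] S(4)[of "i mod m"] S(8) that by (simp add: less_mult_imp_div_less)
qed (simp_all add: compose_def has_eigenvalues_kron has_eigenvalues_kron_sum
    state_spectrumD(1-3)[OF assms(1)] state_spectrumD(1-3)[OF assms(2)])

section \<open>The trace norm\<close>

lemma order_prod_linear:
  fixes c :: "nat \<Rightarrow> complex"
  shows "order x (\<Prod>i<n. [:- c i, 1:]) = card {i. i < n \<and> c i = x}"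
proof (induction n)
  case (Suc n)
  have lin: "order x [:- c n, 1:] = (if c n = x then 1 else 0)"
  proof (cases "c n = x")
    case True
    then show ?thesis using order_power_n_n[of x 1] by simp
  next
    case False
    then show ?thesis by (simp add: order_0I)
  qed
  have set: "{i. i < Suc n \<and> c i = x}
      = (if c n = x then insert n {i. i < n \<and> c i = x} else {i. i < n \<and> c i = x})"
    by (auto simp: less_Suc_eq)
  have "order x (\<Prod>i<Suc n. [:- c i, 1:]) = order x (\<Prod>i<n. [:- c i, 1:]) + order x [:- c n, 1:]"
    unfolding prod.lessThan_Suc by (rule order_mult, rule no_zero_divisors) (auto simp: prod_zero_iff)
  then show ?case unfolding lin set Suc by simp
qed simp

text \<open>\<open>mat_adjoint A * A\<close> is similar to the diagonal matrix of the squares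
  \<open>(a i)\<^sup>2\<close>, and the order of a root of its characteristic polynomial counts the
  indices with that square. Grouping the indices by their squares gives the sum, also when
  eigenvalues of opposite sign merge.\<close>

lemma trace_norm_eigenvalues:
  assumes "has_eigenvalues n P A a"
  shows "trace_norm A = (\<Sum>i<n. \<bar>a i\<bar>)"
proof -
  define B where "B = mat_adjoint A * A"
  define c where "c i = complex_of_real ((a i)\<^sup>2)" for i
  have B: "has_eigenvalues n P B (\<lambda>i. (a i)\<^sup>2)"
    using has_eigenvalues_mult[OF assms assms] has_eigenvalues_hermitian[OF assms]
    by (simp add: B_def hermitian_mat_def power2_eq_square)
  note P = has_eigenvaluesD[OF B]
  have "similar_mat B (mat_diag n c)"
    unfolding similar_mat_def
    by (rule exI[of _ P], rule exI[of _ "mat_adjoint P"], rule similar_mat_witI[of _ _ n])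
      (use P(1) has_eigenvalues_carrier[OF B] P(2) in \<open>simp_all add: unitary_mat_def c_def[abs_def]\<close>)
  then have "char_poly B = char_poly (mat_diag n c)" by (rule char_poly_similar)
  also have "\<dots> = (\<Prod>x\<leftarrow>diag_mat (mat_diag n c). [:- x, 1:])"
    by (rule char_poly_upper_triangular[of _ n]) (auto simp: upper_triangular_def)
  also have "\<dots> = (\<Prod>i<n. [:- c i, 1:])"
  proof -
    have "diag_mat (mat_diag n c) = map c [0..<n]" by (simp add: diag_mat_def)
    then show ?thesis
      using prod.distinct_set_conv_list[of "[0..<n]" "\<lambda>i. [:- c i, 1:]"]
      by (simp add: comp_def lessThan_atLeast0)
  qed
  finally have cp: "char_poly B = (\<Prod>i<n. [:- c i, 1:])" .
  have B': "B \<in> carrier_mat n n" using P by auto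
  have sp: "spectrum B = c ` {..<n}"
    unfolding spectrum_root_char_poly[OF B'] cp poly_prod by (auto simp: prod_zero_iff)
  have "trace_norm A = (\<Sum>x \<in> c ` {..<n}. \<Sum>i\<in>{i \<in> {..<n}. c i = x}. \<bar>a i\<bar>)"
    unfolding trace_norm_def Let_def B_def[symmetric] sp cp order_prod_linear
  proof (intro sum.cong refl)
    fix x assume "x \<in> c ` {..<n}"
    have "\<bar>a i\<bar> = sqrt (Re x)" if "c i = x" for i
      using that[symmetric] by (simp add: c_def)
    then show "real (card {i. i < n \<and> c i = x}) * sqrt (Re x) = (\<Sum>i\<in>{i \<in> {..<n}. c i = x}. \<bar>a i\<bar>)"
      by simp
  qed
  also have "\<dots> = (\<Sum>i<n. \<bar>a i\<bar>)" by (rule sum.group) auto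
  finally show ?thesis .
qed

section \<open>Equilibrating operations preserve equilibrium states\<close>

text \<open>A Gibbs state depends on Hamiltonian and number operator only through
  \<open>H - \<mu> N\<close>, so it is treated as a function of this one operator. Inserting a zero
  number operator into \<open>gibbs\<close> makes the eigenvalue lemmas for it available.\<close>

definition thermal :: "real \<Rightarrow> complex mat \<Rightarrow> complex mat" where
  "thermal \<beta> K = gibbs \<beta> 0 K (0\<^sub>m (dim_row K) (dim_col K))"

lemma gibbs_thermal:
  assumes "H \<in> carrier_mat n n" "N \<in> carrier_mat n n"
  shows "gibbs \<beta> \<mu> H N = thermal \<beta> (H - complex_of_real \<mu> \<cdot>\<^sub>m N)"
proof -
  have "H - complex_of_real \<mu> \<cdot>\<^sub>m N - complex_of_real 0 \<cdot>\<^sub>m 0\<^sub>m n n = H - complex_of_real \<mu> \<cdot>\<^sub>m N"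
    using carrier_matD[OF assms(1)] carrier_matD[OF assms(2)] by (intro eq_matI) auto
  then show ?thesis
    using carrier_matD[OF assms(1)] carrier_matD[OF assms(2)]
    by (simp add: thermal_def gibbs_def boltzmann_def partition_function_def)
qed

lemma has_eigenvalues_thermal:
  assumes "has_eigenvalues n P K k"
  shows "has_eigenvalues n P (thermal \<beta> K) (gibbs_weight \<beta> n k)"
proof -
  have "K - complex_of_real 0 \<cdot>\<^sub>m 0\<^sub>m (dim_row K) (dim_col K) = K"
    by (intro eq_matI) auto
  then show ?thesis unfolding thermal_def using assms by (intro has_eigenvalues_gibbs) simp
qed

text \<open>Conjugation moves the eigenbasis and keeps the eigenvalues, and the thermal state is a
  function of these.\<close>

lemma thermal_conj:
  assumes "unitary_mat n V" "hermitian_mat n K"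
  shows "thermal \<beta> (V * K * mat_adjoint V) = V * thermal \<beta> K * mat_adjoint V"
proof -
  obtain P k where K: "has_eigenvalues n P K k" using spectral_theorem[OF assms(2)] by blast
  show ?thesis
    using has_eigenvaluesD(2)[OF has_eigenvalues_thermal[OF has_eigenvalues_conj[OF assms(1) K]]]
      has_eigenvaluesD(2)[OF has_eigenvalues_conj[OF assms(1) has_eigenvalues_thermal[OF K]]]
    by simp
qed

lemma thermal_kron_sum:
  assumes "hermitian_mat n K" "hermitian_mat m L"
  shows "thermal \<beta> (kron_sum K L) = kron (thermal \<beta> K) (thermal \<beta> L)"
proof -
  obtain P k where K: "has_eigenvalues n P K k" using spectral_theorem[OF assms(1)] by blast
  obtain Q l where L: "has_eigenvalues m Q L l" using spectral_theorem[OF assms(2)] by blast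
  have "has_eigenvalues (n * m) (kron P Q) (thermal \<beta> (kron_sum K L))
      (\<lambda>i. gibbs_weight \<beta> n k (i div m) * gibbs_weight \<beta> m l (i mod m))"
    by (rule has_eigenvalues_cong[OF has_eigenvalues_thermal[OF has_eigenvalues_kron_sum[OF K L]]])
      (rule gibbs_weight_product)
  moreover have "has_eigenvalues (n * m) (kron P Q) (kron (thermal \<beta> K) (thermal \<beta> L))
      (\<lambda>i. gibbs_weight \<beta> n k (i div m) * gibbs_weight \<beta> m l (i mod m))"
    by (rule has_eigenvalues_kron[OF has_eigenvalues_thermal[OF K] has_eigenvalues_thermal[OF L]])
  ultimately show ?thesis using has_eigenvaluesD(2) by metis
qed

lemma thermal_trace:
  assumes "hermitian_mat n K" "0 < n"
  shows "mat_trace (thermal \<beta> K) = 1"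
proof -
  obtain P k where K: "has_eigenvalues n P K k" using spectral_theorem[OF assms(1)] by blast
  then show ?thesis
    using has_eigenvalues_trace[OF has_eigenvalues_thermal[OF K]] gibbs_weight_sum[OF assms(2)] by simp
qed

text \<open>The Gram form is the witness of positivity from here on: conjugation, Kronecker products
  and partial traces preserve it by explicit formulas.\<close>

lemma nonneg_eigenvalues_gram:
  assumes "has_eigenvalues n P A a" "\<And>i. i < n \<Longrightarrow> 0 \<le> a i"
  obtains L where "L \<in> carrier_mat n n" "A = L * mat_adjoint L"
proof -
  note P = has_eigenvaluesD[OF assms(1)]
  define S where "S = mat_diag n (\<lambda>i. complex_of_real (sqrt (a i)))"
  have S: "dim_row S = n" "dim_col S = n" by (simp_all add: S_def)
  have "S * mat_adjoint S = mat_diag n (\<lambda>i. complex_of_real (a i))"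
    unfolding S_def adjoint_diag mat_diag_diag
    by (rule mat_diag_cong) (simp add: assms(2) flip: of_real_mult)
  then have "A = P * (S * mat_adjoint S) * mat_adjoint P" using P(2) by simp
  also have "\<dots> = (P * S) * mat_adjoint (P * S)"
    using unitary_dims[OF P(1)] S by (simp add: adjoint_mult mult_assoc_dim)
  finally have "A = (P * S) * mat_adjoint (P * S)" .
  moreover have "P * S \<in> carrier_mat n n"
    by (rule carrier_matI) (use unitary_dims[OF P(1)] S in auto)
  ultimately show thesis by (intro that)
qed

lemma thermal_gram:
  assumes "hermitian_mat n K"
  obtains L where "L \<in> carrier_mat n n" "thermal \<beta> K = L * mat_adjoint L"
proof -
  obtain P k where K: "has_eigenvalues n P K k" using spectral_theorem[OF assms(1)] by blast
  show thesis
    by (rule nonneg_eigenvalues_gram[OF has_eigenvalues_thermal[OF K, of \<beta>]])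
      (use gibbs_weight_pos that in \<open>auto simp: less_imp_le\<close>)
qed

lemma thermal_dims:
  assumes "hermitian_mat n K"
  shows "dim_row (thermal \<beta> K) = n" "dim_col (thermal \<beta> K) = n"
proof -
  obtain P k where "has_eigenvalues n P K k" using spectral_theorem[OF assms(1)] by blast
  from has_eigenvaluesD(3,4)[OF has_eigenvalues_thermal[OF this]]
  show "dim_row (thermal \<beta> K) = n" "dim_col (thermal \<beta> K) = n" by auto
qed

lemma hermitian_dims: "hermitian_mat n A \<Longrightarrow> dim_row A = n" "hermitian_mat n A \<Longrightarrow> dim_col A = n"
  by (auto simp: hermitian_mat_def)

lemma hermitian_grand:
  assumes "hermitian_mat n H" "hermitian_mat n N"
  shows "hermitian_mat n (H - complex_of_real \<mu> \<cdot>\<^sub>m N)"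
  using assms unfolding hermitian_mat_def by (auto simp: adjoint_minus adjoint_smult)

lemma kron_sum_dims:
  "dim_row A = dim_col A \<Longrightarrow> dim_row B = dim_col B \<Longrightarrow> dim_row (kron_sum A B) = dim_row A * dim_row B"
  "dim_row A = dim_col A \<Longrightarrow> dim_row B = dim_col B \<Longrightarrow> dim_col (kron_sum A B) = dim_row A * dim_row B"
  by (auto simp: kron_sum_def)

lemma hermitian_kron_sum:
  assumes "hermitian_mat n A" "hermitian_mat m B"
  shows "hermitian_mat (n * m) (kron_sum A B)"
proof -
  obtain P a where A: "has_eigenvalues n P A a" using spectral_theorem[OF assms(1)] by blast
  obtain Q b where B: "has_eigenvalues m Q B b" using spectral_theorem[OF assms(2)] by blast
  show ?thesis by (rule has_eigenvalues_hermitian[OF has_eigenvalues_kron_sum[OF A B]])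
qed

lemma kron_sum_grand:
  assumes "hermitian_mat n H" "hermitian_mat n N" "hermitian_mat m H'" "hermitian_mat m N'"
  shows "kron_sum H H' - c \<cdot>\<^sub>m kron_sum N N' = kron_sum (H - c \<cdot>\<^sub>m N) (H' - c \<cdot>\<^sub>m N')"
  by (rule eq_mat_pairI[of _ n m n m])
    (use assms in \<open>auto simp: kron_sum_def hermitian_dims index_pair_less ring_distribs\<close>)

text \<open>The Stinespring form of a quantum channel with environment state
  \<open>\<gamma>\<close>.\<close>

definition channel :: "nat \<Rightarrow> nat \<Rightarrow> complex mat \<Rightarrow> complex mat \<Rightarrow> complex mat \<Rightarrow> complex mat" where
  "channel dY dA V \<gamma> M = partial_trace dY dA (V * kron M \<gamma> * mat_adjoint V)"

lemma partial_trace_dims [simp]: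
  "dim_row (partial_trace dY dA M) = dY" "dim_col (partial_trace dY dA M) = dY"
  by (auto simp: partial_trace_def)

lemma partial_trace_index [simp]:
  "i < dY \<Longrightarrow> j < dY \<Longrightarrow> partial_trace dY dA M $$ (i, j) = (\<Sum>k<dA. M $$ (i * dA + k, j * dA + k))"
  by (auto simp: partial_trace_def)

lemma partial_trace_kron:
  assumes "dim_row A = n" "dim_col A = n" "dim_row B = m" "dim_col B = m"
  shows "partial_trace n m (kron A B) = mat_trace B \<cdot>\<^sub>m A"
  by (rule eq_matI) (use assms in \<open>auto simp: mat_trace_def sum_distrib_left mult.commute\<close>)

lemma partial_trace_trace:
  "dim_row M = dY * dA \<Longrightarrow> mat_trace (partial_trace dY dA M) = mat_trace M"
  by (simp add: mat_trace_def sum_mult_split)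

lemma hdim_compose: "hdim (compose R S) = hdim R * hdim S"
  by (simp add: hdim_def compose_def)

text \<open>With \<open>V = T * U\<close>, conservation shows that \<open>V\<close> carries the
  operator \<open>H - \<mu> N\<close> of \<open>X + G\<close> to the sum of those of
  \<open>Y\<close> and of the discarded system. The joint Gibbs state is a product on both sides, so
  it is carried to the product of the Gibbs states of the two parts, and tracing out one of them
  leaves the other.\<close>

theorem equilibrating_channel:
  assumes eq: "equilibrating \<beta> \<mu> X Y"
    and X: "hermitian_mat (hdim X) (ham X)" "hermitian_mat (hdim X) (numop X)"
      "0 < hdim X" "dens X \<in> carrier_mat (hdim X) (hdim X)"
    and Y: "hermitian_mat (hdim Y) (ham Y)" "hermitian_mat (hdim Y) (numop Y)"
  obtains V n dA L where "unitary_mat (hdim X * n) V" "hdim X * n = hdim Y * dA"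
    "L \<in> carrier_mat n n" "mat_trace (L * mat_adjoint L) = 1"
    "dens Y = channel (hdim Y) dA V (L * mat_adjoint L) (dens X)"
    "gibbs \<beta> \<mu> (ham Y) (numop Y)
      = channel (hdim Y) dA V (L * mat_adjoint L) (gibbs \<beta> \<mu> (ham X) (numop X))"
proof -
  obtain G U T dA HA NA where free: "free_state \<beta> \<mu> G"
    and U: "unitary_mat (hdim X * hdim G) U" "U * ham (compose X G) = ham (compose X G) * U"
      "U * numop (compose X G) = numop (compose X G) * U"
    and d: "hdim X * hdim G = hdim Y * dA"
    and A: "hermitian_mat dA HA" "hermitian_mat dA NA"
    and T: "unitary_mat (hdim X * hdim G) T"
      "T * ham (compose X G) * mat_adjoint T = kron_sum (ham Y) HA"
      "T * numop (compose X G) * mat_adjoint T = kron_sum (numop Y) NA"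
    and dY: "dens Y = partial_trace (hdim Y) dA
      (T * (U * dens (compose X G) * mat_adjoint U) * mat_adjoint T)"
    using eq unfolding equilibrating_def Let_def hdim_compose by blast
  have stG: "is_state G" and gG: "dens G = gibbs \<beta> \<mu> (ham G) (numop G)"
    using free by (auto simp: free_state_def)
  define n where "n = hdim G"
  define d where "d = hdim X * n"
  have G: "hermitian_mat n (ham G)" "hermitian_mat n (numop G)" "mat_trace (dens G) = 1"
    using stG by (auto simp: is_state_def density_mat_def n_def)
  have n: "0 < n" using G(3) by (auto simp: mat_trace_def n_def hdim_def intro!: gr0I)
  define K where "K S = ham S - complex_of_real \<mu> \<cdot>\<^sub>m numop S" for S :: qsystem
  define KA where "KA = HA - complex_of_real \<mu> \<cdot>\<^sub>m NA"
  have KX: "hermitian_mat (hdim X) (K X)" and KG: "hermitian_mat n (K G)"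
    and KY: "hermitian_mat (hdim Y) (K Y)" and KA: "hermitian_mat dA KA"
    unfolding K_def KA_def using X Y A G by (auto intro: hermitian_grand)
  define V where "V = T * U"
  have V: "unitary_mat d V"
    unfolding V_def using U(1) T(1) by (auto simp: d_def n_def intro: unitary_mult)
  note dims = unitary_dims[OF V] unitary_dims[OF U(1), folded n_def, folded d_def]
    unitary_dims[OF T(1), folded n_def, folded d_def]
  \<comment> \<open>Conjugation by \<open>U\<close> fixes whatever commutes with it; this is where
    conservation of energy and number enters.\<close>
  have conj: "V * M * mat_adjoint V = T * M * mat_adjoint T"
    if "U * M = M * U" "dim_row M = d" "dim_col M = d" for M
  proof -
    have "V * M * mat_adjoint V = T * (U * M) * mat_adjoint U * mat_adjoint T"
      using that dims by (simp add: V_def adjoint_mult mult_assoc_dim)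
    also have "\<dots> = T * M * (U * mat_adjoint U) * mat_adjoint T"
      using that dims by (simp add: mult_assoc_dim)
    also have "\<dots> = T * M * mat_adjoint T"
      using U(1) that dims by (simp add: unitary_mat_def n_def[symmetric] d_def[symmetric] right_mult_one_mat[of _ d d])
    finally show ?thesis .
  qed
  have cd: "dim_row (ham (compose X G)) = d" "dim_col (ham (compose X G)) = d"
    "dim_row (numop (compose X G)) = d" "dim_col (numop (compose X G)) = d"
    using X G by (auto simp: compose_def kron_sum_dims hermitian_dims d_def)
  have "V * kron_sum (K X) (K G) * mat_adjoint V
    = V * (ham (compose X G) - complex_of_real \<mu> \<cdot>\<^sub>m numop (compose X G)) * mat_adjoint V"
    unfolding K_def compose_def using X G by (simp add: kron_sum_grand)
  also have "\<dots> = V * ham (compose X G) * mat_adjoint V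
      - complex_of_real \<mu> \<cdot>\<^sub>m (V * numop (compose X G) * mat_adjoint V)"
    using cd dims
    by (simp add: mult_minus_dim minus_mult_dim mult_smult_dim smult_mult_dim)
  also have "\<dots> = kron_sum (ham Y) HA - complex_of_real \<mu> \<cdot>\<^sub>m kron_sum (numop Y) NA"
    using conj[OF U(2)] conj[OF U(3)] cd T(2,3) by simp
  also have "\<dots> = kron_sum (K Y) KA"
    unfolding K_def KA_def using Y A by (simp add: kron_sum_grand)
  finally have KK: "V * kron_sum (K X) (K G) * mat_adjoint V = kron_sum (K Y) KA" .
  have dA: "0 < dA" using d n X(3) by (auto simp: n_def intro!: gr0I)
  have g: "gibbs \<beta> \<mu> (ham S) (numop S) = thermal \<beta> (K S)"
    if "hermitian_mat m (ham S)" "hermitian_mat m (numop S)" for S m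
    using that unfolding K_def by (intro gibbs_thermal[of _ m]) (auto simp: hermitian_mat_def)
  obtain L where L: "L \<in> carrier_mat n n" "thermal \<beta> (K G) = L * mat_adjoint L"
    using thermal_gram[OF KG] by blast
  have dG: "dens G = L * mat_adjoint L" unfolding gG g[OF G(1,2)] L(2) ..
  show thesis
  proof (rule that)
    show "unitary_mat (hdim X * n) V" using V by (simp add: d_def)
    show "hdim X * n = hdim Y * dA" using d by (simp add: n_def)
    show "L \<in> carrier_mat n n" by (rule L)
    show "mat_trace (L * mat_adjoint L) = 1" using G(3) dG by simp
    have "dim_row (dens (compose X G)) = d" unfolding compose_def d_def n_def hdim_def by simp
    moreover have "dim_col (dens (compose X G)) = d"
      unfolding compose_def d_def n_def using carrier_matD[OF X(4)] carrier_matD[OF state_dims(1)[OF stG]]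
      by simp
    ultimately show "dens Y = channel (hdim Y) dA V (L * mat_adjoint L) (dens X)"
      unfolding dY channel_def dG[symmetric] V_def using dims
      by (simp add: compose_def adjoint_mult mult_assoc_dim)
    have "V * kron (thermal \<beta> (K X)) (thermal \<beta> (K G)) * mat_adjoint V
        = kron (thermal \<beta> (K Y)) (thermal \<beta> KA)"
      using thermal_conj[OF V, of "kron_sum (K X) (K G)" \<beta>] hermitian_kron_sum[OF KX KG]
      by (simp add: KK d_def thermal_kron_sum[OF KX KG] thermal_kron_sum[OF KY KA])
    then show "gibbs \<beta> \<mu> (ham Y) (numop Y)
      = channel (hdim Y) dA V (L * mat_adjoint L) (gibbs \<beta> \<mu> (ham X) (numop X))"
      unfolding channel_def g[OF X(1,2)] g[OF Y] L(2)[symmetric]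
      using thermal_dims[OF KY] thermal_dims[OF KA] thermal_trace[OF KA dA]
      by (simp add: partial_trace_kron one_smult_mat)
  qed
qed

section \<open>Effects\<close>

lemma gram_index:
  "i < dim_row L \<Longrightarrow>
    (L * mat_adjoint L) $$ (i, i) = complex_of_real (\<Sum>k<dim_col L. (cmod (L $$ (i, k)))\<^sup>2)"
  by (subst index_mult_mat_sum) (auto simp flip: complex_norm_square)

lemma trace_gram:
  "mat_trace (L * mat_adjoint L) = complex_of_real (\<Sum>i<dim_row L. \<Sum>k<dim_col L. (cmod (L $$ (i, k)))\<^sup>2)"
  unfolding mat_trace_def by (simp add: gram_index del: index_mult_mat(1))

lemma trace_gram_adjoint: "mat_trace (mat_adjoint L * L) = mat_trace (L * mat_adjoint L)"
  by (rule trace_mult_comm) auto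

lemma trace_minus:
  "dim_row A = dim_row B \<Longrightarrow> dim_row A = dim_col A \<Longrightarrow> dim_col A = dim_col B \<Longrightarrow>
    mat_trace (A - B) = mat_trace A - mat_trace B"
  by (simp add: mat_trace_def sum_subtractf)

text \<open>The difference of the traces is the trace of the Gram matrix of \<open>K\<close>, the
  part of \<open>L\<close> orthogonal to the range of \<open>W\<close>, and so it is
  nonnegative.\<close>

lemma trace_isometry_le:
  assumes W: "W \<in> carrier_mat n m" "mat_adjoint W * W = 1\<^sub>m m" and L: "L \<in> carrier_mat n k"
  shows "Re (mat_trace (mat_adjoint W * L * mat_adjoint (mat_adjoint W * L)))
    \<le> Re (mat_trace (L * mat_adjoint L))"
proof -
  note d = carrier_matD[OF W(1)] carrier_matD[OF L]
  define K where "K = L - W * (mat_adjoint W * L)"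
  define Q where "Q = mat_adjoint W * L"
  have Q: "dim_row Q = m" "dim_col Q = k" using d by (auto simp: Q_def)
  have "mat_adjoint W * (W * Q) = (mat_adjoint W * W) * Q"
    by (rule mult_assoc_dim[symmetric]) (use d Q in auto)
  also have "\<dots> = Q" unfolding W(2) by (rule left_mult_one_mat[of Q m k]) (use Q in auto)
  finally have WQ: "mat_adjoint W * (W * Q) = Q" .
  have "mat_adjoint L * (W * Q) = (mat_adjoint L * W) * Q"
    by (rule mult_assoc_dim[symmetric]) (use d Q in auto)
  also have "mat_adjoint L * W = mat_adjoint Q" unfolding Q_def using d by (simp add: adjoint_mult)
  finally have LQ: "mat_adjoint L * (W * Q) = mat_adjoint Q * Q" .
  have "mat_adjoint K * K = (mat_adjoint L - mat_adjoint (W * Q)) * (L - W * Q)"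
    using d Q by (simp add: K_def adjoint_minus flip: Q_def)
  also have "\<dots> = mat_adjoint L * L - mat_adjoint (W * Q) * L
      - (mat_adjoint L * (W * Q) - mat_adjoint (W * Q) * (W * Q))"
    using d Q by (simp add: mult_minus_dim minus_mult_dim)
  also have "mat_adjoint (W * Q) * L = mat_adjoint Q * Q"
    using d Q by (simp add: adjoint_mult mult_assoc_dim flip: Q_def)
  also have "mat_adjoint (W * Q) * (W * Q) = mat_adjoint Q * Q"
    using d Q WQ by (simp add: adjoint_mult mult_assoc_dim)
  finally have "mat_trace (mat_adjoint K * K)
      = mat_trace (mat_adjoint L * L) - mat_trace (mat_adjoint Q * Q)"
    using d Q LQ by (simp add: trace_minus)
  then have "mat_trace (K * mat_adjoint K)
      = mat_trace (L * mat_adjoint L) - mat_trace (Q * mat_adjoint Q)"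
    by (simp add: trace_gram_adjoint)
  moreover have "0 \<le> Re (mat_trace (K * mat_adjoint K))"
    unfolding trace_gram by (auto intro!: sum_nonneg)
  ultimately show ?thesis by (simp add: Q_def)
qed

text \<open>A two-outcome measurement operator \<open>0 \<le> Q \<le> 1\<close>, represented by the functional \<open>M \<mapsto> tr (Q M)\<close>.\<close>

definition effect :: "nat \<Rightarrow> (complex mat \<Rightarrow> real) \<Rightarrow> bool" where
  "effect n f \<longleftrightarrow>
    (\<forall>A \<in> carrier_mat n n. \<forall>B \<in> carrier_mat n n. f (A + B) = f A + f B) \<and>
    (\<forall>c. \<forall>A \<in> carrier_mat n n. f (complex_of_real c \<cdot>\<^sub>m A) = c * f A) \<and>
    (\<forall>k. \<forall>L \<in> carrier_mat n k. 0 \<le> f (L * mat_adjoint L) \<and>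
      f (L * mat_adjoint L) \<le> Re (mat_trace (L * mat_adjoint L)))"

lemma effectD:
  assumes "effect n f"
  shows "A \<in> carrier_mat n n \<Longrightarrow> B \<in> carrier_mat n n \<Longrightarrow> f (A + B) = f A + f B"
    "A \<in> carrier_mat n n \<Longrightarrow> f (complex_of_real c \<cdot>\<^sub>m A) = c * f A"
    "L \<in> carrier_mat n k \<Longrightarrow> 0 \<le> f (L * mat_adjoint L)"
    "L \<in> carrier_mat n k \<Longrightarrow> f (L * mat_adjoint L) \<le> Re (mat_trace (L * mat_adjoint L))"
  using assms by (auto simp: effect_def)

lemma effect_minus:
  assumes f: "effect n f" and A: "A \<in> carrier_mat n n" and B: "B \<in> carrier_mat n n"
  shows "f (A - B) = f A - f B"
proof -
  have "A - B = A + complex_of_real (- 1) \<cdot>\<^sub>m B"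
    using A B by (intro eq_matI) auto
  then show ?thesis using effectD(1)[OF f A, of "complex_of_real (- 1) \<cdot>\<^sub>m B"] effectD(2)[OF f B, of "- 1"] B
    by simp
qed

text \<open>The projective measurement onto the span of the columns of \<open>W\<close> with index
  in \<open>S\<close>.\<close>

lemma effect_projection:
  assumes W: "W \<in> carrier_mat n m" "mat_adjoint W * W = 1\<^sub>m m" and S: "S \<subseteq> {..<m}"
  shows "effect n (\<lambda>A. \<Sum>c\<in>S. Re ((mat_adjoint W * A * W) $$ (c, c)))"
proof -
  note d = carrier_matD[OF W(1)]
  have Sm: "c < m" if "c \<in> S" for c using S that by auto
  have gram: "mat_adjoint W * (L * mat_adjoint L) * W = (mat_adjoint W * L) * mat_adjoint (mat_adjoint W * L)"
    if "L \<in> carrier_mat n k" for L k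
    using d carrier_matD[OF that] by (simp add: adjoint_mult mult_assoc_dim)
  have diag: "Re ((mat_adjoint W * (L * mat_adjoint L) * W) $$ (c, c))
      = (\<Sum>j<k. (cmod ((mat_adjoint W * L) $$ (c, j)))\<^sup>2)"
    if "L \<in> carrier_mat n k" "c < m" for L k c
    using gram_index[of c "mat_adjoint W * L"] d carrier_matD[OF that(1)] that(2)
    unfolding gram[OF that(1)] by simp
  show ?thesis
    unfolding effect_def
  proof (intro conjI ballI allI)
    fix A B :: "complex mat" assume A: "A \<in> carrier_mat n n" and B: "B \<in> carrier_mat n n"
    have "mat_adjoint W * (A + B) * W = mat_adjoint W * A * W + mat_adjoint W * B * W"
      using d carrier_matD[OF A] carrier_matD[OF B] by (simp add: mult_add_dim add_mult_dim)
    then show "(\<Sum>c\<in>S. Re ((mat_adjoint W * (A + B) * W) $$ (c, c)))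
      = (\<Sum>c\<in>S. Re ((mat_adjoint W * A * W) $$ (c, c))) + (\<Sum>c\<in>S. Re ((mat_adjoint W * B * W) $$ (c, c)))"
      using d Sm by (simp add: sum.distrib del: index_mult_mat(1))
  next
    fix c :: real and A :: "complex mat" assume A: "A \<in> carrier_mat n n"
    have "mat_adjoint W * (complex_of_real c \<cdot>\<^sub>m A) * W = complex_of_real c \<cdot>\<^sub>m (mat_adjoint W * A * W)"
      using d carrier_matD[OF A] by (simp add: mult_smult_dim smult_mult_dim)
    then show "(\<Sum>i\<in>S. Re ((mat_adjoint W * (complex_of_real c \<cdot>\<^sub>m A) * W) $$ (i, i)))
      = c * (\<Sum>i\<in>S. Re ((mat_adjoint W * A * W) $$ (i, i)))"
      using d Sm by (simp add: sum_distrib_left del: index_mult_mat(1))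
  next
    fix k and L :: "complex mat" assume L: "L \<in> carrier_mat n k"
    show "0 \<le> (\<Sum>c\<in>S. Re ((mat_adjoint W * (L * mat_adjoint L) * W) $$ (c, c)))"
      by (rule sum_nonneg) (subst diag[OF L Sm], auto intro: sum_nonneg)
    have "(\<Sum>c\<in>S. Re ((mat_adjoint W * (L * mat_adjoint L) * W) $$ (c, c)))
        \<le> (\<Sum>c<m. Re ((mat_adjoint W * (L * mat_adjoint L) * W) $$ (c, c)))"
      by (rule sum_mono2) (use S diag[OF L] in \<open>auto simp: sum_nonneg simp del: index_mult_mat(1)\<close>)
    also have "\<dots> = Re (mat_trace (mat_adjoint W * L * mat_adjoint (mat_adjoint W * L)))"
      unfolding gram[OF L, symmetric] mat_trace_def using d by (simp del: index_mult_mat(1))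
    also have "\<dots> \<le> Re (mat_trace (L * mat_adjoint L))" by (rule trace_isometry_le[OF W L])
    finally show "(\<Sum>c\<in>S. Re ((mat_adjoint W * (L * mat_adjoint L) * W) $$ (c, c)))
        \<le> Re (mat_trace (L * mat_adjoint L))" .
  qed
qed

text \<open>Moving the traced index from the rows of \<open>Z\<close> to its columns turns the sum
  over it into part of a matrix product.\<close>

lemma partial_trace_gram:
  assumes "Z \<in> carrier_mat (dY * dA) q"
  obtains Z' where "Z' \<in> carrier_mat dY (dA * q)"
    "partial_trace dY dA (Z * mat_adjoint Z) = Z' * mat_adjoint Z'"
proof
  define Z' where "Z' = Matrix.mat dY (dA * q) (\<lambda>(i, l). Z $$ (i * dA + l div q, l mod q))"
  show Z': "Z' \<in> carrier_mat dY (dA * q)" by (simp add: Z'_def)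
  note d = carrier_matD[OF assms] carrier_matD[OF Z']
  have Zi: "Z' $$ (i, k * q + l) = Z $$ (i * dA + k, l)" if "i < dY" "k < dA" "l < q" for i k l
    using that by (simp add: Z'_def index_pair_less)
  show "partial_trace dY dA (Z * mat_adjoint Z) = Z' * mat_adjoint Z'"
  proof (rule eq_matI)
    fix i j assume "i < dim_row (Z' * mat_adjoint Z')" "j < dim_col (Z' * mat_adjoint Z')"
    then have ij: "i < dY" "j < dY" using d by auto
    have "(Z' * mat_adjoint Z') $$ (i, j) = (\<Sum>k<dA. \<Sum>l<q. Z $$ (i * dA + k, l) * cnj (Z $$ (j * dA + k, l)))"
      using ij d by (simp add: index_mult_mat_sum sum_mult_split Zi index_pair_less del: index_mult_mat(1))
    also have "\<dots> = (\<Sum>k<dA. (Z * mat_adjoint Z) $$ (i * dA + k, j * dA + k))"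
      using ij d by (simp add: index_mult_mat_sum index_pair_less del: index_mult_mat(1))
    finally show "partial_trace dY dA (Z * mat_adjoint Z) $$ (i, j) = (Z' * mat_adjoint Z') $$ (i, j)"
      using ij by simp
  qed (use d in auto)
qed

text \<open>The Heisenberg picture: a channel is linear, maps Gram matrices to Gram matrices, and
  keeps their traces because the environment has trace one. Hence an effect on the output is an
  effect on the input.\<close>

lemma effect_channel:
  assumes V: "unitary_mat (dX * n) V" and d: "dX * n = dY * dA"
    and L: "L \<in> carrier_mat n n" "mat_trace (L * mat_adjoint L) = 1" and f: "effect dY f"
  shows "effect dX (\<lambda>M. f (channel dY dA V (L * mat_adjoint L) M))"
proof -
  define \<gamma> where "\<gamma> = L * mat_adjoint L"
  have dims: "dim_row V = dX * n" "dim_col V = dX * n" "dim_row \<gamma> = n" "dim_col \<gamma> = n"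
    using unitary_dims[OF V] L(1) by (auto simp: \<gamma>_def)
  have carr: "channel dY dA V \<gamma> M \<in> carrier_mat dY dY" for M
    by (rule carrier_matI) (auto simp: channel_def)
  show ?thesis
    unfolding \<gamma>_def[symmetric] effect_def
  proof (intro conjI ballI allI)
    fix A B :: "complex mat" assume A: "A \<in> carrier_mat dX dX" and B: "B \<in> carrier_mat dX dX"
    have "V * kron (A + B) \<gamma> * mat_adjoint V = V * kron A \<gamma> * mat_adjoint V + V * kron B \<gamma> * mat_adjoint V"
      using dims carrier_matD[OF A] carrier_matD[OF B]
      by (simp add: kron_add_left mult_add_dim add_mult_dim)
    then have "channel dY dA V \<gamma> (A + B) = channel dY dA V \<gamma> A + channel dY dA V \<gamma> B"
      unfolding channel_def using dims d
      by (intro eq_matI) (auto simp: index_pair_less sum.distrib simp del: index_mult_mat(1))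
    then show "f (channel dY dA V \<gamma> (A + B)) = f (channel dY dA V \<gamma> A) + f (channel dY dA V \<gamma> B)"
      using effectD(1)[OF f carr carr] by simp
  next
    fix c :: real and A :: "complex mat" assume A: "A \<in> carrier_mat dX dX"
    have "V * kron (complex_of_real c \<cdot>\<^sub>m A) \<gamma> * mat_adjoint V = complex_of_real c \<cdot>\<^sub>m (V * kron A \<gamma> * mat_adjoint V)"
      using dims carrier_matD[OF A] by (simp add: kron_smult_left mult_smult_dim smult_mult_dim)
    then have "channel dY dA V \<gamma> (complex_of_real c \<cdot>\<^sub>m A) = complex_of_real c \<cdot>\<^sub>m channel dY dA V \<gamma> A"
      unfolding channel_def using dims d
      by (intro eq_matI) (auto simp: index_pair_less sum_distrib_left simp del: index_mult_mat(1))
    then show "f (channel dY dA V \<gamma> (complex_of_real c \<cdot>\<^sub>m A)) = c * f (channel dY dA V \<gamma> A)"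
      using effectD(2)[OF f carr] by simp
  next
    fix k and K :: "complex mat" assume K: "K \<in> carrier_mat dX k"
    define Z where "Z = V * kron K L"
    have Z: "Z \<in> carrier_mat (dY * dA) (k * n)"
      by (rule carrier_matI) (use dims carrier_matD[OF K] carrier_matD[OF L(1)] d in \<open>auto simp: Z_def\<close>)
    have "kron (K * mat_adjoint K) \<gamma> = kron K L * mat_adjoint (kron K L)"
      unfolding \<gamma>_def by (simp add: adjoint_kron kron_mult)
    then have ZZ: "V * kron (K * mat_adjoint K) \<gamma> * mat_adjoint V = Z * mat_adjoint Z"
      using dims carrier_matD[OF K] carrier_matD[OF L(1)]
      by (simp add: Z_def adjoint_mult mult_assoc_dim)
    obtain Z' where Z': "Z' \<in> carrier_mat dY (dA * (k * n))"
      "channel dY dA V \<gamma> (K * mat_adjoint K) = Z' * mat_adjoint Z'"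
      using partial_trace_gram[OF Z] unfolding channel_def ZZ by blast
    have "mat_trace (Z' * mat_adjoint Z') = mat_trace (Z * mat_adjoint Z)"
      unfolding Z'(2)[symmetric] channel_def ZZ
      by (rule partial_trace_trace) (use carrier_matD[OF Z] in simp)
    also have "\<dots> = mat_trace (kron (K * mat_adjoint K) \<gamma>)"
      unfolding ZZ[symmetric]
      by (rule trace_unitary_conj[OF V], rule carrier_matI)
        (use dims carrier_matD[OF K] in auto)
    also have "\<dots> = mat_trace (K * mat_adjoint K)"
      using L(2) dims by (simp add: trace_kron flip: \<gamma>_def)
    finally have tr: "mat_trace (Z' * mat_adjoint Z') = mat_trace (K * mat_adjoint K)" .
    show "0 \<le> f (channel dY dA V \<gamma> (K * mat_adjoint K))"
      unfolding Z'(2) by (rule effectD(3)[OF f Z'(1)])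
    show "f (channel dY dA V \<gamma> (K * mat_adjoint K)) \<le> Re (mat_trace (K * mat_adjoint K))"
      unfolding Z'(2) tr[symmetric] by (rule effectD(4)[OF f Z'(1)])
  qed
qed

text \<open>This is all that \<open>gain_converse\<close> and \<open>cost_converse\<close> use about
  an exact operation: one test \<open>F\<close> reproduces the statistics of \<open>f\<close> on the
  actual state and on the equilibrium state at once.\<close>

lemma equilibrating_pullback:
  assumes "equilibrating \<beta> \<mu> X Y" "effect (hdim Y) f"
    and "hermitian_mat (hdim X) (ham X)" "hermitian_mat (hdim X) (numop X)"
      "0 < hdim X" "dens X \<in> carrier_mat (hdim X) (hdim X)"
    and "hermitian_mat (hdim Y) (ham Y)" "hermitian_mat (hdim Y) (numop Y)"
  obtains F where "effect (hdim X) F" "F (dens X) = f (dens Y)"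
    "F (gibbs \<beta> \<mu> (ham X) (numop X)) = f (gibbs \<beta> \<mu> (ham Y) (numop Y))"
  using equilibrating_channel[OF assms(1,3-8)] effect_channel[OF _ _ _ _ assms(2)] by metis

text \<open>\<open>t i\<close> is the value of the effect on the projection onto column
  \<open>i\<close>, and linearity does the rest. \<open>U\<close> is an isometry rather than a
  unitary, because in \<open>gain_converse\<close> its columns are the system eigenvectors tensored
  with one battery vector.\<close>

lemma effect_diag:
  assumes f: "effect n f" and U: "U \<in> carrier_mat n m" "mat_adjoint U * U = 1\<^sub>m m"
  obtains t where "\<And>i. i < m \<Longrightarrow> 0 \<le> t i" "\<And>i. i < m \<Longrightarrow> t i \<le> 1"
    "\<And>a. f (U * mat_diag m (\<lambda>i. complex_of_real (a i)) * mat_adjoint U) = (\<Sum>i<m. a i * t i)"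
proof
  note d = carrier_matD[OF U(1)]
  define D where "D a = U * mat_diag m (\<lambda>i. complex_of_real (a i)) * mat_adjoint U" for a :: "nat \<Rightarrow> real"
  define e where "e i = (\<lambda>j. if j = i then 1 else 0 :: real)" for i :: nat
  define t where "t i = f (D (e i))" for i
  have D: "D a \<in> carrier_mat n n" for a
    by (rule carrier_matI) (use d in \<open>auto simp: D_def\<close>)
  have add: "D (\<lambda>i. a i + b i) = D a + D b" for a b
  proof -
    have "mat_diag m (\<lambda>i. complex_of_real (a i + b i))
      = mat_diag m (\<lambda>i. complex_of_real (a i)) + mat_diag m (\<lambda>i. complex_of_real (b i))"
      by (rule eq_matI) auto
    then show ?thesis using d by (simp add: D_def mult_add_dim add_mult_dim)
  qed
  have smult: "D (\<lambda>i. c * a i) = complex_of_real c \<cdot>\<^sub>m D a" for a c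
  proof -
    have "mat_diag m (\<lambda>i. complex_of_real (c * a i))
      = complex_of_real c \<cdot>\<^sub>m mat_diag m (\<lambda>i. complex_of_real (a i))"
      by (rule eq_matI) auto
    then show ?thesis using d by (simp add: D_def mult_smult_dim smult_mult_dim)
  qed
  have gram: "D (e i) = (U * mat_diag m (\<lambda>j. complex_of_real (e i j)))
      * mat_adjoint (U * mat_diag m (\<lambda>j. complex_of_real (e i j)))" for i
  proof -
    have "mat_diag m (\<lambda>j. complex_of_real (e i j)) * mat_diag m (\<lambda>j. cnj (complex_of_real (e i j)))
      = mat_diag m (\<lambda>j. complex_of_real (e i j))"
      unfolding mat_diag_diag by (rule mat_diag_cong) (simp add: e_def)
    then have "D (e i) = U * (mat_diag m (\<lambda>j. complex_of_real (e i j))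
        * mat_diag m (\<lambda>j. cnj (complex_of_real (e i j)))) * mat_adjoint U"
      unfolding D_def by simp
    then show ?thesis
      using d by (simp add: adjoint_mult adjoint_diag mult_assoc_dim del: mat_diag_diag)
  qed
  have tr: "mat_trace (D (e i)) = 1" if "i < m" for i
  proof -
    have "mat_trace (D (e i)) = mat_trace (mat_adjoint U * (U * mat_diag m (\<lambda>j. complex_of_real (e i j))))"
      unfolding D_def by (rule trace_mult_comm) (use d in auto)
    also have "\<dots> = mat_trace (mat_diag m (\<lambda>j. complex_of_real (e i j)))"
      by (subst mult_assoc_dim[symmetric]) (use d U(2) in \<open>auto simp: left_mult_one_mat[of _ m m]\<close>)
    also have "\<dots> = 1" using that by (simp add: trace_diag e_def flip: of_real_sum)
    finally show ?thesis .
  qed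
  have c: "U * mat_diag m (\<lambda>j. complex_of_real (e i j)) \<in> carrier_mat n m" for i
    by (rule carrier_matI) (use d in auto)
  show "0 \<le> t i" for i unfolding t_def gram by (rule effectD(3)[OF f c])
  show "t i \<le> 1" if "i < m" for i
    using effectD(4)[OF f c, of i] tr[OF that] unfolding t_def gram[symmetric] by simp
  fix a :: "nat \<Rightarrow> real"
  \<comment> \<open>Additivity of an effect is binary, so the diagonal is filled one entry at a
    time.\<close>
  have "f (D (\<lambda>i. if i < k then a i else 0)) = (\<Sum>i<k. a i * t i)" for k
  proof (induction k)
    case 0
    have "D (\<lambda>i. 0) = complex_of_real 0 \<cdot>\<^sub>m D (\<lambda>i. 0)" using smult[of 0 "\<lambda>_. 0"] by simp
    then show ?case using effectD(2)[OF f D, of 0 "\<lambda>_. 0"] by simp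
  next
    case (Suc k)
    have "(\<lambda>i. if i < Suc k then a i else 0) = (\<lambda>i. (if i < k then a i else 0) + a k * e k i)"
      by (auto simp: e_def less_Suc_eq)
    then show ?case
      using Suc effectD(2)[OF f D, of "a k" "e k"] D
        effectD(1)[OF f D[of "\<lambda>i. if i < k then a i else 0"], of "complex_of_real (a k) \<cdot>\<^sub>m D (e k)"]
      by (simp add: add smult t_def)
  qed
  moreover have "D (\<lambda>i. if i < m then a i else 0) = D a"
    unfolding D_def by (simp cong: mat_diag_cong)
  ultimately show "f (U * mat_diag m (\<lambda>i. complex_of_real (a i)) * mat_adjoint U) = (\<Sum>i<m. a i * t i)"
    unfolding D_def[symmetric] by metis
qed

text \<open>As the trace vanishes, the test \<open>t\<close> may be shifted by 1/2 for free, after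
  which its entries have absolute value at most 1/2.\<close>

lemma effect_trace_norm:
  assumes f: "effect n f" and A: "hermitian_mat n A" "mat_trace A = 0"
  shows "\<bar>f A\<bar> \<le> trace_norm A / 2"
proof -
  obtain P a where P: "has_eigenvalues n P A a" using spectral_theorem[OF A(1)] by blast
  note D = has_eigenvaluesD[OF P]
  obtain t where t: "\<And>i. i < n \<Longrightarrow> 0 \<le> t i" "\<And>i. i < n \<Longrightarrow> t i \<le> 1"
    "\<And>a. f (P * mat_diag n (\<lambda>i. complex_of_real (a i)) * mat_adjoint P) = (\<Sum>i<n. a i * t i)"
    using effect_diag[OF f, of P n] D(1) unfolding unitary_mat_def by metis
  have z: "(\<Sum>i<n. a i) = 0" using has_eigenvalues_trace[OF P] A(2) by (metis of_real_eq_0_iff)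
  have "f A = (\<Sum>i<n. a i * t i)" using t(3)[of a] D(2) by simp
  also have "\<dots> = (\<Sum>i<n. a i * (t i - 1 / 2))"
    using z by (simp add: right_diff_distrib sum_subtractf flip: sum_divide_distrib)
  also have "\<bar>\<dots>\<bar> \<le> (\<Sum>i<n. \<bar>a i\<bar> * (1 / 2))"
  proof (rule order_trans[OF sum_abs], rule sum_mono)
    fix i assume "i \<in> {..<n}"
    then have "\<bar>t i - 1 / 2\<bar> \<le> 1 / 2" using t(1)[of i] t(2)[of i] unfolding abs_le_iff by simp
    then show "\<bar>a i * (t i - 1 / 2)\<bar> \<le> \<bar>a i\<bar> * (1 / 2)"
      unfolding abs_mult by (rule mult_left_mono) simp
  qed
  also have "\<dots> = trace_norm A / 2"
    by (simp add: trace_norm_eigenvalues[OF P] flip: sum_divide_distrib)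
  finally show ?thesis .
qed

section \<open>Upper bounds on work\<close>

lemma kron_add_right:
  "dim_row B = dim_row B' \<Longrightarrow> dim_col B = dim_col B' \<Longrightarrow> kron A (B + B') = kron A B + kron A B'"
  by (rule eq_mat_pairI[of _ "dim_row A" "dim_row B" "dim_col A" "dim_col B"])
    (simp_all add: index_pair_less ring_distribs)

lemma kron_smult_right: "kron A (c \<cdot>\<^sub>m B) = c \<cdot>\<^sub>m kron A B"
  by (rule eq_mat_pairI[of _ "dim_row A" "dim_row B" "dim_col A" "dim_col B"])
    (simp_all add: index_pair_less ring_distribs)

lemma kron_diag_one: "kron (mat_diag n a) (1\<^sub>m 1) = mat_diag n a"
  using kron_diag[of n a 1 "\<lambda>_. 1"] by simp

text \<open>With \<open>Q\<close> the projection onto the complement of the eigenvector, the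
  remainder of \<open>\<gamma>\<close> is \<open>Q * \<gamma> * Q\<close>, the Gram matrix of
  \<open>Q * M\<close>.\<close>

lemma gram_minus_eigenvector:
  assumes \<gamma>: "\<gamma> = M * mat_adjoint M" "M \<in> carrier_mat n n"
    and V: "V \<in> carrier_mat n 1" "mat_adjoint V * V = 1\<^sub>m 1"
    and ev: "\<gamma> * V = complex_of_real c \<cdot>\<^sub>m V"
  obtains L where "L \<in> carrier_mat n n"
    "\<gamma> = complex_of_real c \<cdot>\<^sub>m (V * mat_adjoint V) + L * mat_adjoint L"
proof -
  define R where "R = V * mat_adjoint V"
  define Q where "Q = 1\<^sub>m n - R"
  note d = carrier_matD[OF \<gamma>(2)] carrier_matD[OF V(1)]
  have dims: "dim_row R = n" "dim_col R = n" "dim_row Q = n" "dim_col Q = n" "dim_row \<gamma> = n" "dim_col \<gamma> = n"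
    using d \<gamma>(1) by (auto simp: R_def Q_def)
  have R: "mat_adjoint R = R" unfolding R_def using d by (simp add: adjoint_mult)
  have Q: "mat_adjoint Q = Q" unfolding Q_def using dims R by (simp add: adjoint_minus)
  have \<gamma>': "mat_adjoint \<gamma> = \<gamma>" unfolding \<gamma>(1) using d by (simp add: adjoint_mult)
  have "\<gamma> * R = (\<gamma> * V) * mat_adjoint V"
    unfolding R_def by (rule mult_assoc_dim[symmetric]) (use d dims in auto)
  then have \<gamma>R: "\<gamma> * R = complex_of_real c \<cdot>\<^sub>m R"
    unfolding ev using d by (simp add: smult_mult_dim R_def)
  have R\<gamma>: "R * \<gamma> = complex_of_real c \<cdot>\<^sub>m R"
  proof -
    have "mat_adjoint (\<gamma> * R) = R * \<gamma>" using dims R \<gamma>' by (simp add: adjoint_mult)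
    then show ?thesis unfolding \<gamma>R adjoint_smult R by simp
  qed
  have "R * R = V * (mat_adjoint V * V) * mat_adjoint V"
    using d by (simp add: R_def mult_assoc_dim)
  then have RR: "R * R = R" unfolding V(2) using V(1) right_mult_one_mat[OF V(1)] by (simp add: R_def)
  have one: "1\<^sub>m n * A = A" "A * 1\<^sub>m n = A" if "dim_row A = n" "dim_col A = n" for A :: "complex mat"
    using that by (auto intro: left_mult_one_mat[of _ n n] right_mult_one_mat[of _ n n])
  have "(Q * M) * mat_adjoint (Q * M) = Q * \<gamma> * Q"
    unfolding \<gamma>(1) using d dims Q by (simp add: adjoint_mult mult_assoc_dim)
  also have "Q * \<gamma> = \<gamma> - complex_of_real c \<cdot>\<^sub>m R"
    unfolding Q_def using dims R\<gamma> one by (simp add: minus_mult_dim)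
  also have "(\<gamma> - complex_of_real c \<cdot>\<^sub>m R) * Q
      = (\<gamma> - complex_of_real c \<cdot>\<^sub>m R) - (\<gamma> * R - complex_of_real c \<cdot>\<^sub>m (R * R))"
    unfolding Q_def using dims one by (simp add: mult_minus_dim minus_mult_dim smult_mult_dim)
  also have "\<dots> = \<gamma> - complex_of_real c \<cdot>\<^sub>m R"
    unfolding \<gamma>R RR using dims by (intro eq_matI) auto
  finally have L: "(Q * M) * mat_adjoint (Q * M) = \<gamma> - complex_of_real c \<cdot>\<^sub>m R" .
  show thesis
  proof (rule that)
    show "Q * M \<in> carrier_mat n n" by (rule carrier_matI) (use d dims in auto)
    show "\<gamma> = complex_of_real c \<cdot>\<^sub>m (V * mat_adjoint V) + (Q * M) * mat_adjoint (Q * M)"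
      unfolding L R_def[symmetric] using dims by (intro eq_matI) auto
  qed
qed

text \<open>The eigenvector becomes a one-column matrix \<open>V\<close>, and the Gibbs state of the
  battery is split into the share of this level and a positive remainder. Dropping the remainder
  gives inequalities between effects.\<close>

lemma battery_state_decomposition:
  assumes "battery_state \<beta> \<mu> E B"
  obtains V Z L where "V \<in> carrier_mat (hdim B) 1" "mat_adjoint V * V = 1\<^sub>m 1"
    "dens B = V * mat_adjoint V" "0 < Z"
    "partition_function \<beta> \<mu> (ham B) (numop B) = complex_of_real Z"
    "gibbs \<beta> \<mu> (ham B) (numop B) * V = complex_of_real (exp (- \<beta> * E) / Z) \<cdot>\<^sub>m V"
    "L \<in> carrier_mat (hdim B) (hdim B)"
    "gibbs \<beta> \<mu> (ham B) (numop B)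
      = complex_of_real (exp (- \<beta> * E) / Z) \<cdot>\<^sub>m (V * mat_adjoint V) + L * mat_adjoint L"
proof -
  define n where "n = hdim B"
  define \<gamma> where "\<gamma> = gibbs \<beta> \<mu> (ham B) (numop B)"
  obtain v where v: "v \<in> carrier_vec n" "v \<bullet>c v = 1" "dens B = outer_self v"
    and ev: "\<gamma> *\<^sub>v v = (complex_of_real (exp (- \<beta> * E)) / partition_function \<beta> \<mu> (ham B) (numop B)) \<cdot>\<^sub>v v"
    and st: "is_state B"
    using assms unfolding battery_state_def n_def \<gamma>_def by blast
  have H: "hermitian_mat n (ham B)" "hermitian_mat n (numop B)"
    using st by (auto simp: is_state_def n_def)
  obtain P k where k: "has_eigenvalues n P (ham B - complex_of_real \<mu> \<cdot>\<^sub>m numop B) k"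
    using spectral_theorem[OF hermitian_grand[OF H]] by blast
  define Z where "Z = (\<Sum>i<n. exp (- \<beta> * k i))"
  have Z: "partition_function \<beta> \<mu> (ham B) (numop B) = complex_of_real Z"
    unfolding Z_def by (rule has_eigenvalues_partition_function[OF k])
  have n: "0 < n" using v by (auto intro!: gr0I simp: scalar_prod_def)
  have "0 < Z" unfolding Z_def using n by (intro sum_pos) auto
  define V where "V = Matrix.mat n 1 (\<lambda>(i, j). v $ i)"
  have V: "V \<in> carrier_mat n 1" by (simp add: V_def)
  note d = carrier_matD[OF V]
  have \<gamma>e: "has_eigenvalues n P \<gamma> (gibbs_weight \<beta> n k)"
    unfolding \<gamma>_def by (rule has_eigenvalues_gibbs[OF k])
  note \<gamma>d = has_eigenvaluesD(3,4)[OF \<gamma>e]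
  have VV: "mat_adjoint V * V = 1\<^sub>m 1"
  proof (rule eq_matI)
    fix i j assume "i < dim_row (1\<^sub>m 1 :: complex mat)" "j < dim_col (1\<^sub>m 1 :: complex mat)"
    then have "i = 0" "j = 0" by auto
    moreover have "(mat_adjoint V * V) $$ (0, 0) = v \<bullet>c v"
      using v(1) d by (subst index_mult_mat_sum)
        (auto simp: V_def scalar_prod_def lessThan_atLeast0 mult.commute)
    ultimately show "(mat_adjoint V * V) $$ (i, j) = 1\<^sub>m 1 $$ (i, j)" using v(2) by simp
  qed (use d in auto)
  have dB: "dens B = V * mat_adjoint V"
    unfolding v(3) outer_self_def
    by (rule eq_matI) (use v(1) d in \<open>auto simp: index_mult_mat_sum V_def simp del: index_mult_mat(1)\<close>)
  have evV: "\<gamma> * V = complex_of_real (exp (- \<beta> * E) / Z) \<cdot>\<^sub>m V"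
  proof (rule eq_matI)
    fix i j
    assume "i < dim_row (complex_of_real (exp (- \<beta> * E) / Z) \<cdot>\<^sub>m V)"
      "j < dim_col (complex_of_real (exp (- \<beta> * E) / Z) \<cdot>\<^sub>m V)"
    then have i: "i < n" and j: "j = 0" using d by auto
    have "(\<gamma> * V) $$ (i, j) = (\<gamma> *\<^sub>v v) $ i"
      unfolding j using v(1) d \<gamma>d i
      by (subst index_mult_mat_sum) (auto simp: V_def scalar_prod_def lessThan_atLeast0)
    then show "(\<gamma> * V) $$ (i, j) = (complex_of_real (exp (- \<beta> * E) / Z) \<cdot>\<^sub>m V) $$ (i, j)"
      unfolding ev Z using v(1) i j d by (simp add: V_def)
  qed (use d \<gamma>d in auto)
  obtain M where M: "M \<in> carrier_mat n n" "\<gamma> = M * mat_adjoint M"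
    by (rule nonneg_eigenvalues_gram[OF \<gamma>e]) (auto simp: less_imp_le gibbs_weight_pos)
  obtain L where "L \<in> carrier_mat n n"
    "\<gamma> = complex_of_real (exp (- \<beta> * E) / Z) \<cdot>\<^sub>m (V * mat_adjoint V) + L * mat_adjoint L"
    using gram_minus_eigenvector[OF M(2,1) V VV evV] by blast
  then show thesis
    using that[of V Z L] V VV dB \<open>0 < Z\<close> Z evV unfolding n_def \<gamma>_def by blast
qed

lemma gibbs_compose:
  assumes "hermitian_mat n (ham R)" "hermitian_mat n (numop R)"
    "hermitian_mat m (ham S)" "hermitian_mat m (numop S)"
  shows "gibbs \<beta> \<mu> (ham (compose R S)) (numop (compose R S))
    = kron (gibbs \<beta> \<mu> (ham R) (numop R)) (gibbs \<beta> \<mu> (ham S) (numop S))"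
proof -
  have carr: "hermitian_mat k A \<Longrightarrow> A \<in> carrier_mat k k" for k A by (simp add: hermitian_mat_def)
  show ?thesis
    using assms hermitian_kron_sum[OF assms(1,3)] hermitian_kron_sum[OF assms(2,4)]
    by (simp add: compose_def gibbs_thermal[OF carr carr] kron_sum_grand
        thermal_kron_sum[OF hermitian_grand hermitian_grand])
qed

lemma compose_dims:
  assumes "is_state R" "is_state S"
  shows "hermitian_mat (hdim (compose R S)) (ham (compose R S))"
    "hermitian_mat (hdim (compose R S)) (numop (compose R S))"
    "dens (compose R S) \<in> carrier_mat (hdim (compose R S)) (hdim (compose R S))"
    "0 < hdim (compose R S)"
proof -
  have pos: "0 < hdim T" if "is_state T" for T
    using that by (auto simp: is_state_def density_mat_def mat_trace_def hdim_def intro!: gr0I)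
  show "hermitian_mat (hdim (compose R S)) (ham (compose R S))"
    "hermitian_mat (hdim (compose R S)) (numop (compose R S))"
    using assms unfolding hdim_compose
    by (auto simp: is_state_def compose_def intro: hermitian_kron_sum)
  show "dens (compose R S) \<in> carrier_mat (hdim (compose R S)) (hdim (compose R S))"
    unfolding hdim_compose
    using kron_carrier[OF state_dims(1)[OF assms(1)] state_dims(1)[OF assms(2)]]
    by (simp add: compose_def)
  show "0 < hdim (compose R S)" unfolding hdim_compose using pos assms by simp
qed

lemma kron_isometry:
  assumes "unitary_mat n P" "V \<in> carrier_mat m 1" "mat_adjoint V * V = 1\<^sub>m 1"
  shows "kron P V \<in> carrier_mat (n * m) n" "mat_adjoint (kron P V) * kron P V = 1\<^sub>m n"
proof -
  show "kron P V \<in> carrier_mat (n * m) n"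
    using kron_carrier[OF unitary_carrier[OF assms(1)] assms(2)] by simp
  show "mat_adjoint (kron P V) * kron P V = 1\<^sub>m n"
    using assms unitary_dims[OF assms(1)] carrier_matD[OF assms(2)] kron_one[of n 1]
    by (simp add: adjoint_kron kron_mult unitary_mat_def)
qed

lemma kron_projection:
  assumes "has_eigenvalues n P A a" "V \<in> carrier_mat m 1"
  shows "kron A (V * mat_adjoint V)
    = kron P V * mat_diag n (\<lambda>i. complex_of_real (a i)) * mat_adjoint (kron P V)"
proof -
  note D = has_eigenvaluesD[OF assms(1)]
  have "kron A (V * mat_adjoint V)
      = kron (P * mat_diag n (\<lambda>i. complex_of_real (a i)) * mat_adjoint P) (V * 1\<^sub>m 1 * mat_adjoint V)"
    using D(2) right_mult_one_mat[OF assms(2)] by simp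
  also have "\<dots> = kron P V * kron (mat_diag n (\<lambda>i. complex_of_real (a i))) (1\<^sub>m 1) * mat_adjoint (kron P V)"
    using unitary_dims[OF D(1)] carrier_matD[OF assms(2)] by (simp add: adjoint_kron kron_mult)
  finally show ?thesis unfolding kron_diag_one .
qed

text \<open>Trace distance at most \<open>\<epsilon>\<close> becomes an error of at most
  \<open>\<epsilon>\<close> in the acceptance probability. The equation for the Gibbs states remains
  exact, since these depend on Hamiltonian and number operator alone and not on the density that was
  perturbed.\<close>

lemma equilibrating_approxD:
  assumes "equilibrating_approx \<beta> \<mu> \<epsilon> X Y" "is_state Y \<or> mat_trace (dens Y) = 1 \<and> hermitian_mat (hdim Y) (dens Y)"
    and "effect (hdim Y) f"
    and "hermitian_mat (hdim X) (ham X)" "hermitian_mat (hdim X) (numop X)"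
      "0 < hdim X" "dens X \<in> carrier_mat (hdim X) (hdim X)"
  obtains F where "effect (hdim X) F" "\<bar>F (dens X) - f (dens Y)\<bar> \<le> \<epsilon>"
    "F (gibbs \<beta> \<mu> (ham X) (numop X)) = f (gibbs \<beta> \<mu> (ham Y) (numop Y))"
proof -
  obtain \<sigma> where \<sigma>: "is_state (Y\<lparr>dens := \<sigma>\<rparr>)" "hdim (Y\<lparr>dens := \<sigma>\<rparr>) = hdim Y"
    "equilibrating \<beta> \<mu> X (Y\<lparr>dens := \<sigma>\<rparr>)" "trace_norm (\<sigma> - dens Y) / 2 \<le> \<epsilon>"
    using assms(1) by (auto simp: equilibrating_approx_def)
  define n where "n = hdim Y"
  have h\<sigma>: "hermitian_mat n \<sigma>" "mat_trace \<sigma> = 1" "hermitian_mat n (ham Y)" "hermitian_mat n (numop Y)"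
    using \<sigma>(1,2) by (auto simp: is_state_def density_mat_def n_def)
  have hY: "hermitian_mat n (dens Y)" "mat_trace (dens Y) = 1"
    using assms(2) by (auto simp: is_state_def density_mat_def n_def)
  have f: "effect n f" "effect (hdim (Y\<lparr>dens := \<sigma>\<rparr>)) f"
    using assms(3) \<sigma>(2) by (auto simp: n_def)
  have "hermitian_mat n (\<sigma> - dens Y)"
    using hermitian_grand[OF h\<sigma>(1) hY(1), of 1] by (simp add: one_smult_mat)
  moreover have "mat_trace (\<sigma> - dens Y) = 0"
    using h\<sigma> hY by (simp add: trace_minus hermitian_dims)
  ultimately have "\<bar>f (\<sigma> - dens Y)\<bar> \<le> \<epsilon>"
    using effect_trace_norm[OF f(1)] \<sigma>(4) by fastforce
  moreover have "f (\<sigma> - dens Y) = f \<sigma> - f (dens Y)"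
    using effect_minus[OF f(1)] h\<sigma>(1) hY(1) by (simp add: hermitian_mat_def)
  ultimately have close: "\<bar>f \<sigma> - f (dens Y)\<bar> \<le> \<epsilon>" by simp
  show thesis
    by (rule equilibrating_pullback[OF \<sigma>(3) f(2) assms(4-7)])
      (use h\<sigma> \<sigma>(2) close that in \<open>simp_all add: n_def\<close>)
qed

lemma battery_weight_add:
  "exp (- \<beta> * (E + W)) / Z = exp (- \<beta> * E) / Z * exp (- \<beta> * W :: real)"
proof -
  have "- \<beta> * (E + W) = - \<beta> * E + - \<beta> * W" by (simp add: ring_distribs)
  then show ?thesis by (simp only: exp_add) simp
qed

lemma mult_expand_isometry:
  assumes "U \<in> carrier_mat n m" "mat_adjoint U * U = 1\<^sub>m m" "A \<in> carrier_mat m m"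
  shows "mat_adjoint U * (U * A * mat_adjoint U) * U = A"
proof -
  note d = carrier_matD[OF assms(1)] carrier_matD[OF assms(3)]
  have "mat_adjoint U * (U * A * mat_adjoint U) * U = (mat_adjoint U * U) * A * (mat_adjoint U * U)"
    using d by (simp add: mult_assoc_dim)
  then show ?thesis unfolding assms(2)
    using assms(3) left_mult_one_mat[OF assms(3)] right_mult_one_mat[OF assms(3)] by simp
qed

text \<open>In the Gibbs state of the input, the initial battery level contributes
  \<open>exp (- \<beta> * E) / Z\<close> times the \<open>g\<close>-weight of the test and the rest
  contributes a nonnegative amount; \<open>Z\<close> cancels and the \<open>g\<close>-weight is at
  most \<open>exp (- \<beta> * W)\<close>. The rest is the Neyman-Pearson argument: below the
  threshold, \<open>r i * t i\<close> is at most \<open>exp \<theta> * (g i * t i)\<close>, and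
  above it at most \<open>r i\<close>.\<close>

lemma gain_converse:
  assumes R: "state_spectrum n P R r h \<nu>"
    and g: "g = gibbs_weight \<beta> n (\<lambda>i. h i - \<mu> * \<nu> i)"
    and bat: "battery_pair \<beta> \<mu> E W B B'"
    and eq: "equilibrating_approx \<beta> \<mu> \<epsilon> (compose R B) B'"
  shows "1 - \<epsilon> - (\<Sum>i | i < n \<and> exp \<theta> * g i \<le> r i. r i) \<le> exp (\<theta> - \<beta> * W)"
proof -
  note Rd = state_spectrumD[OF R]
  have stR: "is_state R" by (rule state_spectrum_is_state[OF R])
  have b: "battery_state \<beta> \<mu> E B" "battery_state \<beta> \<mu> (E + W) B'" "ham B' = ham B" "numop B' = numop B"
    using bat by (auto simp: battery_pair_def)
  have st: "is_state B" "is_state B'" using b by (auto simp: battery_state_def)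
  define m where "m = hdim B"
  have HB: "hermitian_mat m (ham B)" "hermitian_mat m (numop B)"
    using st by (auto simp: is_state_def m_def)
  have m': "hdim B' = m"
    using st(2) b(3) HB(1) by (auto simp: is_state_def hermitian_mat_def)
  obtain V Z L where V: "V \<in> carrier_mat m 1" "mat_adjoint V * V = 1\<^sub>m 1" "dens B = V * mat_adjoint V"
    and Z: "0 < Z" "partition_function \<beta> \<mu> (ham B) (numop B) = complex_of_real Z"
    and L: "L \<in> carrier_mat m m" "gibbs \<beta> \<mu> (ham B) (numop B)
      = complex_of_real (exp (- \<beta> * E) / Z) \<cdot>\<^sub>m (V * mat_adjoint V) + L * mat_adjoint L"
    by (rule battery_state_decomposition[OF b(1), folded m_def]) (rule that)
  obtain V' Z' where V': "V' \<in> carrier_mat m 1" "mat_adjoint V' * V' = 1\<^sub>m 1" "dens B' = V' * mat_adjoint V'"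
    and Z': "partition_function \<beta> \<mu> (ham B) (numop B) = complex_of_real Z'"
      "gibbs \<beta> \<mu> (ham B) (numop B) * V' = complex_of_real (exp (- \<beta> * (E + W)) / Z') \<cdot>\<^sub>m V'"
    by (rule battery_state_decomposition[OF b(2), unfolded m' b(3,4)]) (rule that)
  \<comment> \<open>Both levels belong to one battery, hence to one partition function.\<close>
  have "Z' = Z" using Z(2) Z'(1) of_real_eq_iff[of Z' Z, where 'a = complex] by simp
  note ev' = Z'(2)[unfolded this]
  define f where "f = (\<lambda>A. \<Sum>c\<in>{0}. Re ((mat_adjoint V' * A * V') $$ (c, c)))"
  have f: "effect (hdim B') f"
    unfolding f_def m' by (rule effect_projection[OF V'(1,2)]) simp
  note X = compose_dims[OF stR st(1)]
  obtain F where F: "effect (hdim (compose R B)) F" "\<bar>F (dens (compose R B)) - f (dens B')\<bar> \<le> \<epsilon>"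
    "F (gibbs \<beta> \<mu> (ham (compose R B)) (numop (compose R B))) = f (gibbs \<beta> \<mu> (ham B') (numop B'))"
    by (rule equilibrating_approxD[OF eq _ f X(1,2,4,3)]) (use st in auto)
  have hd: "hdim (compose R B) = n * m" by (simp add: hdim_compose Rd m_def)
  define \<gamma> where "\<gamma> = gibbs \<beta> \<mu> (ham B) (numop B)"
  have \<gamma>d: "dim_row \<gamma> = m" "dim_col \<gamma> = m"
    using L carrier_matD[OF L(1)] carrier_matD[OF V(1)] by (auto simp: \<gamma>_def)
  note vd = carrier_matD[OF V'(1)]
  have f1: "f (dens B') = 1"
  proof -
    have "mat_adjoint V' * (V' * mat_adjoint V') * V' = (mat_adjoint V' * V') * (mat_adjoint V' * V')"
      using vd by (simp add: mult_assoc_dim)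
    then show ?thesis unfolding f_def V'(3) V'(2) by simp
  qed
  have f2: "f \<gamma> = exp (- \<beta> * (E + W)) / Z"
  proof -
    have "mat_adjoint V' * \<gamma> * V' = complex_of_real (exp (- \<beta> * (E + W)) / Z) \<cdot>\<^sub>m (mat_adjoint V' * V')"
      using vd \<gamma>d ev'[folded \<gamma>_def] by (simp add: mult_assoc_dim mult_smult_dim)
    then show ?thesis unfolding f_def V'(2) by simp
  qed
  define U where "U = kron P V"
  note U = kron_isometry[OF Rd(7) V(1,2), folded U_def]
  obtain t where t: "\<And>i. i < n \<Longrightarrow> 0 \<le> t i" "\<And>i. i < n \<Longrightarrow> t i \<le> 1"
    "\<And>a. F (U * mat_diag n (\<lambda>i. complex_of_real (a i)) * mat_adjoint U) = (\<Sum>i<n. a i * t i)"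
    using effect_diag[OF F(1)[unfolded hd] U] by blast
  have gR: "has_eigenvalues n P (gibbs \<beta> \<mu> (ham R) (numop R)) g"
    unfolding g by (rule has_eigenvalues_gibbs[OF has_eigenvalues_grand[OF Rd(2,3)]])
  note gRd = has_eigenvaluesD(3,4)[OF gR]
  have gpos: "0 < g i" if "i < n" for i unfolding g by (rule gibbs_weight_pos[OF that])
  have FX: "F (dens (compose R B)) = (\<Sum>i<n. r i * t i)"
    using kron_projection[OF Rd(1) V(1), folded U_def] t(3)[of r] V(3) by (simp add: compose_def)
  obtain M where M: "M \<in> carrier_mat n n" "gibbs \<beta> \<mu> (ham R) (numop R) = M * mat_adjoint M"
    by (rule nonneg_eigenvalues_gram[OF gR]) (use gpos less_imp_le in auto)
  define A where "A = kron (gibbs \<beta> \<mu> (ham R) (numop R)) (V * mat_adjoint V)"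
  have A: "A \<in> carrier_mat (n * m) (n * m)"
    by (rule carrier_matI) (use gRd carrier_matD[OF V(1)] in \<open>auto simp: A_def\<close>)
  have kML: "kron M L \<in> carrier_mat (n * m) (n * m)" by (rule kron_carrier[OF M(1) L(1)])
  note Fe = F(1)[unfolded hd]
  have gX: "gibbs \<beta> \<mu> (ham (compose R B)) (numop (compose R B))
      = complex_of_real (exp (- \<beta> * E) / Z) \<cdot>\<^sub>m A + kron M L * mat_adjoint (kron M L)"
    using gibbs_compose[of n R m B \<beta> \<mu>] has_eigenvalues_hermitian[OF Rd(2)] has_eigenvalues_hermitian[OF Rd(3)]
      HB L(2) M(2) carrier_matD[OF V(1)] carrier_matD[OF L(1)] carrier_matD[OF M(1)]
    by (simp add: kron_add_right kron_smult_right A_def adjoint_kron kron_mult)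
  have FA: "F A = (\<Sum>i<n. g i * t i)"
    unfolding A_def kron_projection[OF gR V(1), folded U_def] by (rule t(3))
  have "F (gibbs \<beta> \<mu> (ham (compose R B)) (numop (compose R B)))
      = exp (- \<beta> * E) / Z * (\<Sum>i<n. g i * t i) + F (kron M L * mat_adjoint (kron M L))"
    unfolding gX FA[symmetric] effectD(2)[OF Fe A, symmetric]
    by (rule effectD(1)[OF Fe]) (use A kML in auto)
  then have "exp (- \<beta> * E) / Z * (\<Sum>i<n. g i * t i) \<le> exp (- \<beta> * (E + W)) / Z"
    using F(3) f2 effectD(3)[OF Fe kML] unfolding b(3,4) \<gamma>_def[symmetric] by linarith
  then have gt: "(\<Sum>i<n. g i * t i) \<le> exp (- \<beta> * W)"
    using Z(1) unfolding battery_weight_add by (subst (asm) mult_le_cancel_left_pos) auto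
  have "1 - \<epsilon> \<le> (\<Sum>i<n. r i * t i)" using F(2) FX f1 by linarith
  also have "\<dots> \<le> (\<Sum>i<n. (if exp \<theta> * g i \<le> r i then r i else 0) + exp \<theta> * (g i * t i))"
  proof (rule sum_mono)
    fix i assume i: "i \<in> {..<n}"
    then have *: "0 \<le> r i" "0 \<le> t i" "t i \<le> 1" "0 < g i" using t Rd(4) gpos by auto
    show "r i * t i \<le> (if exp \<theta> * g i \<le> r i then r i else 0) + exp \<theta> * (g i * t i)"
    proof (cases "exp \<theta> * g i \<le> r i")
      case True
      then show ?thesis using * mult_left_le[of "t i" "r i"] by (simp add: add_increasing2)
    next
      case False
      then have "r i * t i \<le> (exp \<theta> * g i) * t i" using * by (intro mult_right_mono) auto
      then show ?thesis using False by (simp add: mult.assoc)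
    qed
  qed
  also have "\<dots> = (\<Sum>i | i < n \<and> exp \<theta> * g i \<le> r i. r i) + exp \<theta> * (\<Sum>i<n. g i * t i)"
    by (simp add: sum.distrib sum_distrib_left sum.If_cases Int_def)
  also have "\<dots> \<le> (\<Sum>i | i < n \<and> exp \<theta> * g i \<le> r i. r i) + exp \<theta> * exp (- \<beta> * W)"
    using gt by simp
  finally show ?thesis by (simp flip: exp_add)
qed

text \<open>The effect asks whether the battery is in level \<open>E\<close> and the system in the
  set \<open>S\<close> of high likelihood ratio. Since \<open>r\<close> exceeds
  \<open>exp \<theta> * g\<close> on \<open>S\<close> and has total mass one, \<open>S\<close> has
  \<open>g\<close>-weight at most \<open>exp (- \<theta>)\<close>; comparing the Gibbs states costs
  another factor \<open>exp (\<beta> * W)\<close>.\<close>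

lemma cost_converse:
  assumes R: "state_spectrum n P R r h \<nu>"
    and g: "g = gibbs_weight \<beta> n (\<lambda>i. h i - \<mu> * \<nu> i)"
    and bat: "battery_pair \<beta> \<mu> E W B B'"
    and eq: "equilibrating_approx \<beta> \<mu> \<epsilon> B' (compose R B)"
  shows "(\<Sum>i | i < n \<and> exp \<theta> * g i < r i. r i) - \<epsilon> \<le> exp (\<beta> * W - \<theta>)"
proof -
  note Rd = state_spectrumD[OF R]
  have stR: "is_state R" by (rule state_spectrum_is_state[OF R])
  have b: "battery_state \<beta> \<mu> E B" "battery_state \<beta> \<mu> (E + W) B'" "ham B' = ham B" "numop B' = numop B"
    using bat by (auto simp: battery_pair_def)
  have st: "is_state B" "is_state B'" using b by (auto simp: battery_state_def)
  define m where "m = hdim B"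
  have HB: "hermitian_mat m (ham B)" "hermitian_mat m (numop B)"
    using st by (auto simp: is_state_def m_def)
  have m': "hdim B' = m"
    using st(2) b(3) HB(1) by (auto simp: is_state_def hermitian_mat_def)
  obtain V Z where V: "V \<in> carrier_mat m 1" "mat_adjoint V * V = 1\<^sub>m 1" "dens B = V * mat_adjoint V"
    and Z: "0 < Z" "partition_function \<beta> \<mu> (ham B) (numop B) = complex_of_real Z"
    and ev: "gibbs \<beta> \<mu> (ham B) (numop B) * V = complex_of_real (exp (- \<beta> * E) / Z) \<cdot>\<^sub>m V"
    by (rule battery_state_decomposition[OF b(1), folded m_def]) (rule that)
  obtain V' Z' L where V': "V' \<in> carrier_mat m 1" "mat_adjoint V' * V' = 1\<^sub>m 1" "dens B' = V' * mat_adjoint V'"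
    and Z': "partition_function \<beta> \<mu> (ham B) (numop B) = complex_of_real Z'"
    and L': "L \<in> carrier_mat m m" "gibbs \<beta> \<mu> (ham B) (numop B)
      = complex_of_real (exp (- \<beta> * (E + W)) / Z') \<cdot>\<^sub>m (V' * mat_adjoint V') + L * mat_adjoint L"
    by (rule battery_state_decomposition[OF b(2), unfolded m' b(3,4)]) (rule that)
  have "Z' = Z" using Z(2) Z' of_real_eq_iff[of Z' Z, where 'a = complex] by simp
  note L = L'(1) L'(2)[unfolded this]
  define S where "S = {i. i < n \<and> exp \<theta> * g i < r i}"
  have S: "S \<subseteq> {..<n}" "finite S" by (auto simp: S_def)
  define U where "U = kron P V"
  note U = kron_isometry[OF Rd(7) V(1,2), folded U_def]
  define f where "f = (\<lambda>A. \<Sum>c\<in>S. Re ((mat_adjoint U * A * U) $$ (c, c)))"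
  have hd: "hdim (compose R B) = n * m" by (simp add: hdim_compose Rd m_def)
  have f: "effect (hdim (compose R B)) f"
    unfolding f_def hd by (rule effect_projection[OF U S(1)])
  note Y = compose_dims[OF stR st(1)]
  have dY: "dens (compose R B) = U * mat_diag n (\<lambda>i. complex_of_real (r i)) * mat_adjoint U"
    unfolding U_def by (subst kron_projection[OF Rd(1) V(1), symmetric]) (simp add: compose_def V(3))
  have fr: "f (dens (compose R B)) = (\<Sum>i\<in>S. r i)"
    unfolding dY f_def mult_expand_isometry[OF U mat_diag_dim]
    by (rule sum.cong) (use S in auto)
  have Rh: "hermitian_mat n (ham R)" "hermitian_mat n (numop R)"
    using Rd(2,3) has_eigenvalues_hermitian by auto
  have hYd: "hermitian_mat (hdim (compose R B)) (dens (compose R B))"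
    unfolding hermitian_mat_def using Y(3) has_eigenvalues_hermitian[OF Rd(1)] carrier_matD[OF V(1)]
    by (simp add: compose_def adjoint_kron V(3) adjoint_mult hermitian_mat_def)
  have trY: "mat_trace (dens (compose R B)) = 1"
    using stR st(1) state_dims(1)[OF stR] state_dims(1)[OF st(1)]
    by (simp add: compose_def trace_kron is_state_def density_mat_def)
  have m: "0 < m" using V(1,2) Y(4) unfolding hd by (auto intro: gr0I)
  have B': "hermitian_mat (hdim B') (ham B')" "hermitian_mat (hdim B') (numop B')" "0 < hdim B'"
    "dens B' \<in> carrier_mat (hdim B') (hdim B')"
    using HB b m m' state_dims(1)[OF st(2)] by auto
  obtain F where F: "effect (hdim B') F" "\<bar>F (dens B') - f (dens (compose R B))\<bar> \<le> \<epsilon>"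
    "F (gibbs \<beta> \<mu> (ham B') (numop B'))
      = f (gibbs \<beta> \<mu> (ham (compose R B)) (numop (compose R B)))"
    by (rule equilibrating_approxD[OF eq _ f B']) (use hYd trY in auto)
  note Fe = F(1)[unfolded m']
  define \<gamma> where "\<gamma> = gibbs \<beta> \<mu> (ham B) (numop B)"
  have \<gamma>d: "dim_row \<gamma> = m" "dim_col \<gamma> = m"
    using L carrier_matD[OF L(1)] carrier_matD[OF V'(1)] by (auto simp: \<gamma>_def)
  have gR: "has_eigenvalues n P (gibbs \<beta> \<mu> (ham R) (numop R)) g"
    unfolding g by (rule has_eigenvalues_gibbs[OF has_eigenvalues_grand[OF Rd(2,3)]])
  note gRd = has_eigenvaluesD(3,4)[OF gR] and Pd = unitary_dims[OF Rd(7)] and Vd = carrier_matD[OF V(1)]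
  have gpos: "0 < g i" if "i < n" for i unfolding g by (rule gibbs_weight_pos[OF that])
  have "mat_adjoint U * kron (gibbs \<beta> \<mu> (ham R) (numop R)) \<gamma> * U
      = kron (mat_adjoint P * gibbs \<beta> \<mu> (ham R) (numop R) * P) (mat_adjoint V * \<gamma> * V)"
    unfolding U_def using gRd \<gamma>d Pd Vd by (simp add: adjoint_kron kron_mult)
  also have "mat_adjoint V * \<gamma> * V = complex_of_real (exp (- \<beta> * E) / Z) \<cdot>\<^sub>m (mat_adjoint V * V)"
    using \<gamma>d Vd ev[folded \<gamma>_def] by (simp add: mult_assoc_dim mult_smult_dim)
  finally have Ug: "mat_adjoint U * kron (gibbs \<beta> \<mu> (ham R) (numop R)) \<gamma> * U
      = complex_of_real (exp (- \<beta> * E) / Z) \<cdot>\<^sub>m mat_diag n (\<lambda>i. complex_of_real (g i))"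
    unfolding has_eigenvalues_conj_diag[OF gR] V(2) kron_smult_right kron_diag_one .
  have fg: "f (gibbs \<beta> \<mu> (ham (compose R B)) (numop (compose R B)))
      = exp (- \<beta> * E) / Z * (\<Sum>i\<in>S. g i)"
    unfolding f_def gibbs_compose[OF Rh HB] Ug[unfolded \<gamma>_def] sum_distrib_left
    by (rule sum.cong) (use S in auto)
  have VV': "V' * mat_adjoint V' \<in> carrier_mat m m"
    by (rule carrier_matI) (use carrier_matD[OF V'(1)] in auto)
  have "F (gibbs \<beta> \<mu> (ham B) (numop B))
      = exp (- \<beta> * (E + W)) / Z * F (V' * mat_adjoint V') + F (L * mat_adjoint L)"
    unfolding L(2) effectD(2)[OF Fe VV', symmetric]
    by (rule effectD(1)[OF Fe]) (use L(1) VV' in auto)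
  then have "exp (- \<beta> * (E + W)) / Z * F (dens B') \<le> exp (- \<beta> * E) / Z * (\<Sum>i\<in>S. g i)"
    using F(3) fg effectD(3)[OF Fe L(1)] unfolding b(3,4) V'(3) by linarith
  then have "exp (- \<beta> * W) * F (dens B') \<le> (\<Sum>i\<in>S. g i)"
    using Z(1) unfolding battery_weight_add mult.assoc by (subst (asm) mult_le_cancel_left_pos) auto
  moreover have "(\<Sum>i\<in>S. r i) - \<epsilon> \<le> F (dens B')" using F(2) fr by linarith
  ultimately have 1: "exp (- \<beta> * W) * ((\<Sum>i\<in>S. r i) - \<epsilon>) \<le> (\<Sum>i\<in>S. g i)"
    by (meson exp_ge_zero mult_left_mono order_trans)
  have "(\<Sum>i\<in>S. exp \<theta> * g i) \<le> (\<Sum>i\<in>S. r i)"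
    by (rule sum_mono) (auto simp: S_def)
  also have "\<dots> \<le> (\<Sum>i<n. r i)" by (rule sum_mono2) (use S Rd(4) in auto)
  finally have 2: "exp \<theta> * (\<Sum>i\<in>S. g i) \<le> 1" unfolding Rd(5) sum_distrib_left .
  have "(\<Sum>i\<in>S. r i) - \<epsilon>
      = exp (\<beta> * W) * (exp (- \<beta> * W) * ((\<Sum>i\<in>S. r i) - \<epsilon>))"
    by (simp add: exp_minus)
  also have "\<dots> \<le> exp (\<beta> * W) * (\<Sum>i\<in>S. g i)" using 1 by (rule mult_left_mono) simp
  also have "\<dots> = exp (\<beta> * W - \<theta>) * (exp \<theta> * (\<Sum>i\<in>S. g i))"
    by (simp add: exp_diff)
  also have "\<dots> \<le> exp (\<beta> * W - \<theta>) * 1" using 2 by (rule mult_left_mono) simp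
  finally show ?thesis by (simp add: S_def)
qed

section \<open>Equilibrating operations from bijections of levels\<close>

lemma permute_columns_unitary:
  assumes Q: "unitary_mat N Q" and f: "bij_betw f {..<N} {..<N}"
  shows "unitary_mat N (Matrix.mat N N (\<lambda>(i, k). Q $$ (i, f k)))" (is "unitary_mat N ?Q")
proof (rule unitary_matI)
  show "mat_adjoint ?Q * ?Q = 1\<^sub>m N"
  proof (rule eq_matI)
    fix i j assume "i < dim_row (1\<^sub>m N :: complex mat)" "j < dim_col (1\<^sub>m N :: complex mat)"
    then have ij: "i < N" "j < N" by auto
    then have fij: "f i < N" "f j < N" using f by (auto simp: bij_betw_def)
    have "(mat_adjoint ?Q * ?Q) $$ (i, j) = (\<Sum>k<N. cnj (Q $$ (k, f i)) * Q $$ (k, f j))"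
      using ij by (subst index_mult_mat_sum) auto
    also have "\<dots> = (mat_adjoint Q * Q) $$ (f i, f j)"
      using fij unitary_dims[OF Q] by (subst index_mult_mat_sum) auto
    also have "\<dots> = (if f i = f j then 1 else 0)" using Q fij by (simp add: unitary_mat_def)
    also have "\<dots> = 1\<^sub>m N $$ (i, j)"
      using ij bij_betw_imp_inj_on[OF f] by (auto simp: inj_on_def)
    finally show "(mat_adjoint ?Q * ?Q) $$ (i, j) = 1\<^sub>m N $$ (i, j)" .
  qed auto
qed auto

text \<open>\<open>T\<close> sends column \<open>k\<close> of \<open>P\<close> to column
  \<open>f k\<close> of \<open>Q\<close>, and thereby relabels by \<open>f\<close> the eigenvalues
  of all matrices diagonal in \<open>P\<close> simultaneously.\<close>

lemma eigenvalue_transport: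
  assumes P: "unitary_mat N P" and Q: "unitary_mat N Q" and f: "bij_betw f {..<N} {..<N}"
  obtains T where "unitary_mat N T"
    "\<And>A a b. has_eigenvalues N P A a \<Longrightarrow> (\<And>k. k < N \<Longrightarrow> b (f k) = a k) \<Longrightarrow>
      has_eigenvalues N Q (T * A * mat_adjoint T) b"
proof
  define Q' where "Q' = Matrix.mat N N (\<lambda>(i, k). Q $$ (i, f k))"
  define T where "T = Q' * mat_adjoint P"
  have Q': "unitary_mat N Q'" unfolding Q'_def by (rule permute_columns_unitary[OF Q f])
  show T: "unitary_mat N T"
    unfolding T_def by (rule unitary_mult[OF Q' unitary_adjoint[OF P]])
  fix A and a b :: "nat \<Rightarrow> real"
  assume A: "has_eigenvalues N P A a" and b: "\<And>k. k < N \<Longrightarrow> b (f k) = a k"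
  have "T * P = Q' * (mat_adjoint P * P)"
    unfolding T_def by (rule mult_assoc_dim) (use unitary_dims[OF P] unitary_dims[OF Q'] in auto)
  also have "\<dots> = Q'" using P Q' by (simp add: unitary_mat_def right_mult_one_mat[of _ N N])
  finally have 1: "has_eigenvalues N Q' (T * A * mat_adjoint T) a"
    using has_eigenvalues_conj[OF T A] by simp
  show "has_eigenvalues N Q (T * A * mat_adjoint T) b"
  proof (rule has_eigenvaluesI[OF Q has_eigenvalues_carrier[OF 1]])
    fix i j assume ij: "i < N" "j < N"
    have "(T * A * mat_adjoint T) $$ (i, j)
        = (\<Sum>k<N. complex_of_real (b (f k)) * (Q $$ (i, f k) * cnj (Q $$ (j, f k))))"
      using has_eigenvalues_index[OF 1 ij] ij b by (simp add: Q'_def)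
    also have "\<dots> = (\<Sum>k<N. complex_of_real (b k) * (Q $$ (i, k) * cnj (Q $$ (j, k))))"
      by (rule sum.reindex_bij_betw[OF f])
    finally show "(T * A * mat_adjoint T) $$ (i, j)
        = (\<Sum>k<N. complex_of_real (b k) * (Q $$ (i, k) * cnj (Q $$ (j, k))))" .
  qed
qed

text \<open>With the standard basis on the traced factor, cross terms vanish and what remains is the
  marginal distribution of the first factor.\<close>

lemma partial_trace_eigenvalues:
  assumes P: "unitary_mat n P" and A: "has_eigenvalues (n * m) (kron P (1\<^sub>m m)) A b"
  shows "has_eigenvalues n P (partial_trace n m A) (\<lambda>p. \<Sum>k<m. b (p * m + k))"
proof (rule has_eigenvaluesI[OF P])
  show "partial_trace n m A \<in> carrier_mat n n" by (rule carrier_matI) auto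
  fix i j assume ij: "i < n" "j < n"
  note d = unitary_dims[OF P]
  have *: "A $$ (i * m + k, j * m + k)
      = (\<Sum>p<n. complex_of_real (b (p * m + k)) * (P $$ (i, p) * cnj (P $$ (j, p))))" if k: "k < m" for k
  proof -
    have "A $$ (i * m + k, j * m + k) = (\<Sum>p<n. \<Sum>q<m. complex_of_real (b (p * m + q)) *
        (kron P (1\<^sub>m m) $$ (i * m + k, p * m + q) * cnj (kron P (1\<^sub>m m) $$ (j * m + k, p * m + q))))"
      using has_eigenvalues_index[OF A index_pair_less[OF ij(1) k] index_pair_less[OF ij(2) k]]
      by (simp add: sum_mult_split)
    also have "\<dots> = (\<Sum>p<n. \<Sum>q<m. if q = k then
        complex_of_real (b (p * m + q)) * (P $$ (i, p) * cnj (P $$ (j, p))) else 0)"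
      by (intro sum.cong refl) (use d ij k in simp)
    finally show ?thesis using k by simp
  qed
  have "partial_trace n m A $$ (i, j)
      = (\<Sum>k<m. \<Sum>p<n. complex_of_real (b (p * m + k)) * (P $$ (i, p) * cnj (P $$ (j, p))))"
    using ij by (simp add: *)
  also have "\<dots> = (\<Sum>p<n. complex_of_real (\<Sum>k<m. b (p * m + k)) * (P $$ (i, p) * cnj (P $$ (j, p))))"
    by (subst sum.swap) (simp add: sum_distrib_right)
  finally show "partial_trace n m A $$ (i, j)
      = (\<Sum>p<n. complex_of_real (\<Sum>k<m. b (p * m + k)) * (P $$ (i, p) * cnj (P $$ (j, p))))" .
qed

lemma bij_betw_nat_finite_lessThan:
  assumes "finite A"
  obtains e where "bij_betw e {..<card A} A"
  using ex_bij_betw_nat_finite[OF assms] by (auto simp: lessThan_atLeast0)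

lemma mult_index_bij:
  "bij_betw (\<lambda>i. (i div m, i mod m)) {..<n * m} ({..<n} \<times> {..<m :: nat})"
proof (rule bij_betw_byWitness[where f' = "\<lambda>(a, b). a * m + b"])
  show "(\<lambda>i. (i div m, i mod m)) ` {..<n * m} \<subseteq> {..<n} \<times> {..<m}"
    by (cases "m = 0") (auto simp: less_mult_imp_div_less)
qed (auto simp: index_pair_less)

text \<open>The bijection is put entirely into the identification \<open>T\<close> of the joint
  system with retained and discarded parts, and \<open>U\<close> is the identity. Conservation of
  energy and number says that \<open>T\<close> makes both total operators sums over the two parts;
  the output is the marginal of the transported product distribution.\<close>

lemma equilibrating_of_bijection:
  fixes K :: "'k set" and K' :: "'l set"
  assumes X: "state_spectrum dX PX X x hx nx" and Y: "state_spectrum dY PY Y y hy ny"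
    and fin: "finite K" "finite K'"
    and w: "\<And>k. k \<in> K \<Longrightarrow> w k = c * exp (- \<beta> * (\<kappa> k - \<mu> * \<eta> k))" "(\<Sum>k\<in>K. w k) = 1"
    and \<phi>: "bij_betw \<phi> ({..<dX} \<times> K) ({..<dY} \<times> K')"
    and en: "\<And>i k. i < dX \<Longrightarrow> k \<in> K \<Longrightarrow> hx i + \<kappa> k = hy (fst (\<phi> (i, k))) + \<kappa>' (snd (\<phi> (i, k)))"
    and nu: "\<And>i k. i < dX \<Longrightarrow> k \<in> K \<Longrightarrow> nx i + \<eta> k = ny (fst (\<phi> (i, k))) + \<eta>' (snd (\<phi> (i, k)))"
    and y: "\<And>j. j < dY \<Longrightarrow> y j = (\<Sum>i<dX. \<Sum>k\<in>K. if fst (\<phi> (i, k)) = j then x i * w k else 0)"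
  shows "equilibrating \<beta> \<mu> X Y"
proof -
  define n where "n = card K"
  define m where "m = card K'"
  obtain e where e: "bij_betw e {..<n} K" unfolding n_def by (rule bij_betw_nat_finite_lessThan[OF fin(1)])
  obtain e' where e': "bij_betw e' {..<m} K'" unfolding m_def by (rule bij_betw_nat_finite_lessThan[OF fin(2)])
  define N where "N = dX * n"
  have N: "N = dY * m"
    using bij_betw_same_card[OF \<phi>] by (simp add: N_def n_def m_def card_cartesian_product)
  have eK: "e k \<in> K" if "k < n" for k using e that by (auto simp: bij_betw_def)
  define G where "G = \<lparr>dens = mat_diag n (\<lambda>k. complex_of_real (w (e k))),
    ham = mat_diag n (\<lambda>k. complex_of_real (\<kappa> (e k))), numop = mat_diag n (\<lambda>k. complex_of_real (\<eta> (e k)))\<rparr>"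
  have w1: "(\<Sum>k<n. w (e k)) = 1" using w(2) sum.reindex_bij_betw[OF e, of w] by simp
  have n0: "0 < n" using w1 by (auto intro: gr0I)
  have "0 \<le> c"
  proof (rule ccontr)
    assume "\<not> 0 \<le> c"
    then have "(\<Sum>k\<in>K. w k) \<le> 0" by (intro sum_nonpos) (simp add: w(1) mult_nonpos_nonneg)
    then show False using w(2) by simp
  qed
  then have w0: "0 \<le> w (e k)" if "k < n" for k using w(1)[OF eK[OF that]] by simp
  have G: "state_spectrum n (1\<^sub>m n) G (\<lambda>k. w (e k)) (\<lambda>k. \<kappa> (e k)) (\<lambda>k. \<eta> (e k))"
    unfolding state_spectrum_def G_def using w1 w0 by (simp add: has_eigenvalues_diag)
  note Gd = state_spectrumD[OF G]
  have free: "free_state \<beta> \<mu> G"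
    unfolding free_state_def
  proof
    show "is_state G" by (rule state_spectrum_is_state[OF G])
    have "has_eigenvalues n (1\<^sub>m n) (gibbs \<beta> \<mu> (ham G) (numop G)) (\<lambda>k. w (e k))"
      by (rule has_eigenvalues_cong[OF has_eigenvalues_gibbs[OF has_eigenvalues_grand[OF Gd(2,3)]]],
          rule gibbs_weight_eqI[of _ _ c]) (use w(1) eK w1 in auto)
    then show "dens G = gibbs \<beta> \<mu> (ham G) (numop G)"
      using has_eigenvaluesD(2) has_eigenvaluesD(2)[OF Gd(1)] by metis
  qed
  define A where "A = mat_diag m (\<lambda>k. complex_of_real (\<kappa>' (e' k)))"
  define A' where "A' = mat_diag m (\<lambda>k. complex_of_real (\<eta>' (e' k)))"
  have A: "has_eigenvalues m (1\<^sub>m m) A (\<lambda>k. \<kappa>' (e' k))" "has_eigenvalues m (1\<^sub>m m) A' (\<lambda>k. \<eta>' (e' k))"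
    unfolding A_def A'_def by (rule has_eigenvalues_diag)+
  note XG = state_spectrumD[OF state_spectrum_compose[OF X G]]
  note Xd = state_spectrumD[OF X] and Yd = state_spectrumD[OF Y]
  \<comment> \<open>\<open>\<psi>\<close> is \<open>\<phi>\<close> in terms of the tensor index of
    the input. Enumerating the discarded levels by \<open>e'\<close> as well gives \<open>f\<close>,
    a permutation of tensor indices.\<close>
  define \<psi> where "\<psi> = (\<lambda>i. \<phi> (i div n, e (i mod n)))"
  define f where "f = (\<lambda>i. fst (\<psi> i) * m + the_inv_into {..<m} e' (snd (\<psi> i)))"
  have \<psi>: "bij_betw \<psi> {..<N} ({..<dY} \<times> K')"
  proof -
    have "bij_betw (\<lambda>(i, k). (i, e k)) ({..<dX} \<times> {..<n}) ({..<dX} \<times> K)"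
      using bij_betw_map_prod[OF bij_betw_id e] by (simp add: map_prod_def)
    from bij_betw_trans[OF bij_betw_trans[OF mult_index_bij this] \<phi>]
    show ?thesis by (simp add: \<psi>_def N_def comp_def)
  qed
  have \<psi>in: "fst (\<psi> i) < dY" "snd (\<psi> i) \<in> K'" if "i < N" for i
    using bij_betwE[OF \<psi>] that by (auto simp: mem_Times_iff)
  have inv: "the_inv_into {..<m} e' k < m" "e' (the_inv_into {..<m} e' k) = k" if "k \<in> K'" for k
    using bij_betwE[OF bij_betw_the_inv_into[OF e']] f_the_inv_into_f_bij_betw[OF e'] that by auto
  have fdiv: "f i div m = fst (\<psi> i)" "e' (f i mod m) = snd (\<psi> i)" "f i < N" if "i < N" for i
    using inv[OF \<psi>in(2)[OF that]] index_pair_less[OF \<psi>in(1)[OF that] inv(1)[OF \<psi>in(2)[OF that]]]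
    by (auto simp: f_def N)
  have "inj_on f {..<N}"
  proof (rule inj_onI)
    fix i j assume ij: "i \<in> {..<N}" "j \<in> {..<N}" "f i = f j"
    then have "\<psi> i = \<psi> j" using fdiv[of i] fdiv[of j] by (metis lessThan_iff prod_eq_iff)
    then show "i = j" using bij_betw_imp_inj_on[OF \<psi>] ij by (auto simp: inj_on_def)
  qed
  moreover from this have "f ` {..<N} = {..<N}" by (intro endo_inj_surj) (use fdiv(3) in auto)
  ultimately have f: "bij_betw f {..<N} {..<N}" by (simp add: bij_betw_def)
  define P where "P = kron PX (1\<^sub>m n)"
  define Q where "Q = kron PY (1\<^sub>m m)"
  have PQ: "unitary_mat N P" "unitary_mat N Q"
    using unitary_kron[OF Xd(7) unitary_one[of n]] unitary_kron[OF Yd(7) unitary_one[of m]]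
    unfolding P_def Q_def N_def[symmetric] N[symmetric] by auto
  obtain T where T: "unitary_mat N T"
    "\<And>A a b. has_eigenvalues N P A a \<Longrightarrow> (\<And>k. k < N \<Longrightarrow> b (f k) = a k) \<Longrightarrow>
      has_eigenvalues N Q (T * A * mat_adjoint T) b"
    by (rule eigenvalue_transport[OF PQ f], rule that, assumption, blast)
  have lt: "i div n < dX" "e (i mod n) \<in> K" if "i < N" for i
    using that n0 eK by (auto simp: N_def less_mult_imp_div_less)
  have "has_eigenvalues N Q (T * ham (compose X G) * mat_adjoint T)
      (\<lambda>i. hy (i div m) + \<kappa>' (e' (i mod m)))"
    by (rule T(2)[OF XG(2)[folded P_def N_def]])
      (simp add: fdiv en[OF lt] \<psi>_def)
  moreover have "has_eigenvalues N Q (kron_sum (ham Y) A) (\<lambda>i. hy (i div m) + \<kappa>' (e' (i mod m)))"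
    using has_eigenvalues_kron_sum[OF Yd(2) A(1)] by (simp add: Q_def N)
  ultimately have TH: "T * ham (compose X G) * mat_adjoint T = kron_sum (ham Y) A"
    using has_eigenvaluesD(2) by metis
  have "has_eigenvalues N Q (T * numop (compose X G) * mat_adjoint T)
      (\<lambda>i. ny (i div m) + \<eta>' (e' (i mod m)))"
    by (rule T(2)[OF XG(3)[folded P_def N_def]])
      (simp add: fdiv nu[OF lt] \<psi>_def)
  moreover have "has_eigenvalues N Q (kron_sum (numop Y) A') (\<lambda>i. ny (i div m) + \<eta>' (e' (i mod m)))"
    using has_eigenvalues_kron_sum[OF Yd(3) A(2)] by (simp add: Q_def N)
  ultimately have TN: "T * numop (compose X G) * mat_adjoint T = kron_sum (numop Y) A'"
    using has_eigenvaluesD(2) by metis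
  define a where "a = (\<lambda>i. x (i div n) * w (e (i mod n)))"
  define b where "b = (\<lambda>i. a (the_inv_into {..<N} f i))"
  have bf: "b (f k) = a k" if "k < N" for k
    using the_inv_into_f_f[OF bij_betw_imp_inj_on[OF f]] that by (simp add: b_def)
  have "has_eigenvalues N Q (T * dens (compose X G) * mat_adjoint T) b"
    by (rule T(2)[OF XG(1)[folded P_def N_def]]) (simp add: bf a_def)
  then have D: "has_eigenvalues dY PY (partial_trace dY m (T * dens (compose X G) * mat_adjoint T))
      (\<lambda>p. \<Sum>k<m. b (p * m + k))"
    by (intro partial_trace_eigenvalues Yd) (simp add: Q_def N)
  have "(\<Sum>k<m. b (p * m + k)) = y p" if p: "p < dY" for p
  proof -
    have "(\<Sum>k<m. b (p * m + k)) = (\<Sum>p'<dY. \<Sum>k<m. if (p' * m + k) div m = p then b (p' * m + k) else 0)"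
    proof -
      have "(\<Sum>p'<dY. \<Sum>k<m. if (p' * m + k) div m = p then b (p' * m + k) else 0)
          = (\<Sum>p'<dY. if p' = p then \<Sum>k<m. b (p' * m + k) else 0)"
        by (intro sum.cong refl) auto
      then show ?thesis using p by simp
    qed
    also have "\<dots> = (\<Sum>i<N. if i div m = p then b i else 0)"
      unfolding N by (rule sum_mult_split[symmetric])
    also have "\<dots> = (\<Sum>i<N. if f i div m = p then b (f i) else 0)"
      by (rule sum.reindex_bij_betw[OF f, symmetric])
    also have "\<dots> = (\<Sum>i<N. if fst (\<phi> (i div n, e (i mod n))) = p then a i else 0)"
      by (intro sum.cong refl) (auto simp: fdiv bf \<psi>_def)
    also have "\<dots> = (\<Sum>i<dX. \<Sum>k<n. if fst (\<phi> (i, e k)) = p then x i * w (e k) else 0)"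
      unfolding N_def sum_mult_split by (intro sum.cong refl) (auto simp: a_def)
    also have "\<dots> = (\<Sum>i<dX. \<Sum>k\<in>K. if fst (\<phi> (i, k)) = p then x i * w k else 0)"
      by (intro sum.cong refl sum.reindex_bij_betw[OF e])
    finally show ?thesis using y[OF p] by simp
  qed
  then have "has_eigenvalues dY PY (partial_trace dY m (T * dens (compose X G) * mat_adjoint T)) y"
    by (intro has_eigenvalues_cong[OF D])
  then have DY: "dens Y = partial_trace dY m (T * dens (compose X G) * mat_adjoint T)"
    using has_eigenvaluesD(2) Yd(1) by metis
  have XGd: "dim_row (dens (compose X G)) = N" "dim_col (dens (compose X G)) = N"
    "dim_row (ham (compose X G)) = N" "dim_col (ham (compose X G)) = N"
    "dim_row (numop (compose X G)) = N" "dim_col (numop (compose X G)) = N"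
    using has_eigenvaluesD(3,4) XG(1-3) by (auto simp: N_def)
  have one: "1\<^sub>m N * M = M" "M * 1\<^sub>m N = M" if "dim_row M = N" "dim_col M = N" for M :: "complex mat"
    using that by (auto intro: left_mult_one_mat[of _ N N] right_mult_one_mat[of _ N N])
  have hdXG: "hdim (compose X G) = N" using XG(6) by (simp add: N_def)
  show ?thesis
    unfolding equilibrating_def Let_def hdXG
    by (rule exI[of _ G], rule exI[of _ "1\<^sub>m N"], rule exI[of _ T], rule exI[of _ m], rule exI[of _ A], rule exI[of _ A'])
      (use free T(1) TH TN has_eigenvalues_hermitian[OF A(1)] has_eigenvalues_hermitian[OF A(2)] in
        \<open>simp add: one XGd Yd(6) hdXG flip: N DY\<close>)
qed

text \<open>If \<open>l\<close> lies below both the produced weights \<open>z\<close> and the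
  desired ones \<open>y\<close>, then \<open>\<bar>z j - y j\<bar>\<close> is at most
  \<open>(z j - l j) + (y j - l j)\<close>, so the trace distance is at most one minus the total of
  \<open>l\<close>.\<close>

lemma equilibrating_approx_of_bijection:
  fixes K :: "'k set" and K' :: "'l set"
  assumes X: "state_spectrum dX PX X x hx nx" and Y: "state_spectrum dY PY Y y hy ny"
    and fin: "finite K" "finite K'"
    and w: "\<And>k. k \<in> K \<Longrightarrow> w k = c * exp (- \<beta> * (\<kappa> k - \<mu> * \<eta> k))" "(\<Sum>k\<in>K. w k) = 1"
    and \<phi>: "bij_betw \<phi> ({..<dX} \<times> K) ({..<dY} \<times> K')"
    and en: "\<And>i k. i < dX \<Longrightarrow> k \<in> K \<Longrightarrow> hx i + \<kappa> k = hy (fst (\<phi> (i, k))) + \<kappa>' (snd (\<phi> (i, k)))"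
    and nu: "\<And>i k. i < dX \<Longrightarrow> k \<in> K \<Longrightarrow> nx i + \<eta> k = ny (fst (\<phi> (i, k))) + \<eta>' (snd (\<phi> (i, k)))"
    and low: "\<And>j. j < dY \<Longrightarrow> l j \<le> y j"
      "\<And>j. j < dY \<Longrightarrow> l j \<le> (\<Sum>i<dX. \<Sum>k\<in>K. if fst (\<phi> (i, k)) = j then x i * w k else 0)"
      "1 - \<epsilon> \<le> (\<Sum>j<dY. l j)"
  shows "equilibrating_approx \<beta> \<mu> \<epsilon> X Y"
proof -
  note Xd = state_spectrumD[OF X] and Yd = state_spectrumD[OF Y]
  define z where "z = (\<lambda>j. \<Sum>i<dX. \<Sum>k\<in>K. if fst (\<phi> (i, k)) = j then x i * w k else 0)"
  have "0 \<le> c"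
  proof (rule ccontr)
    assume "\<not> 0 \<le> c"
    then have "(\<Sum>k\<in>K. w k) \<le> 0" by (intro sum_nonpos) (simp add: w(1) mult_nonpos_nonneg)
    then show False using w(2) by simp
  qed
  then have z0: "0 \<le> z j" for j
    unfolding z_def by (intro sum_nonneg) (auto simp: w(1) Xd(4))
  have \<phi>in: "fst (\<phi> (i, k)) < dY" if "i < dX" "k \<in> K" for i k
    using bij_betwE[OF \<phi>] that by (auto simp: mem_Times_iff)
  have "(\<Sum>j<dY. z j) = (\<Sum>i<dX. \<Sum>j<dY. \<Sum>k\<in>K. if fst (\<phi> (i, k)) = j then x i * w k else 0)"
    unfolding z_def by (rule sum.swap)
  also have "\<dots> = (\<Sum>i<dX. \<Sum>k\<in>K. \<Sum>j<dY. if fst (\<phi> (i, k)) = j then x i * w k else 0)"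
    by (intro sum.cong refl sum.swap)
  also have "\<dots> = (\<Sum>i<dX. \<Sum>k\<in>K. x i * w k)"
    by (intro sum.cong refl) (use \<phi>in in simp)
  also have "\<dots> = 1" using Xd(5) w(2) by (simp flip: sum_product)
  finally have z1: "(\<Sum>j<dY. z j) = 1" .
  define \<sigma> where "\<sigma> = PY * mat_diag dY (\<lambda>i. complex_of_real (z i)) * mat_adjoint PY"
  have \<sigma>: "has_eigenvalues dY PY \<sigma> z" using Yd(7) by (simp add: has_eigenvalues_def \<sigma>_def)
  have Y': "state_spectrum dY PY (Y\<lparr>dens := \<sigma>\<rparr>) z hy ny"
    unfolding state_spectrum_def using \<sigma> Yd(2,3) z0 z1 by simp
  have eq: "equilibrating \<beta> \<mu> X (Y\<lparr>dens := \<sigma>\<rparr>)"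
    by (rule equilibrating_of_bijection[OF X Y' fin w \<phi> en nu]) (simp_all add: z_def)
  have "trace_norm (\<sigma> - dens Y) = (\<Sum>j<dY. \<bar>z j - y j\<bar>)"
    by (rule trace_norm_eigenvalues[OF has_eigenvalues_minus[OF \<sigma> Yd(1)]])
  also have "\<dots> \<le> (\<Sum>j<dY. (z j - l j) + (y j - l j))"
    by (rule sum_mono) (use low(1,2) in \<open>force simp: z_def abs_le_iff\<close>)
  also have "\<dots> = 2 - 2 * (\<Sum>j<dY. l j)"
    using z1 Yd(5) by (simp add: sum.distrib sum_subtractf sum_distrib_left)
  finally have "trace_norm (\<sigma> - dens Y) / 2 \<le> \<epsilon>" using low(3) by simp
  then show ?thesis
    unfolding equilibrating_approx_def using eq state_spectrum_is_state[OF Y'] state_spectrumD(6)[OF Y'] Yd(6)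
    by auto
qed

section \<open>A work protocol\<close>

text \<open>The bath consists of \<open>M\<close> copies of the equilibrium state of the system (each with a degenerate
  register of \<open>K\<close> levels) and of a ladder whose levels are the words \<open>xs\<close> of length at most \<open>L\<close>
  over an alphabet of \<open>M\<close> letters; all lengths of words are equally likely if every letter carries
  the energy \<open>ln M / \<beta>\<close>. When the battery moves from level 1 to level 0, the system is swapped with
  the first copy in an accepted level, and the index of that copy is pushed to the word. All moves
  are reversed when the battery moves from level 0 to level 1.\<close>

locale work_protocol =
  fixes D M L K :: nat and c :: "nat \<Rightarrow> nat"
  assumes M: "0 < M" and K: "0 < K" and c: "\<And>i. i < D \<Longrightarrow> c i \<le> K"
begin

text \<open>The register acts as a coin: a copy in level \<open>i\<close> is accepted with
  probability \<open>c i / K\<close>.\<close>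

definition accepted :: "(nat \<times> nat) set" where
  "accepted = {(i, s). i < D \<and> s < c i}"

definition picks :: "(nat \<Rightarrow> nat \<times> nat) \<Rightarrow> nat \<Rightarrow> bool" where
  "picks x j \<longleftrightarrow> j < M \<and> x j \<in> accepted \<and> (\<forall>m<j. x m \<notin> accepted)"

text \<open>Only the levels are exchanged. The system has no register, so the one of copy
  \<open>j\<close> stays where it is.\<close>

definition swap :: "nat \<Rightarrow> nat \<Rightarrow> (nat \<Rightarrow> nat \<times> nat) \<Rightarrow> nat \<Rightarrow> nat \<times> nat" where
  "swap i j x = x(j := (i, snd (x j)))"

definition words :: "nat list set" where
  "words = {xs. set xs \<subseteq> {..<M} \<and> length xs \<le> L}"

definition copies_levels :: "(nat \<Rightarrow> nat \<times> nat) set" where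
  "copies_levels = {..<M} \<rightarrow>\<^sub>E {..<D} \<times> {..<K}"

definition levels :: "(nat \<times> nat \<times> nat list \<times> (nat \<Rightarrow> nat \<times> nat)) set" where
  "levels = {..<D} \<times> {..<2} \<times> words \<times> copies_levels"

text \<open>On words of length at most \<open>L\<close>, the second case applies exactly to the
  images of the first: the exchange with the copy named by the top letter is undone only if that
  copy then becomes the first accepted one. This makes \<open>move\<close> an involution, hence a
  bijection, and the bound on the length keeps it inside the finite ladder.\<close>

definition move :: "nat \<times> nat \<times> nat list \<times> (nat \<Rightarrow> nat \<times> nat) \<Rightarrow>
    nat \<times> nat \<times> nat list \<times> (nat \<Rightarrow> nat \<times> nat)" where
  "move = (\<lambda>(i, b, xs, x).
     if b = 1 \<and> length xs < L \<and> (\<exists>j. picks x j) then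
       let j = (THE j. picks x j) in (fst (x j), 0, j # xs, swap i j x)
     else if b = 0 \<and> xs \<noteq> [] \<and> picks (swap i (hd xs) x) (hd xs) then
       (fst (x (hd xs)), 1, tl xs, swap i (hd xs) x)
     else (i, b, xs, x))"

lemma picks_unique: "picks x j \<Longrightarrow> picks x k \<Longrightarrow> j = k"
  unfolding picks_def by (metis linorder_neqE_nat)

lemma move_up:
  assumes "length xs < L" "picks x j"
  shows "move (i, 1, xs, x) = (fst (x j), 0, j # xs, swap i j x)"
proof -
  have "(THE j. picks x j) = j" using assms(2) picks_unique by blast
  then show ?thesis using assms by (auto simp: move_def)
qed

lemma move_down:
  "picks (swap i j x) j \<Longrightarrow> move (i, 0, j # xs, x) = (fst (x j), 1, xs, swap i j x)"
  by (simp add: move_def)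

lemma swap_swap: "swap (fst (x j)) j (swap i j x) = x"
  by (auto simp: swap_def)

lemma swap_at [simp]: "swap i j x j = (i, snd (x j))"
  by (simp add: swap_def)

lemma move_cases:
  obtains
    (up) i xs x j where "p = (i, 1, xs, x)" "length xs < L" "picks x j"
      "move p = (fst (x j), 0, j # xs, swap i j x)"
  | (down) i xs x j where "p = (i, 0, j # xs, x)" "picks (swap i j x) j"
      "move p = (fst (x j), 1, xs, swap i j x)"
  | (stay) "move p = p"
proof -
  obtain i b xs x where p: "p = (i, b, xs, x)" by (metis prod_cases4)
  consider "b = 1 \<and> length xs < L \<and> (\<exists>j. picks x j)"
    | "b = 0 \<and> xs \<noteq> [] \<and> picks (swap i (hd xs) x) (hd xs)"
    | "\<not> (b = 1 \<and> length xs < L \<and> (\<exists>j. picks x j))"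
      "\<not> (b = 0 \<and> xs \<noteq> [] \<and> picks (swap i (hd xs) x) (hd xs))" by blast
  then show thesis
  proof cases
    case 1
    then show ?thesis using up move_up p by blast
  next
    case 2
    then show ?thesis using down[of i "hd xs" "tl xs" x] move_down[of i "hd xs" x "tl xs"] p by simp
  next
    case 3
    then have "move p = p" unfolding p move_def by auto
    then show ?thesis by (rule stay)
  qed
qed

lemma swap_copies_levels:
  assumes "x \<in> copies_levels" "i < D" "j < M"
  shows "swap i j x \<in> copies_levels"
proof -
  have "x j \<in> {..<D} \<times> {..<K}" using assms by (auto simp: copies_levels_def)
  then have "(i, snd (x j)) \<in> {..<D} \<times> {..<K}" using assms(2) by auto
  then show ?thesis using assms by (auto simp: copies_levels_def swap_def PiE_iff extensional_def)
qed

lemma copies_levels_fst: "x \<in> copies_levels \<Longrightarrow> j < M \<Longrightarrow> fst (x j) < D"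
  by (auto simp: copies_levels_def PiE_iff mem_Times_iff)

lemma move_levels:
  assumes "p \<in> levels"
  shows "move p \<in> levels"
proof (cases p rule: move_cases)
  case (up i xs x j)
  then have "j < M" by (simp add: picks_def)
  then show ?thesis
    using assms up swap_copies_levels copies_levels_fst by (auto simp: levels_def words_def)
next
  case (down i xs x j)
  then have "j < M" by (simp add: picks_def)
  then show ?thesis
    using assms down swap_copies_levels copies_levels_fst by (auto simp: levels_def words_def)
qed (use assms in simp)

lemma move_move:
  assumes "p \<in> levels"
  shows "move (move p) = p"
proof (cases p rule: move_cases)
  case (up i xs x j)
  have "move (fst (x j), 0, j # xs, swap i j x)
      = (fst (swap i j x j), 1, xs, swap (fst (x j)) j (swap i j x))"
    by (rule move_down) (simp add: swap_swap up(3))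
  then show ?thesis using up(1,4) by (simp add: swap_swap)
next
  case (down i xs x j)
  have "length xs < L" using assms down(1) by (auto simp: levels_def words_def)
  then have "move (fst (x j), 1, xs, swap i j x)
      = (fst (swap i j x j), 0, j # xs, swap (fst (x j)) j (swap i j x))"
    using down(2) by (rule move_up)
  then show ?thesis using down(1,3) by (simp add: swap_swap)
qed simp

lemma move_bij: "bij_betw move levels levels"
  by (rule bij_betw_byWitness[where f' = move]) (use move_move move_levels in auto)

lemma sum_swap:
  fixes f :: "nat \<Rightarrow> real"
  assumes "j < M"
  shows "f (fst (x j)) + (\<Sum>m<M. f (fst (swap i j x m))) = f i + (\<Sum>m<M. f (fst (x m)))"
proof -
  have "(\<Sum>m\<in>{..<M} - {j}. f (fst (swap i j x m))) = (\<Sum>m\<in>{..<M} - {j}. f (fst (x m)))"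
    by (intro sum.cong) (auto simp: swap_def)
  then show ?thesis
    using assms by (simp add: sum.remove[of "{..<M}" j "\<lambda>m. f (fst (x m))"]
      sum.remove[of "{..<M}" j "\<lambda>m. f (fst (swap i j x m))"])
qed

text \<open>The battery and a letter carry the same energy \<open>W\<close>, so one can be traded
  for the other. With \<open>W = 0\<close> the same formula counts particles.\<close>

definition energy :: "(nat \<Rightarrow> real) \<Rightarrow> real \<Rightarrow> nat \<times> nat \<times> nat list \<times> (nat \<Rightarrow> nat \<times> nat) \<Rightarrow> real" where
  "energy f W = (\<lambda>(i, b, xs, x). f i + W * real b + (W * real (length xs) + (\<Sum>m<M. f (fst (x m)))))"

lemma move_energy: "energy f W (move p) = energy f W p"
proof (cases p rule: move_cases)
  case (up i xs x j)
  then have "j < M" by (simp add: picks_def)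
  then show ?thesis using up sum_swap[of j f x i] by (simp add: energy_def ring_distribs)
next
  case (down i xs x j)
  then have "j < M" by (simp add: picks_def)
  then show ?thesis using down sum_swap[of j f x i] by (simp add: energy_def ring_distribs)
qed simp

subsection \<open>Probabilities\<close>

text \<open>There are \<open>M ^ k\<close> words of length \<open>k\<close>, so each length from 0
  to \<open>L\<close> has probability \<open>1 / (L + 1)\<close>.\<close>

definition word_weight :: "nat list \<Rightarrow> real" where
  "word_weight xs = 1 / ((real L + 1) * real M ^ length xs)"

definition copies_weight :: "(nat \<Rightarrow> real) \<Rightarrow> (nat \<Rightarrow> nat \<times> nat) \<Rightarrow> real" where
  "copies_weight g x = (\<Prod>m<M. g (fst (x m)) / real K)"

lemma finite_words: "finite words"
  unfolding words_def by (rule finite_lists_length_le) simp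

lemma finite_copies_levels: "finite copies_levels"
  unfolding copies_levels_def by (intro finite_PiE) auto

lemma sum_words:
  "(\<Sum>xs | xs \<in> words \<and> P (length xs). word_weight xs) = real (card {k. k \<le> L \<and> P k}) / (real L + 1)"
proof -
  have "(\<Sum>xs | xs \<in> words \<and> P (length xs). word_weight xs)
    = (\<Sum>k | k \<le> L \<and> P k. \<Sum>xs | xs \<in> {xs \<in> words. P (length xs)} \<and> length xs = k. word_weight xs)"
    by (rule sum.group[symmetric]) (auto simp: finite_words words_def intro: finite_subset[OF _ finite_words])
  also have "\<dots> = (\<Sum>k | k \<le> L \<and> P k. 1 / (real L + 1))"
  proof (rule sum.cong[OF refl])
    fix k assume k: "k \<in> {k. k \<le> L \<and> P k}"
    then have "{xs. xs \<in> {xs \<in> words. P (length xs)} \<and> length xs = k} = {xs. set xs \<subseteq> {..<M} \<and> length xs = k}"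
      by (auto simp: words_def)
    then have "(\<Sum>xs | xs \<in> {xs \<in> words. P (length xs)} \<and> length xs = k. word_weight xs)
        = (\<Sum>xs | set xs \<subseteq> {..<M} \<and> length xs = k. 1 / ((real L + 1) * real M ^ k))"
      by (intro sum.cong) (auto simp: word_weight_def)
    then show "(\<Sum>xs | xs \<in> {xs \<in> words. P (length xs)} \<and> length xs = k. word_weight xs) = 1 / (real L + 1)"
      using M by (simp add: card_lists_length_eq)
  qed
  finally show ?thesis by simp
qed

lemma sum_copies:
  assumes "\<And>m. m < M \<Longrightarrow> F m \<subseteq> {..<D} \<times> {..<K}"
  shows "(\<Sum>x | x \<in> copies_levels \<and> (\<forall>m<M. x m \<in> F m). copies_weight g x)
    = (\<Prod>m<M. \<Sum>v\<in>F m. g (fst v) / real K)"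
proof -
  have "{x. x \<in> copies_levels \<and> (\<forall>m<M. x m \<in> F m)} = PiE {..<M} F"
    unfolding copies_levels_def PiE_def Pi_def using assms by blast
  moreover have "finite (F m)" if "m < M" for m
    by (rule finite_subset[OF assms[OF that]]) simp
  ultimately show ?thesis
    unfolding copies_weight_def by (simp only:) (rule prod_sum_PiE[symmetric], auto)
qed

lemma accepted_subset: "accepted \<subseteq> {..<D} \<times> {..<K}"
  using c by (fastforce simp: accepted_def)

text \<open>The probability that a given copy is in level \<open>i\<close> and is accepted. The sum
  over \<open>i\<close> is the acceptance probability of a copy, called \<open>\<alpha>\<close> in
  the proofs below.\<close>

definition rate :: "(nat \<Rightarrow> real) \<Rightarrow> nat \<Rightarrow> real" where
  "rate g i = g i * real (c i) / real K"

lemma sum_levels: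
  assumes "(\<Sum>i<D. g i) = (1 :: real)"
  shows "(\<Sum>v\<in>{..<D} \<times> {..<K}. g (fst v) / real K) = 1"
proof -
  have "(\<Sum>v\<in>{..<D} \<times> {..<K}. g (fst v) / real K) = (\<Sum>i<D. \<Sum>s<K. g i / real K)"
    unfolding sum.cartesian_product case_prod_beta ..
  then show ?thesis using K assms by simp
qed

lemma sum_accepted: "(\<Sum>v\<in>accepted. g (fst v) / real K) = (\<Sum>i<D. rate g i)"
proof -
  have "accepted = (SIGMA i:{..<D}. {..<c i})" by (auto simp: accepted_def)
  then have "(\<Sum>v\<in>accepted. g (fst v) / real K) = (\<Sum>i<D. \<Sum>s<c i. g i / real K)"
    by (subst sum.Sigma) (auto simp: case_prod_beta)
  then show ?thesis by (simp add: rate_def mult.commute)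
qed

lemma sum_rejected:
  assumes "(\<Sum>i<D. g i) = 1"
  shows "(\<Sum>v\<in>{..<D} \<times> {..<K} - accepted. g (fst v) / real K) = 1 - (\<Sum>i<D. rate g i)"
  by (subst sum_diff) (use accepted_subset sum_levels[OF assms] sum_accepted in auto)

lemma prod_first:
  fixes a b :: real
  assumes "j < n"
  shows "(\<Prod>m<n. if m < j then a else if m = j then b else 1) = a ^ j * b"
  using assms
proof (induction n)
  case (Suc n)
  show ?case
  proof (cases "j = n")
    case True
    have "(\<Prod>m<n. if m < j then a else if m = j then b else 1) = (\<Prod>m<n. a)"
      by (rule prod.cong) (use True in auto)
    then show ?thesis using True by simp
  next
    case False
    then show ?thesis using Suc by simp
  qed
qed simp

text \<open>The copies are independent: \<open>j\<close> of them are rejected, the next one lies in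
  \<open>F\<close>, and the others are unconstrained.\<close>

lemma probability_first:
  assumes g: "(\<Sum>i<D. g i) = 1" and j: "j < M" and F: "F \<subseteq> {..<D} \<times> {..<K}"
  shows "(\<Sum>x | x \<in> copies_levels \<and> (\<forall>m<j. x m \<notin> accepted) \<and> x j \<in> F. copies_weight g x)
    = (1 - (\<Sum>i<D. rate g i)) ^ j * (\<Sum>v\<in>F. g (fst v) / real K)"
proof -
  define C where "C = {..<D} \<times> {..<K}"
  define G where "G = (\<lambda>m. if m < j then C - accepted else if m = j then F else C)"
  have CM: "x m \<in> C" if "x \<in> copies_levels" "m < M" for x m
    using that by (auto simp: copies_levels_def C_def)
  have "{x. x \<in> copies_levels \<and> (\<forall>m<j. x m \<notin> accepted) \<and> x j \<in> F}
      = {x. x \<in> copies_levels \<and> (\<forall>m<M. x m \<in> G m)}"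
    using j CM by (auto simp: G_def)
  then have "(\<Sum>x | x \<in> copies_levels \<and> (\<forall>m<j. x m \<notin> accepted) \<and> x j \<in> F. copies_weight g x)
      = (\<Prod>m<M. \<Sum>v\<in>G m. g (fst v) / real K)"
    using F by (simp only:) (rule sum_copies, auto simp: G_def C_def)
  also have "\<dots> = (\<Prod>m<M. if m < j then 1 - (\<Sum>i<D. rate g i)
      else if m = j then (\<Sum>v\<in>F. g (fst v) / real K) else 1)"
    by (intro prod.cong refl)
      (use sum_rejected[OF g] sum_levels[OF g] in \<open>simp add: G_def C_def\<close>)
  finally show ?thesis by (simp only: prod_first[OF j])
qed

lemma copies_weight_sum:
  assumes "(\<Sum>i<D. g i) = 1"
  shows "(\<Sum>x\<in>copies_levels. copies_weight g x) = 1"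
proof -
  have "{x. x \<in> copies_levels \<and> (\<forall>m<M. x m \<in> {..<D} \<times> {..<K})} = copies_levels"
    unfolding copies_levels_def PiE_def Pi_def by blast
  then show ?thesis
    using sum_copies[of "\<lambda>_. {..<D} \<times> {..<K}" g] sum_levels[OF assms] by simp
qed

lemma word_weight_sum: "(\<Sum>xs\<in>words. word_weight xs) = 1"
  using sum_words[of "\<lambda>_. True"] by (simp flip: atMost_def)

end

section \<open>Batteries\<close>

text \<open>The zero number operator gives each level the equilibrium weight that
  \<open>battery_state\<close> demands, namely one determined by its energy alone.\<close>

definition battery :: "real \<Rightarrow> real \<Rightarrow> nat \<Rightarrow> qsystem" where
  "battery E W b = \<lparr>dens = mat_diag 2 (\<lambda>i. complex_of_real (if i = b then 1 else 0)),
    ham = mat_diag 2 (\<lambda>i. complex_of_real (E + W * real i)), numop = mat_diag 2 (\<lambda>_. complex_of_real 0)\<rparr>"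

lemma battery_spectrum:
  assumes "b < 2"
  shows "state_spectrum 2 (1\<^sub>m 2) (battery E W b) (\<lambda>i. if i = b then 1 else 0) (\<lambda>i. E + W * real i) (\<lambda>_. 0)"
  unfolding state_spectrum_def battery_def
  by (simp only: qsystem.simps has_eigenvalues_diag) (use assms in auto)

lemma sum_less_2: "(\<Sum>b<2. f b) = f 0 + f (1 :: nat)"
  by (simp add: numeral_2_eq_2)

lemma Suc_double_mod: "Suc (a * 2) mod 2 = 1"
  by presburger

lemma diag_unit_vec:
  fixes a :: "nat \<Rightarrow> complex"
  assumes "b < n"
  shows "mat_diag n a *\<^sub>v unit_vec n b = a b \<cdot>\<^sub>v unit_vec n b"
proof (rule eq_vecI)
  fix i assume "i < dim_vec (a b \<cdot>\<^sub>v unit_vec n b)"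
  then have i: "i < n" by simp
  have "(mat_diag n a *\<^sub>v unit_vec n b) $ i = (\<Sum>k<n. (if i = k then a k else 0) * (if k = b then 1 else 0))"
    using i assms by (simp add: scalar_prod_def lessThan_atLeast0)
  also have "\<dots> = (if i = b then a b else 0)"
    using assms by (simp add: if_distrib[of "\<lambda>x. _ * x"] cong: if_cong)
  finally show "(mat_diag n a *\<^sub>v unit_vec n b) $ i = (a b \<cdot>\<^sub>v unit_vec n b) $ i"
    using i assms by simp
qed (use assms in simp)

lemma battery_state_battery:
  assumes b: "b < 2"
  shows "battery_state \<beta> \<mu> (E + W * real b) (battery E W b)"
proof -
  note B = state_spectrumD[OF battery_spectrum[OF b, of E W]]
  define B where "B = battery E W b"
  have gr: "has_eigenvalues 2 (1\<^sub>m 2) (ham B - complex_of_real \<mu> \<cdot>\<^sub>m numop B) (\<lambda>i. E + W * real i - \<mu> * 0)"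
    unfolding B_def by (rule has_eigenvalues_grand[OF B(2,3)])
  have gi: "gibbs \<beta> \<mu> (ham B) (numop B)
      = mat_diag 2 (\<lambda>i. complex_of_real (gibbs_weight \<beta> 2 (\<lambda>i. E + W * real i - \<mu> * 0) i))"
    using has_eigenvaluesD(2)[OF has_eigenvalues_gibbs[OF gr]]
      has_eigenvaluesD(2)[OF has_eigenvalues_diag] by metis
  have "dens B = outer_self (unit_vec 2 b)"
    by (rule eq_matI) (use b in \<open>auto simp: B_def battery_def outer_self_def\<close>)
  moreover have "ham B *\<^sub>v unit_vec 2 b = complex_of_real (E + W * real b) \<cdot>\<^sub>v unit_vec 2 b"
    unfolding B_def battery_def by (simp only: qsystem.simps diag_unit_vec[OF b])
  moreover have "gibbs \<beta> \<mu> (ham B) (numop B) *\<^sub>v unit_vec 2 b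
      = (complex_of_real (exp (- \<beta> * (E + W * real b))) / partition_function \<beta> \<mu> (ham B) (numop B))
        \<cdot>\<^sub>v unit_vec 2 b"
    unfolding gi diag_unit_vec[OF b] has_eigenvalues_partition_function[OF gr]
    by (simp add: gibbs_weight_def)
  moreover have "is_state B"
    unfolding B_def by (rule state_spectrum_is_state[OF battery_spectrum[OF b]])
  ultimately show ?thesis
    unfolding battery_state_def B_def[symmetric] using b B(6)[folded B_def]
    by (intro conjI bexI[of _ "unit_vec 2 b"]) auto
qed

lemma battery_pair_battery: "battery_pair \<beta> \<mu> E W (battery E W 0) (battery E W 1)"
  using battery_state_battery[of 0 \<beta> \<mu> E W] battery_state_battery[of 1 \<beta> \<mu> E W]
  by (simp add: battery_pair_def battery_def)

context work_protocol
begin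

definition bath :: "(nat list \<times> (nat \<Rightarrow> nat \<times> nat)) set" where
  "bath = words \<times> copies_levels"

definition bath_weight :: "(nat \<Rightarrow> real) \<Rightarrow> nat list \<times> (nat \<Rightarrow> nat \<times> nat) \<Rightarrow> real" where
  "bath_weight g = (\<lambda>(xs, x). word_weight xs * copies_weight g x)"

definition bath_energy :: "(nat \<Rightarrow> real) \<Rightarrow> real \<Rightarrow> nat list \<times> (nat \<Rightarrow> nat \<times> nat) \<Rightarrow> real" where
  "bath_energy f W = (\<lambda>(xs, x). W * real (length xs) + (\<Sum>m<M. f (fst (x m))))"

lemma finite_bath: "finite bath"
  unfolding bath_def by (intro finite_cartesian_product finite_words finite_copies_levels)

lemma sum_bath: "(\<Sum>k\<in>bath. F k) = (\<Sum>xs\<in>words. \<Sum>x\<in>copies_levels. F (xs, x))"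
  unfolding bath_def by (simp add: sum.cartesian_product)

lemma levels_bath: "levels = {..<D} \<times> {..<2} \<times> bath"
  by (simp add: levels_def bath_def)

lemma bath_weight_sum:
  assumes "(\<Sum>i<D. g i) = 1"
  shows "(\<Sum>k\<in>bath. bath_weight g k) = 1"
  unfolding sum_bath using word_weight_sum copies_weight_sum[OF assms]
  by (simp add: bath_weight_def flip: sum_distrib_left)

lemma bath_weight_nonneg:
  assumes "\<And>i. i < D \<Longrightarrow> 0 \<le> g i" "k \<in> bath"
  shows "0 \<le> bath_weight g k"
  using assms copies_levels_fst
  by (auto simp: bath_weight_def bath_def word_weight_def copies_weight_def intro!: divide_nonneg_nonneg mult_nonneg_nonneg prod_nonneg)

text \<open>The choice of \<open>W\<close> gives every letter the Boltzmann factor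
  \<open>1 / M\<close>, so the weights on words, and with the copies those on the bath, form a Gibbs
  distribution.\<close>

lemma bath_weight_exp:
  assumes \<beta>: "\<beta> > 0" and g: "g = gibbs_weight \<beta> D (\<lambda>i. h i - \<mu> * \<nu> i)" and W: "W = ln (real M) / \<beta>"
    and k: "k \<in> bath"
  shows "bath_weight g k = (1 / ((real L + 1) * ((\<Sum>j<D. exp (- \<beta> * (h j - \<mu> * \<nu> j))) * real K) ^ M))
    * exp (- \<beta> * (bath_energy h W k - \<mu> * bath_energy \<nu> 0 k))"
proof -
  obtain xs x where k': "k = (xs, x)" by (cases k)
  define Z where "Z = (\<Sum>j<D. exp (- \<beta> * (h j - \<mu> * \<nu> j)))"
  have "exp (- (\<beta> * (W * real (length xs)))) = exp (- ln (real M)) ^ length xs"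
    using \<beta> by (simp add: W flip: exp_of_nat_mult)
  also have "\<dots> = 1 / real M ^ length xs"
    using M by (simp add: exp_minus power_inverse divide_inverse)
  finally have 1: "exp (- (\<beta> * (W * real (length xs)))) = 1 / real M ^ length xs" .
  have "copies_weight g x = (\<Prod>m<M. exp (- \<beta> * (h (fst (x m)) - \<mu> * \<nu> (fst (x m)))) * (1 / (Z * real K)))"
    unfolding copies_weight_def g gibbs_weight_def Z_def by simp
  also have "\<dots> = exp (\<Sum>m<M. - \<beta> * (h (fst (x m)) - \<mu> * \<nu> (fst (x m)))) * (1 / (Z * real K)) ^ M"
    by (simp add: prod.distrib exp_sum del: times_divide_eq_right)
  also have "(\<Sum>m<M. - \<beta> * (h (fst (x m)) - \<mu> * \<nu> (fst (x m))))
      = - \<beta> * ((\<Sum>m<M. h (fst (x m))) - \<mu> * (\<Sum>m<M. \<nu> (fst (x m))))"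
    by (simp add: sum_negf sum_subtractf flip: sum_distrib_left)
  finally have 2: "copies_weight g x = exp (- \<beta> * ((\<Sum>m<M. h (fst (x m))) - \<mu> * (\<Sum>m<M. \<nu> (fst (x m)))))
      * (1 / (Z * real K)) ^ M" .
  have 3: "exp (- \<beta> * (bath_energy h W k - \<mu> * bath_energy \<nu> 0 k))
      = exp (- (\<beta> * (W * real (length xs))))
        * exp (- \<beta> * ((\<Sum>m<M. h (fst (x m))) - \<mu> * (\<Sum>m<M. \<nu> (fst (x m)))))"
    by (simp add: bath_energy_def k' ring_distribs flip: exp_add)
  show ?thesis
    unfolding 3 1 Z_def[symmetric] by (simp add: k' bath_weight_def word_weight_def 2 power_one_over)
qed

text \<open>\<open>compose\<close> merges the levels of system and battery into one index. These
  bijections translate between that index and the tuples on which \<open>move\<close> acts, in the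
  groupings that gain and cost need.\<close>

lemma split_levels_bij: "bij_betw (\<lambda>(a, k). (a div 2, a mod 2, k)) ({..<D * 2} \<times> bath) levels"
  unfolding levels_bath
  by (rule bij_betw_byWitness[where f' = "\<lambda>(i, b, k). (i * 2 + b, k)"])
    (auto simp: less_mult_imp_div_less)

lemma join_levels_bij: "bij_betw (\<lambda>(i, b, k). (i * 2 + b, k)) levels ({..<D * 2} \<times> bath)"
  unfolding levels_bath
  by (rule bij_betw_byWitness[where f' = "\<lambda>(a, k). (a div 2, a mod 2, k)"])
    (auto simp: less_mult_imp_div_less)

lemma rotate_levels_bij: "bij_betw (\<lambda>(i, b, k). (b, i, k)) levels ({..<2} \<times> {..<D} \<times> bath)"
  unfolding levels_bath
  by (rule bij_betw_byWitness[where f' = "\<lambda>(b, i, k). (i, b, k)"]) auto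

lemma unrotate_levels_bij: "bij_betw (\<lambda>(b, i, k). (i, b, k)) ({..<2} \<times> {..<D} \<times> bath) levels"
  unfolding levels_bath
  by (rule bij_betw_byWitness[where f' = "\<lambda>(i, b, k). (b, i, k)"]) auto

lemma energy_bath: "energy f W (i, b, k) = f i + W * real b + bath_energy f W k"
  by (cases k) (simp add: energy_def bath_energy_def)

lemma move_energy_bath:
  assumes "move (i, b, k) = (i', b', k')"
  shows "f i + W * real b + bath_energy f W k = f i' + W * real b' + bath_energy f W k'"
  using move_energy[of f W "(i, b, k)"] unfolding assms energy_bath by simp

text \<open>The battery is retained, while the system is discarded together with the bath. The
  common mass is \<open>1 - \<epsilon>\<close> on the upper level, so only the success probability
  of the move matters.\<close>

lemma gain_protocol:
  assumes \<beta>: "\<beta> > 0" and R: "state_spectrum D P R r h \<nu>"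
    and g: "g = gibbs_weight \<beta> D (\<lambda>i. h i - \<mu> * \<nu> i)" and W: "W = ln (real M) / \<beta>"
    and \<epsilon>: "0 \<le> \<epsilon>"
    and p: "1 - \<epsilon> \<le> (\<Sum>i<D. r i * (\<Sum>k\<in>bath. if fst (snd (move (i, 0, k))) = 1 then bath_weight g k else 0))"
  shows "equilibrating_approx \<beta> \<mu> \<epsilon> (compose R (battery E W 0)) (battery E W 1)"
proof -
  note Rd = state_spectrumD[OF R]
  have g1: "(\<Sum>i<D. g i) = 1" unfolding g by (rule gibbs_weight_sum[OF Rd(8)])
  have g0: "0 \<le> g i" if "i < D" for i unfolding g using gibbs_weight_pos[OF that] by (simp add: less_imp_le)
  define \<phi> where "\<phi> = (\<lambda>(i, b, k). (b, i, k)) \<circ> move \<circ> (\<lambda>(a, k). (a div 2 :: nat, a mod 2 :: nat, k))"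
  have \<phi>: "bij_betw \<phi> ({..<D * 2} \<times> bath) ({..<2} \<times> {..<D} \<times> bath)"
    unfolding \<phi>_def by (intro bij_betw_trans[OF split_levels_bij] bij_betw_trans[OF move_bij] rotate_levels_bij)
  have fst\<phi>: "fst (\<phi> (a, k)) = fst (snd (move (a div 2, a mod 2, k)))" for a k
    by (simp add: \<phi>_def case_prod_beta)
  note X = state_spectrum_compose[OF R battery_spectrum[of 0 E W]]
  show ?thesis
  proof (rule equilibrating_approx_of_bijection[OF X battery_spectrum finite_bath _
        bath_weight_exp[OF \<beta> g W] bath_weight_sum[OF g1] \<phi>,
        where \<kappa>' = "\<lambda>(i, k). h i + bath_energy h W k" and \<eta>' = "\<lambda>(i, k). \<nu> i + bath_energy \<nu> 0 k"
        and l = "\<lambda>j. if j = 1 then 1 - \<epsilon> else 0"])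
    show "finite ({..<D} \<times> bath)" using finite_bath by simp
  next
    fix a k
    obtain i' b' k' where m: "move (a div 2, a mod 2, k) = (i', b', k')" by (metis prod_cases3)
    show "h (a div 2) + (E + W * real (a mod 2)) + bath_energy h W k
      = E + W * real (fst (\<phi> (a, k))) + (case snd (\<phi> (a, k)) of (i, k) \<Rightarrow> h i + bath_energy h W k)"
      using move_energy_bath[OF m, of h W] by (simp add: \<phi>_def m)
    show "\<nu> (a div 2) + 0 + bath_energy \<nu> 0 k = 0 + (case snd (\<phi> (a, k)) of (i, k) \<Rightarrow> \<nu> i + bath_energy \<nu> 0 k)"
      using move_energy_bath[OF m, of \<nu> 0] by (simp add: \<phi>_def m)
  next
    fix j :: nat assume "j < 2"
    show "(if j = 1 then 1 - \<epsilon> else 0) \<le> (if j = 1 then 1 else 0)" using \<epsilon> by simp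
    have "(\<Sum>i<D * 2. \<Sum>k\<in>bath. if fst (\<phi> (i, k)) = j
        then r (i div 2) * (if i mod 2 = 0 then 1 else 0) * bath_weight g k else 0)
      = (\<Sum>i<D. \<Sum>k\<in>bath. if fst (snd (move (i, 0, k))) = j then r i * bath_weight g k else 0)"
      unfolding sum_mult_split fst\<phi> sum_less_2 by (simp add: Suc_double_mod cong: if_cong)
    also have "\<dots> = (\<Sum>i<D. r i * (\<Sum>k\<in>bath. if fst (snd (move (i, 0, k))) = j then bath_weight g k else 0))"
      by (simp add: sum_distrib_left if_distrib[of "\<lambda>x. _ * x"] cong: if_cong)
    finally have s: "(\<Sum>i<D * 2. \<Sum>k\<in>bath. if fst (\<phi> (i, k)) = j
        then r (i div 2) * (if i mod 2 = 0 then 1 else 0) * bath_weight g k else 0)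
      = (\<Sum>i<D. r i * (\<Sum>k\<in>bath. if fst (snd (move (i, 0, k))) = j then bath_weight g k else 0))" .
    have "0 \<le> (\<Sum>i<D. r i * (\<Sum>k\<in>bath. if fst (snd (move (i, 0, k))) = j then bath_weight g k else 0))"
      by (intro sum_nonneg mult_nonneg_nonneg) (auto simp: Rd(4) bath_weight_nonneg[OF g0])
    then show "(if j = 1 then 1 - \<epsilon> else 0) \<le> (\<Sum>i<D * 2. \<Sum>k\<in>bath. if fst (\<phi> (i, k)) = j
        then r (i div 2) * (if i mod 2 = 0 then 1 else 0) * bath_weight g k else 0)"
      unfolding s using p by simp
  qed (simp_all add: numeral_2_eq_2)
qed

text \<open>The place of the system is first taken by an equilibrium copy belonging to the bath,
  hence the average over \<open>g\<close>. System and battery are retained, and the common mass sits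
  on battery level 0, that is, on the even indices of the composite.\<close>

lemma cost_protocol:
  assumes \<beta>: "\<beta> > 0" and R: "state_spectrum D P R r h \<nu>"
    and g: "g = gibbs_weight \<beta> D (\<lambda>i. h i - \<mu> * \<nu> i)" and W: "W = ln (real M) / \<beta>"
    and l: "\<And>i. i < D \<Longrightarrow> l i \<le> r i"
      "\<And>i. i < D \<Longrightarrow> l i \<le> (\<Sum>i'<D. g i' * (\<Sum>k\<in>bath.
        if fst (move (i', 1, k)) = i \<and> fst (snd (move (i', 1, k))) = 0 then bath_weight g k else 0))"
      "1 - \<epsilon> \<le> (\<Sum>i<D. l i)"
  shows "equilibrating_approx \<beta> \<mu> \<epsilon> (battery E W 1) (compose R (battery E W 0))"
proof -
  note Rd = state_spectrumD[OF R]
  have g1: "(\<Sum>i<D. g i) = 1" unfolding g by (rule gibbs_weight_sum[OF Rd(8)])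
  have g0: "0 \<le> g i" if "i < D" for i unfolding g using gibbs_weight_pos[OF that] by (simp add: less_imp_le)
  define w where "w = (\<lambda>(i, k). g i * bath_weight g k)"
  define \<phi> where "\<phi> = (\<lambda>(i, b, k). (i * 2 + b :: nat, k)) \<circ> move \<circ> (\<lambda>(b, i, k). (i, b, k))"
  have \<phi>: "bij_betw \<phi> ({..<2} \<times> {..<D} \<times> bath) ({..<D * 2} \<times> bath)"
    unfolding \<phi>_def by (intro bij_betw_trans[OF unrotate_levels_bij] bij_betw_trans[OF move_bij] join_levels_bij)
  define Z where "Z = (\<Sum>j<D. exp (- \<beta> * (h j - \<mu> * \<nu> j)))"
  have w: "w k = (1 / Z * (1 / ((real L + 1) * (Z * real K) ^ M)))
      * exp (- \<beta> * ((case k of (i, k) \<Rightarrow> h i + bath_energy h W k) - \<mu> * (case k of (i, k) \<Rightarrow> \<nu> i + bath_energy \<nu> 0 k)))"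
    if k: "k \<in> {..<D} \<times> bath" for k
  proof -
    obtain i b where k': "k = (i, b)" "b \<in> bath" using k by auto
    have "exp (- \<beta> * (h i + bath_energy h W b - \<mu> * (\<nu> i + bath_energy \<nu> 0 b)))
        = exp (- \<beta> * (h i - \<mu> * \<nu> i)) * exp (- \<beta> * (bath_energy h W b - \<mu> * bath_energy \<nu> 0 b))"
      by (simp add: ring_distribs flip: exp_add)
    then show ?thesis
      unfolding w_def k'(1) using bath_weight_exp[OF \<beta> g W k'(2)]
      by (simp add: g gibbs_weight_def Z_def)
  qed
  have w1: "(\<Sum>k\<in>{..<D} \<times> bath. w k) = 1"
    using g1 bath_weight_sum[OF g1]
    by (simp add: w_def sum.cartesian_product[symmetric] flip: sum_product)
  note Y = state_spectrum_compose[OF R battery_spectrum[of 0 E W]]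
  show ?thesis
  proof (rule equilibrating_approx_of_bijection[OF battery_spectrum Y _ finite_bath w w1 \<phi>,
        where \<kappa>' = "bath_energy h W" and \<eta>' = "bath_energy \<nu> 0"
        and l = "\<lambda>j. if j mod 2 = 0 then l (j div 2) else 0"])
    show "finite ({..<D} \<times> bath)" using finite_bath by simp
  next
    fix b :: nat and p assume b: "b < 2" and "p \<in> {..<D} \<times> bath"
    obtain i k where p: "p = (i, k)" by (cases p)
    obtain i' b' k' where m: "move (i, b, k) = (i', b', k')" by (metis prod_cases3)
    have "move (i, b, k) \<in> levels"
      using move_levels[of "(i, b, k)"] b p \<open>p \<in> _\<close> by (auto simp: levels_bath)
    then have b': "b' < 2" unfolding m levels_bath by simp
    show "E + W * real b + (case p of (i, k) \<Rightarrow> h i + bath_energy h W k)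
      = h (fst (\<phi> (b, p)) div 2) + (E + W * real (fst (\<phi> (b, p)) mod 2)) + bath_energy h W (snd (\<phi> (b, p)))"
      using move_energy_bath[OF m, of h W] b' by (simp add: \<phi>_def m p)
    show "0 + (case p of (i, k) \<Rightarrow> \<nu> i + bath_energy \<nu> 0 k)
      = \<nu> (fst (\<phi> (b, p)) div 2) + 0 + bath_energy \<nu> 0 (snd (\<phi> (b, p)))"
      using move_energy_bath[OF m, of \<nu> 0] b' by (simp add: \<phi>_def m p)
  next
    fix j :: nat assume j: "j < D * 2"
    then have j2: "j div 2 < D" by auto
    show "(if j mod 2 = 0 then l (j div 2) else 0) \<le> r (j div 2) * (if j mod 2 = 0 then 1 else 0)"
      using l(1)[OF j2] by simp
    have w0: "0 \<le> w p" if "p \<in> {..<D} \<times> bath" for p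
      using that g0 bath_weight_nonneg[OF g0] by (auto simp: w_def)
    have "(\<Sum>b<2. \<Sum>p\<in>{..<D} \<times> bath. if fst (\<phi> (b, p)) = j then (if b = 1 then 1 else 0) * w p else 0)
        = (\<Sum>p\<in>{..<D} \<times> bath. if fst (\<phi> (1, p)) = j then w p else 0)"
      unfolding sum_less_2 by (simp cong: if_cong)
    also have "\<dots> = (\<Sum>i<D. \<Sum>k\<in>bath. if fst (\<phi> (1, i, k)) = j then g i * bath_weight g k else 0)"
      by (simp add: sum.cartesian_product w_def case_prod_beta cong: if_cong)
    finally have s: "(\<Sum>b<2. \<Sum>p\<in>{..<D} \<times> bath. if fst (\<phi> (b, p)) = j then (if b = 1 then 1 else 0) * w p else 0)
        = (\<Sum>i<D. \<Sum>k\<in>bath. if fst (\<phi> (1, i, k)) = j then g i * bath_weight g k else 0)" .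
    show "(if j mod 2 = 0 then l (j div 2) else 0) \<le>
        (\<Sum>b<2. \<Sum>p\<in>{..<D} \<times> bath. if fst (\<phi> (b, p)) = j then (if b = 1 then 1 else 0) * w p else 0)"
    proof (cases "j mod 2 = 0")
      case True
      have "l (j div 2) \<le> (\<Sum>i'<D. g i' * (\<Sum>k\<in>bath.
        if fst (move (i', 1, k)) = j div 2 \<and> fst (snd (move (i', 1, k))) = 0 then bath_weight g k else 0))"
        by (rule l(2)[OF j2])
      also have "\<dots> = (\<Sum>i<D. \<Sum>k\<in>bath.
        if fst (move (i, 1, k)) = j div 2 \<and> fst (snd (move (i, 1, k))) = 0 then g i * bath_weight g k else 0)"
        by (simp add: sum_distrib_left if_distrib[of "\<lambda>x. _ * x"] cong: if_cong)
      also have "\<dots> \<le> (\<Sum>i<D. \<Sum>k\<in>bath. if fst (\<phi> (1, i, k)) = j then g i * bath_weight g k else 0)"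
        by (intro sum_mono) (use True g0 bath_weight_nonneg[OF g0] in \<open>auto simp: \<phi>_def case_prod_beta\<close>)
      finally show ?thesis unfolding s using True by simp
    next
      case False
      then show ?thesis
        by (simp add: sum_nonneg w0)
    qed
  next
    have "(\<Sum>j<D * 2. if j mod 2 = 0 then l (j div 2) else 0) = (\<Sum>i<D. l i)"
      unfolding sum_mult_split sum_less_2 by (simp add: Suc_double_mod)
    then show "1 - \<epsilon> \<le> (\<Sum>j<D * 2. if j mod 2 = 0 then l (j div 2) else 0)" using l(3) by simp
  qed simp_all
qed

end

section \<open>Success probabilities of the moves\<close>

context work_protocol
begin

lemma word_weight_nonneg: "0 \<le> word_weight xs"
  by (simp add: word_weight_def)

lemma copies_weight_nonneg:
  assumes "\<And>i. i < D \<Longrightarrow> 0 \<le> g i" "x \<in> copies_levels"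
  shows "0 \<le> copies_weight g x"
  using assms copies_levels_fst by (auto simp: copies_weight_def intro!: divide_nonneg_nonneg prod_nonneg)

lemma words_length_positive: "(\<Sum>xs | xs \<in> words \<and> 0 < length xs. word_weight xs) = real L / (real L + 1)"
proof -
  have "{k. k \<le> L \<and> 0 < k} = {0<..L}" by auto
  then show ?thesis using sum_words[of "\<lambda>k. 0 < k"] by simp
qed

lemma words_length_less: "(\<Sum>xs | xs \<in> words \<and> length xs < L. word_weight xs) = real L / (real L + 1)"
proof -
  have "{k. k \<le> L \<and> k < L} = {..<L}" by auto
  then show ?thesis using sum_words[of "\<lambda>k. k < L"] by simp
qed

lemma rate_nonneg: "0 \<le> g i \<Longrightarrow> 0 \<le> rate g i"
  by (simp add: rate_def)

lemma rate_le: "0 \<le> g i \<Longrightarrow> i < D \<Longrightarrow> rate g i \<le> g i"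
  using c[of i] K by (simp add: rate_def divide_simps mult_left_mono)

text \<open>A level accepted for every register value is found again in copy \<open>j\<close> once
  the earlier copies are rejected, which has probability \<open>(1 - \<alpha>) ^ j\<close>;
  Bernoulli's inequality bounds this for the worst letter \<open>M - 1\<close>. The factor
  \<open>L / (L + 1)\<close> is the probability that there is a letter to pop.\<close>

lemma gain_success:
  assumes g1: "(\<Sum>i<D. g i) = 1" and g0: "\<And>i. i < D \<Longrightarrow> 0 \<le> g i" and i: "i < D" "c i = K"
  shows "real L / (real L + 1) * (1 - real (M - 1) * (\<Sum>i<D. rate g i))
    \<le> (\<Sum>k\<in>bath. if fst (snd (move (i, 0, k))) = 1 then bath_weight g k else 0)"
proof -
  define \<alpha> where "\<alpha> = (\<Sum>i<D. rate g i)"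
  have \<alpha>: "0 \<le> \<alpha>" "\<alpha> \<le> 1"
    unfolding \<alpha>_def using g0 sum_mono[of "{..<D}" "rate g" g] g1 by (auto intro!: sum_nonneg rate_nonneg rate_le)
  have bound: "1 - real (M - 1) * \<alpha> \<le> (\<Sum>x\<in>copies_levels. if fst (snd (move (i, 0, xs, x))) = 1 then copies_weight g x else 0)"
    if xs: "xs \<in> words" "0 < length xs" for xs
  proof -
    obtain j ys where ys: "xs = j # ys" using xs by (cases xs) auto
    then have j: "j < M" using xs by (auto simp: words_def)
    have "1 + real j * (- \<alpha>) \<le> (1 + (- \<alpha>)) ^ j"
      by (rule Bernoulli_inequality) (use \<alpha> in simp)
    moreover have "real j * \<alpha> \<le> real (M - 1) * \<alpha>" using j \<alpha> by (intro mult_right_mono) auto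
    ultimately have "1 - real (M - 1) * \<alpha> \<le> (1 - \<alpha>) ^ j" by simp
    also have "\<dots> = (\<Sum>x | x \<in> copies_levels \<and> (\<forall>m<j. x m \<notin> accepted) \<and> x j \<in> {..<D} \<times> {..<K}. copies_weight g x)"
      using probability_first[OF g1 j, of "{..<D} \<times> {..<K}"] sum_levels[OF g1] by (simp add: \<alpha>_def)
    also have "\<dots> = (\<Sum>x | x \<in> copies_levels \<and> (\<forall>m<j. x m \<notin> accepted) \<and> x j \<in> {..<D} \<times> {..<K}.
        if fst (snd (move (i, 0, xs, x))) = 1 then copies_weight g x else 0)"
    proof (rule sum.cong[OF refl])
      fix x assume x: "x \<in> {x. x \<in> copies_levels \<and> (\<forall>m<j. x m \<notin> accepted) \<and> x j \<in> {..<D} \<times> {..<K}}"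
      then have "picks (swap i j x) j"
        using i j by (auto simp: picks_def accepted_def swap_def mem_Times_iff)
      then show "copies_weight g x = (if fst (snd (move (i, 0, xs, x))) = 1 then copies_weight g x else 0)"
        by (simp add: ys move_down)
    qed
    also have "\<dots> \<le> (\<Sum>x\<in>copies_levels. if fst (snd (move (i, 0, xs, x))) = 1 then copies_weight g x else 0)"
      by (rule sum_mono2) (use finite_copies_levels copies_weight_nonneg[OF g0] in auto)
    finally show ?thesis .
  qed
  have "real L / (real L + 1) * (1 - real (M - 1) * \<alpha>)
      = (\<Sum>xs | xs \<in> words \<and> 0 < length xs. word_weight xs * (1 - real (M - 1) * \<alpha>))"
    using words_length_positive by (simp flip: sum_distrib_right)
  also have "\<dots> \<le> (\<Sum>xs | xs \<in> words \<and> 0 < length xs. word_weight xs *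
      (\<Sum>x\<in>copies_levels. if fst (snd (move (i, 0, xs, x))) = 1 then copies_weight g x else 0))"
    by (intro sum_mono mult_left_mono word_weight_nonneg) (use bound in auto)
  also have "\<dots> \<le> (\<Sum>xs\<in>words. word_weight xs *
      (\<Sum>x\<in>copies_levels. if fst (snd (move (i, 0, xs, x))) = 1 then copies_weight g x else 0))"
    by (rule sum_mono2)
      (auto simp: finite_words word_weight_nonneg copies_weight_nonneg[OF g0] intro!: mult_nonneg_nonneg sum_nonneg)
  also have "\<dots> = (\<Sum>k\<in>bath. if fst (snd (move (i, 0, k))) = 1 then bath_weight g k else 0)"
    unfolding sum_bath bath_weight_def by (simp add: sum_distrib_left if_distrib[of "\<lambda>x. _ * x"] cong: if_cong)
  finally show ?thesis by (simp add: \<alpha>_def)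
qed

text \<open>The move pushes a letter if the word is not full, whence \<open>L / (L + 1)\<close>.
  Copy \<open>j\<close> is the first accepted one and has level \<open>i\<close> with probability
  \<open>(1 - \<alpha>) ^ j * rate g i\<close>; these events are disjoint for different
  \<open>j\<close> and independent of the level \<open>i'\<close> being replaced.\<close>

lemma cost_success:
  assumes g1: "(\<Sum>i<D. g i) = 1" and g0: "\<And>i. i < D \<Longrightarrow> 0 \<le> g i" and i: "i < D"
  shows "real L / (real L + 1) * (rate g i * (\<Sum>j<M. (1 - (\<Sum>i<D. rate g i)) ^ j))
    \<le> (\<Sum>i'<D. g i' * (\<Sum>k\<in>bath.
        if fst (move (i', 1, k)) = i \<and> fst (snd (move (i', 1, k))) = 0 then bath_weight g k else 0))"
proof -
  define \<alpha> where "\<alpha> = (\<Sum>i<D. rate g i)"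
  define Q where "Q = (\<lambda>(x :: nat \<Rightarrow> nat \<times> nat) (j :: nat). (\<forall>m<j. x m \<notin> accepted) \<and> x j \<in> {i} \<times> {..<c i})"
  have Qpicks: "picks x j \<and> fst (x j) = i" if "Q x j" "j < M" for x j
  proof -
    have x: "fst (x j) = i" "snd (x j) < c i" "\<forall>m<j. x m \<notin> accepted"
      using that(1) by (auto simp: Q_def mem_Times_iff)
    then have "x j \<in> accepted" using i by (simp add: accepted_def case_prod_beta)
    then show ?thesis using x that(2) by (simp add: picks_def)
  qed
  have bound: "rate g i * (\<Sum>j<M. (1 - \<alpha>) ^ j) \<le> (\<Sum>x\<in>copies_levels.
      if fst (move (i', 1, xs, x)) = i \<and> fst (snd (move (i', 1, xs, x))) = 0 then copies_weight g x else 0)"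
    if xs: "length xs < L" for xs i'
  proof -
    have F: "{i} \<times> {..<c i} \<subseteq> {..<D} \<times> {..<K}" using c[OF i] i by auto
    have "(\<Sum>v\<in>{i} \<times> {..<c i}. g (fst v) / real K) = (\<Sum>i'\<in>{i}. \<Sum>s<c i. g i' / real K)"
      unfolding sum.cartesian_product case_prod_beta ..
    then have ri: "(\<Sum>v\<in>{i} \<times> {..<c i}. g (fst v) / real K) = rate g i"
      by (simp add: rate_def mult.commute)
    have "rate g i * (\<Sum>j<M. (1 - \<alpha>) ^ j) = (\<Sum>j<M. (1 - \<alpha>) ^ j * rate g i)"
      by (simp add: sum_distrib_left mult.commute)
    also have "\<dots> = (\<Sum>j<M. \<Sum>x | x \<in> copies_levels \<and> Q x j. copies_weight g x)"
      by (intro sum.cong refl) (use probability_first[OF g1 _ F] ri in \<open>simp add: \<alpha>_def Q_def\<close>)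
    also have "\<dots> = (\<Sum>j<M. \<Sum>x\<in>copies_levels. if Q x j then copies_weight g x else 0)"
      by (rule sum.cong[OF refl], rule sum.inter_filter[OF finite_copies_levels])
    also have "\<dots> = (\<Sum>x\<in>copies_levels. \<Sum>j<M. if Q x j then copies_weight g x else 0)"
      by (rule sum.swap)
    also have "\<dots> \<le> (\<Sum>x\<in>copies_levels.
      if fst (move (i', 1, xs, x)) = i \<and> fst (snd (move (i', 1, xs, x))) = 0 then copies_weight g x else 0)"
    proof (rule sum_mono)
      fix x assume x: "x \<in> copies_levels"
      show "(\<Sum>j<M. if Q x j then copies_weight g x else 0)
        \<le> (if fst (move (i', 1, xs, x)) = i \<and> fst (snd (move (i', 1, xs, x))) = 0 then copies_weight g x else 0)"
      proof (cases "\<exists>j<M. Q x j")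
        case True
        then obtain j where j: "j < M" "Q x j" by blast
        \<comment> \<open>Only one copy can be picked, so at most one term of the sum over
          \<open>j\<close> is nonzero.\<close>
        have "(Q x k) = (k = j)" if "k < M" for k
          using j that Qpicks picks_unique by blast
        then have "(\<Sum>k<M. if Q x k then copies_weight g x else 0)
            = (\<Sum>k<M. if k = j then copies_weight g x else 0)"
          by (intro sum.cong refl) auto
        also have "\<dots> = copies_weight g x" using j by simp
        finally show ?thesis using move_up[OF xs, of x j i'] Qpicks[OF j(2,1)] by simp
      next
        case False
        then have "(\<Sum>k<M. if Q x k then copies_weight g x else 0) = 0"
          by (intro sum.neutral) auto
        then show ?thesis using copies_weight_nonneg[OF g0 x] by simp
      qed
    qed
    finally show ?thesis .
  qed
  have inner: "real L / (real L + 1) * (rate g i * (\<Sum>j<M. (1 - \<alpha>) ^ j)) \<le> (\<Sum>k\<in>bath.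
      if fst (move (i', 1, k)) = i \<and> fst (snd (move (i', 1, k))) = 0 then bath_weight g k else 0)" for i'
  proof -
    have "real L / (real L + 1) * (rate g i * (\<Sum>j<M. (1 - \<alpha>) ^ j))
        = (\<Sum>xs | xs \<in> words \<and> length xs < L. word_weight xs * (rate g i * (\<Sum>j<M. (1 - \<alpha>) ^ j)))"
      using words_length_less by (simp flip: sum_distrib_right)
    also have "\<dots> \<le> (\<Sum>xs | xs \<in> words \<and> length xs < L. word_weight xs * (\<Sum>x\<in>copies_levels.
        if fst (move (i', 1, xs, x)) = i \<and> fst (snd (move (i', 1, xs, x))) = 0 then copies_weight g x else 0))"
      by (intro sum_mono mult_left_mono word_weight_nonneg bound) auto
    also have "\<dots> \<le> (\<Sum>xs\<in>words. word_weight xs * (\<Sum>x\<in>copies_levels.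
        if fst (move (i', 1, xs, x)) = i \<and> fst (snd (move (i', 1, xs, x))) = 0 then copies_weight g x else 0))"
      by (rule sum_mono2)
        (auto simp: finite_words word_weight_nonneg copies_weight_nonneg[OF g0] intro!: mult_nonneg_nonneg sum_nonneg)
    also have "\<dots> = (\<Sum>k\<in>bath. if fst (move (i', 1, k)) = i \<and> fst (snd (move (i', 1, k))) = 0
        then bath_weight g k else 0)"
      unfolding sum_bath bath_weight_def by (simp add: sum_distrib_left if_distrib[of "\<lambda>x. _ * x"] cong: if_cong)
    finally show ?thesis .
  qed
  have "real L / (real L + 1) * (rate g i * (\<Sum>j<M. (1 - \<alpha>) ^ j))
      = (\<Sum>i'<D. g i' * (real L / (real L + 1) * (rate g i * (\<Sum>j<M. (1 - \<alpha>) ^ j))))"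
    unfolding sum_distrib_right[symmetric] g1 by simp
  also have "\<dots> \<le> (\<Sum>i'<D. g i' * (\<Sum>k\<in>bath.
        if fst (move (i', 1, k)) = i \<and> fst (snd (move (i', 1, k))) = 0 then bath_weight g k else 0))"
    by (intro sum_mono mult_left_mono inner) (use g0 in auto)
  finally show ?thesis by (simp add: \<alpha>_def)
qed

end

section \<open>Lower bounds on work\<close>

text \<open>A strict slack in the success probability absorbs the loss at the ends of a long
  ladder.\<close>

lemma ladder_length:
  fixes a b :: real
  assumes "b < a"
  obtains L :: nat where "b \<le> real L / (real L + 1) * a"
proof -
  have "(\<lambda>L. real L / (real L + 1) * a) \<longlonglongrightarrow> 1 * a"
    by (intro tendsto_mult tendsto_const) (rule LIMSEQ_n_over_Suc_n[unfolded of_nat_Suc add.commute[of 1]])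
  then have "\<forall>\<^sub>F L in sequentially. b < real L / (real L + 1) * a"
    using assms by (intro order_tendstoD(1)[where a = b]) simp_all
  then obtain L where "b < real L / (real L + 1) * a"
    using eventually_happens trivial_limit_sequentially by blast
  then show thesis using that[of L] by simp
qed

lemma gain_achievable:
  assumes \<beta>: "\<beta> > 0" and R: "state_spectrum n P R r h \<nu>"
    and g: "g = gibbs_weight \<beta> n (\<lambda>i. h i - \<mu> * \<nu> i)"
    and \<epsilon>: "0 \<le> \<epsilon>" and \<delta>: "0 < \<delta>" "\<delta> < 1"
    and p: "1 - \<epsilon> < (1 - \<delta>) * (\<Sum>i | i < n \<and> exp \<theta> * g i \<le> r i. r i)"
  obtains W where "\<theta> + ln \<delta> \<le> \<beta> * W"
    "\<And>E. \<exists>B B'. battery_pair \<beta> \<mu> E W B B' \<and> equilibrating_approx \<beta> \<mu> \<epsilon> (compose R B) B'"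
proof -
  note Rd = state_spectrumD[OF R]
  have g1: "(\<Sum>i<n. g i) = 1" unfolding g by (rule gibbs_weight_sum[OF Rd(8)])
  have g0: "0 < g i" if "i < n" for i unfolding g by (rule gibbs_weight_pos[OF that])
  then have g0': "0 \<le> g i" if "i < n" for i using that by (simp add: less_imp_le)
  define A where "A = {i. i < n \<and> exp \<theta> * g i \<le> r i}"
  have A: "A \<subseteq> {..<n}" by (auto simp: A_def)
  \<comment> \<open>The choice has \<open>M - 1\<close> at most and \<open>M\<close> at least
    \<open>\<delta> * exp \<theta>\<close>. The first keeps the failure probability below
    \<open>\<delta>\<close>, because \<open>A\<close> has \<open>g\<close>-weight at most
    \<open>exp (- \<theta>)\<close>; the second gives the work.\<close>
  define M where "M = nat \<lfloor>\<delta> * exp \<theta>\<rfloor> + 1"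
  obtain L where L: "1 - \<epsilon> \<le> real L / (real L + 1) * ((1 - \<delta>) * (\<Sum>i\<in>A. r i))"
    using ladder_length[OF p] unfolding A_def by blast
  \<comment> \<open>Here acceptance means membership in \<open>A\<close>, with no randomness, so a
    register of one level is enough.\<close>
  define K1 :: nat where "K1 = 1"
  define c :: "nat \<Rightarrow> nat" where "c = (\<lambda>i. if i \<in> A then 1 else 0)"
  interpret work_protocol n M L K1 c
    by unfold_locales (auto simp: M_def K1_def c_def)
  have \<alpha>: "(\<Sum>i<n. rate g i) = (\<Sum>i\<in>A. g i)"
  proof -
    have "(\<Sum>i<n. rate g i) = (\<Sum>i<n. if i \<in> A then g i else 0)"
      unfolding rate_def by (intro sum.cong) (auto simp: c_def K1_def)
    then show ?thesis using A by (simp add: sum.If_cases Int_absorb1)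
  qed
  have "exp \<theta> * (\<Sum>i\<in>A. g i) \<le> (\<Sum>i\<in>A. r i)"
    unfolding sum_distrib_left by (rule sum_mono) (auto simp: A_def)
  also have "\<dots> \<le> (\<Sum>i<n. r i)" by (rule sum_mono2) (use A Rd(4) in auto)
  finally have gA: "exp \<theta> * (\<Sum>i\<in>A. g i) \<le> 1" unfolding Rd(5) .
  have M1: "real (M - 1) \<le> \<delta> * exp \<theta>" using \<delta> by (simp add: M_def)
  have M2: "\<delta> * exp \<theta> \<le> real M" using \<delta> by (simp add: M_def) linarith
  have "real (M - 1) * (\<Sum>i\<in>A. g i) \<le> \<delta> * exp \<theta> * (\<Sum>i\<in>A. g i)"
    by (rule mult_right_mono[OF M1]) (use g0' A in \<open>force intro: sum_nonneg\<close>)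
  also have "\<dots> \<le> \<delta> * 1" unfolding mult.assoc using gA \<delta> by (intro mult_left_mono) auto
  finally have Mg: "1 - \<delta> \<le> 1 - real (M - 1) * (\<Sum>i\<in>A. g i)" by simp
  define W where "W = ln (real M) / \<beta>"
  have "1 - \<epsilon> \<le> (\<Sum>i\<in>A. r i * (real L / (real L + 1) * (1 - \<delta>)))"
    unfolding sum_distrib_right[symmetric] using L by (simp add: ac_simps)
  also have "\<dots> \<le> (\<Sum>i\<in>A. r i * (\<Sum>k\<in>bath. if fst (snd (move (i, 0, k))) = 1 then bath_weight g k else 0))"
  proof (intro sum_mono mult_left_mono)
    fix i assume i: "i \<in> A"
    then have i': "i < n" using A by auto
    show "0 \<le> r i" by (rule Rd(4)[OF i'])
    have "real L / (real L + 1) * (1 - \<delta>) \<le> real L / (real L + 1) * (1 - real (M - 1) * (\<Sum>i<n. rate g i))"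
      by (intro mult_left_mono) (use Mg in \<open>simp_all add: \<alpha>\<close>)
    also have "\<dots> \<le> (\<Sum>k\<in>bath. if fst (snd (move (i, 0, k))) = 1 then bath_weight g k else 0)"
      by (rule gain_success[OF g1 _ i']) (use i g0' in \<open>auto simp: c_def K1_def\<close>)
    finally show "real L / (real L + 1) * (1 - \<delta>)
      \<le> (\<Sum>k\<in>bath. if fst (snd (move (i, 0, k))) = 1 then bath_weight g k else 0)" .
  qed
  also have "\<dots> \<le> (\<Sum>i<n. r i * (\<Sum>k\<in>bath. if fst (snd (move (i, 0, k))) = 1 then bath_weight g k else 0))"
    by (rule sum_mono2)
      (use A Rd(4) bath_weight_nonneg[OF g0'] in \<open>auto intro!: mult_nonneg_nonneg sum_nonneg\<close>)
  finally have "equilibrating_approx \<beta> \<mu> \<epsilon> (compose R (battery E W 0)) (battery E W 1)" for E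
    by (rule gain_protocol[OF \<beta> R g W_def \<epsilon>])
  moreover have "\<theta> + ln \<delta> \<le> \<beta> * W"
  proof -
    have "\<theta> + ln \<delta> = ln (\<delta> * exp \<theta>)" using \<delta> by (simp add: ln_mult)
    also have "\<dots> \<le> ln (real M)" using M2 \<delta> by (intro ln_mono) auto
    finally show ?thesis using \<beta> by (simp add: W_def)
  qed
  ultimately show thesis using that[of W] battery_pair_battery by blast
qed

text \<open>The slack \<open>\<kappa>\<close> is split: one quarter for rounding the acceptance
  probabilities, one for the chance that no copy is accepted, and the remainder for the ends of the
  ladder.\<close>

lemma cost_achievable:
  assumes \<beta>: "\<beta> > 0" and R: "state_spectrum n P R r h \<nu>"
    and g: "g = gibbs_weight \<beta> n (\<lambda>i. h i - \<mu> * \<nu> i)"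
    and \<epsilon>: "\<epsilon> < 1" and \<kappa>: "0 < \<kappa>" "\<kappa> < 1"
    and p: "1 - \<epsilon> + \<kappa> \<le> (\<Sum>i | i < n \<and> r i \<le> exp \<theta> * g i. r i)"
  obtains W where "\<beta> * W \<le> \<theta> + ln (4 / (3 * \<kappa>) * ln (4 / \<kappa>) + 2 / \<kappa>)"
    "\<And>E. \<exists>B B'. battery_pair \<beta> \<mu> E W B B' \<and> equilibrating_approx \<beta> \<mu> \<epsilon> B' (compose R B)"
proof -
  note Rd = state_spectrumD[OF R]
  have g1: "(\<Sum>i<n. g i) = 1" unfolding g by (rule gibbs_weight_sum[OF Rd(8)])
  have g0: "0 < g i" if "i < n" for i unfolding g by (rule gibbs_weight_pos[OF that])
  then have g0': "0 \<le> g i" if "i < n" for i using that by (simp add: less_imp_le)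
  define A where "A = {i. i < n \<and> r i \<le> exp \<theta> * g i}"
  have A: "A \<subseteq> {..<n}" "finite A" by (auto simp: A_def)
  define a where "a = (\<Sum>i\<in>A. r i)"
  have a: "1 - \<epsilon> + \<kappa> \<le> a" "\<kappa> < a" using p \<epsilon> by (auto simp: a_def A_def)
  have a1: "a \<le> 1" unfolding a_def Rd(5)[symmetric] by (rule sum_mono2) (use A Rd(4) in auto)
  have "a \<le> (\<Sum>i\<in>A. exp \<theta> * g i)" unfolding a_def by (rule sum_mono) (auto simp: A_def)
  also have "\<dots> \<le> exp \<theta> * (\<Sum>i<n. g i)"
    unfolding sum_distrib_left by (rule sum_mono2) (use A g0' in auto)
  finally have a\<theta>: "a \<le> exp \<theta>" unfolding g1 by simp
  \<comment> \<open>Rounding the acceptance probabilities down to multiples of \<open>1 / K\<close>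
    lowers \<open>exp \<theta> * \<alpha>\<close> by at most \<open>exp \<theta> / K\<close>, which
    is at most \<open>\<kappa> / 4\<close>.\<close>
  define K where "K = nat \<lceil>4 * exp \<theta> / \<kappa>\<rceil> + 1"
  have Kx: "0 < K" "4 * exp \<theta> / \<kappa> \<le> real K" unfolding K_def by (simp, linarith)
  \<comment> \<open>Rejection sampling: accepting level \<open>i\<close> with probability about \<open>r i / (exp \<theta> * g i)\<close> makes the
    first accepted copy distributed almost like \<open>r\<close> restricted to \<open>A\<close>.\<close>
  define c where "c = (\<lambda>i. if i \<in> A then nat \<lfloor>real K * r i / (exp \<theta> * g i)\<rfloor> else 0)"
  have c1: "real (c i) \<le> real K * r i / (exp \<theta> * g i)" and c2: "real K * r i / (exp \<theta> * g i) - 1 \<le> real (c i)"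
    if "i \<in> A" for i
  proof -
    have "0 \<le> real K * r i / (exp \<theta> * g i)"
      using that A Rd(4)[of i] g0[of i] by (intro divide_nonneg_nonneg mult_nonneg_nonneg) auto
    then show "real (c i) \<le> real K * r i / (exp \<theta> * g i)" "real K * r i / (exp \<theta> * g i) - 1 \<le> real (c i)"
      using that unfolding c_def by (simp_all, linarith?)
  qed
  have cK: "c i \<le> K" if "i < n" for i
  proof (cases "i \<in> A")
    case True
    have "real K * r i \<le> real K * (exp \<theta> * g i)" using True by (intro mult_left_mono) (auto simp: A_def)
    then have "real K * r i / (exp \<theta> * g i) \<le> real K" using g0[OF that] by (simp add: divide_le_eq)
    then show ?thesis using c1[OF True] by linarith
  qed (simp add: c_def)
  \<comment> \<open>As \<open>exp \<theta> * \<alpha>\<close> will be at least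
    \<open>3 / 4 * \<kappa>\<close>, having \<open>M\<close> at least
    \<open>C * exp \<theta>\<close> makes \<open>\<alpha> * M\<close> at least
    \<open>ln (4 / \<kappa>)\<close>. Then all \<open>M\<close> copies are rejected with probability
    at most \<open>\<kappa> / 4\<close>.\<close>
  define C where "C = 4 / (3 * \<kappa>) * ln (4 / \<kappa>)"
  have C: "0 \<le> C" using \<kappa> by (simp add: C_def)
  define M where "M = nat \<lceil>C * exp \<theta>\<rceil> + 1"
  have "0 \<le> C * exp \<theta>" using C by simp
  then have Mx: "0 < M" "C * exp \<theta> \<le> real M" "real M \<le> C * exp \<theta> + 2"
    unfolding M_def by (simp, linarith, linarith)
  have "1 - \<epsilon> < (1 - \<kappa> / 4) * (a - \<kappa> / 4)"
  proof -
    have "(1 - \<kappa> / 4) * (a - \<kappa> / 4) = a - \<kappa> / 4 - \<kappa> / 4 * a + \<kappa> / 4 * (\<kappa> / 4)" by (simp add: algebra_simps)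
    moreover have "\<kappa> / 4 * a \<le> \<kappa> / 4 * 1" using a1 \<kappa> by (intro mult_left_mono) auto
    moreover have "0 < \<kappa> / 4 * (\<kappa> / 4)" using \<kappa> by simp
    ultimately show ?thesis using a \<kappa> by linarith
  qed
  then obtain L where L: "1 - \<epsilon> \<le> real L / (real L + 1) * ((1 - \<kappa> / 4) * (a - \<kappa> / 4))"
    using ladder_length by blast
  interpret work_protocol n M L K c
    by unfold_locales (use Kx Mx cK in auto)
  define \<alpha> where "\<alpha> = (\<Sum>i<n. rate g i)"
  have rate1: "exp \<theta> * rate g i \<le> r i" if "i < n" for i
  proof (cases "i \<in> A")
    case True
    have "rate g i = g i / real K * real (c i)" by (simp add: rate_def)
    also have "\<dots> \<le> g i / real K * (real K * r i / (exp \<theta> * g i))"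
      using g0[OF that] c1[OF True] by (intro mult_left_mono) auto
    also have "\<dots> = r i / exp \<theta>" using g0[OF that] Kx by simp
    finally show ?thesis by (simp add: field_simps)
  next
    case False
    then show ?thesis using Rd(4)[OF that] unfolding rate_def by (simp add: c_def)
  qed
  have rate2: "r i - exp \<theta> * g i / real K \<le> exp \<theta> * rate g i" if "i \<in> A" for i
  proof -
    have gi: "0 < g i" using that A g0 by auto
    have "r i - exp \<theta> * g i / real K = exp \<theta> * (g i / real K) * (real K * r i / (exp \<theta> * g i) - 1)"
      using gi Kx by (simp add: field_simps)
    also have "\<dots> \<le> exp \<theta> * (g i / real K) * real (c i)"
      using gi c2[OF that] by (intro mult_left_mono) auto
    finally show ?thesis by (simp add: rate_def)
  qed
  have rate0: "0 \<le> rate g i" if "i < n" for i by (rule rate_nonneg) (use g0[OF that] in simp)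
  have \<alpha>1: "exp \<theta> * \<alpha> \<le> 1"
    unfolding \<alpha>_def sum_distrib_left Rd(5)[symmetric] by (rule sum_mono) (use rate1 in auto)
  have "a - exp \<theta> / real K * (\<Sum>i\<in>A. g i) = (\<Sum>i\<in>A. r i - exp \<theta> * g i / real K)"
    by (simp add: a_def sum_subtractf sum_distrib_left)
  also have "\<dots> \<le> (\<Sum>i\<in>A. exp \<theta> * rate g i)" by (rule sum_mono) (rule rate2)
  also have "\<dots> \<le> exp \<theta> * \<alpha>"
    unfolding \<alpha>_def sum_distrib_left by (rule sum_mono2) (use A rate0 in auto)
  finally have "a - exp \<theta> / real K * (\<Sum>i\<in>A. g i) \<le> exp \<theta> * \<alpha>" .
  moreover have "exp \<theta> / real K * (\<Sum>i\<in>A. g i) \<le> \<kappa> / 4 * 1"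
  proof (rule mult_mono)
    show "exp \<theta> / real K \<le> \<kappa> / 4" using Kx \<kappa> by (simp add: field_simps)
    show "(\<Sum>i\<in>A. g i) \<le> 1" unfolding g1[symmetric] by (rule sum_mono2) (use A g0' in auto)
  qed (use \<kappa> A g0' in \<open>auto intro!: sum_nonneg\<close>)
  ultimately have \<alpha>2: "a - \<kappa> / 4 \<le> exp \<theta> * \<alpha>" by simp
  have \<alpha>0: "0 < exp \<theta> * \<alpha>" using \<alpha>2 a \<kappa> by linarith
  then have \<alpha>pos: "0 < \<alpha>" by (simp add: zero_less_mult_iff)
  have \<alpha>le: "\<alpha> \<le> 1"
    unfolding \<alpha>_def g1[symmetric] by (rule sum_mono) (use g0' rate_le in auto)
  have "ln (4 / \<kappa>) = 3 / 4 * \<kappa> * C" using \<kappa> by (simp add: C_def)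
  also have "\<dots> \<le> (exp \<theta> * \<alpha>) * C" using \<alpha>2 a by (intro mult_right_mono C) linarith
  also have "\<dots> = \<alpha> * (C * exp \<theta>)" by simp
  also have "\<dots> \<le> \<alpha> * real M" using Mx(2) \<alpha>pos by (intro mult_left_mono) auto
  finally have lnM: "ln (4 / \<kappa>) \<le> \<alpha> * real M" .
  have "(1 - \<alpha>) ^ M \<le> exp (- \<alpha>) ^ M"
    using \<alpha>le exp_ge_add_one_self[of "- \<alpha>"] by (intro power_mono) auto
  also have "\<dots> = exp (- (\<alpha> * real M))" by (simp add: mult.commute flip: exp_of_nat_mult)
  also have "\<dots> \<le> exp (- ln (4 / \<kappa>))" using lnM by simp
  also have "\<dots> = \<kappa> / 4" using \<kappa> by (simp add: exp_minus)
  finally have pM: "1 - \<kappa> / 4 \<le> 1 - (1 - \<alpha>) ^ M" by simp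
  have geo: "(\<Sum>j<M. (1 - \<alpha>) ^ j) * \<alpha> = 1 - (1 - \<alpha>) ^ M"
    using geometric_sum[of "1 - \<alpha>" M] \<alpha>pos by (simp add: field_simps)
  \<comment> \<open>By the geometric sum the protocol produces level \<open>i\<close> with weight at
    least \<open>rate g i / \<alpha>\<close> times the two success factors. Replacing
    \<open>1 / \<alpha>\<close> by \<open>exp \<theta>\<close>, which is not larger, also brings the
    value below \<open>r i\<close>.\<close>
  define l where "l = (\<lambda>i. real L / (real L + 1) * ((1 - (1 - \<alpha>) ^ M) * (exp \<theta> * rate g i)))"
  have q1: "0 \<le> 1 - (1 - \<alpha>) ^ M" "1 - (1 - \<alpha>) ^ M \<le> 1"
    using \<alpha>pos \<alpha>le by (auto simp: power_le_one)
  define W where "W = ln (real M) / \<beta>"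
  have "equilibrating_approx \<beta> \<mu> \<epsilon> (battery E W 1) (compose R (battery E W 0))" for E
  proof (rule cost_protocol[OF \<beta> R g W_def, where l = l])
    fix i assume i: "i < n"
    have "l i \<le> 1 * (1 * r i)"
      unfolding l_def by (intro mult_mono) (use q1 rate1[OF i] rate0[OF i] Rd(4)[OF i] in auto)
    then show "l i \<le> r i" by simp
    have "(1 - (1 - \<alpha>) ^ M) * (exp \<theta> * rate g i) = (exp \<theta> * \<alpha>) * (rate g i * (\<Sum>j<M. (1 - \<alpha>) ^ j))"
      unfolding geo[symmetric] by simp
    also have "\<dots> \<le> 1 * (rate g i * (\<Sum>j<M. (1 - \<alpha>) ^ j))"
      by (rule mult_right_mono[OF \<alpha>1]) (use rate0[OF i] \<alpha>le in \<open>auto intro!: mult_nonneg_nonneg sum_nonneg\<close>)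
    finally have "l i \<le> real L / (real L + 1) * (rate g i * (\<Sum>j<M. (1 - \<alpha>) ^ j))"
      unfolding l_def by (intro mult_left_mono) auto
    also have "\<dots> \<le> (\<Sum>i'<n. g i' * (\<Sum>k\<in>bath.
        if fst (move (i', 1, k)) = i \<and> fst (snd (move (i', 1, k))) = 0 then bath_weight g k else 0))"
      unfolding \<alpha>_def by (rule cost_success[OF g1 _ i]) (use g0' in auto)
    finally show "l i \<le> (\<Sum>i'<n. g i' * (\<Sum>k\<in>bath.
        if fst (move (i', 1, k)) = i \<and> fst (snd (move (i', 1, k))) = 0 then bath_weight g k else 0))" .
  next
    have "1 - \<epsilon> \<le> real L / (real L + 1) * ((1 - \<kappa> / 4) * (a - \<kappa> / 4))" by (rule L)
    also have "\<dots> \<le> real L / (real L + 1) * ((1 - (1 - \<alpha>) ^ M) * (exp \<theta> * \<alpha>))"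
      by (intro mult_left_mono mult_mono pM \<alpha>2) (use q1 a \<kappa> in auto)
    also have "\<dots> = (\<Sum>i<n. l i)"
      unfolding l_def \<alpha>_def[symmetric] by (simp add: \<alpha>_def sum_distrib_left)
    finally show "1 - \<epsilon> \<le> (\<Sum>i<n. l i)" .
  qed
  moreover have "\<beta> * W \<le> \<theta> + ln (C + 2 / \<kappa>)"
  proof -
    \<comment> \<open>Since \<kappa> < a \<le> \<open>exp \<theta>\<close>, the additive 2 from
      rounding \<open>M\<close> up is bounded by a multiple of \<open>exp \<theta>\<close> and only
      changes the constant.\<close>
    have "2 \<le> 2 / \<kappa> * exp \<theta>" using a a\<theta> \<kappa> by (simp add: field_simps)
    then have "real M \<le> (C + 2 / \<kappa>) * exp \<theta>" using Mx(3) by (simp add: ring_distribs)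
    then have "ln (real M) \<le> ln ((C + 2 / \<kappa>) * exp \<theta>)" using Mx(1) by (intro ln_mono) auto
    also have "\<dots> = \<theta> + ln (C + 2 / \<kappa>)" using add_nonneg_pos[OF C, of "2 / \<kappa>"] \<kappa> by (simp add: ln_mult)
    finally show ?thesis using \<beta> by (simp add: W_def)
  qed
  ultimately show thesis using that[of W] battery_pair_battery unfolding C_def by blast
qed

section \<open>The central limit theorem for product weights\<close>

text \<open>An index of the \<open>n\<close>-fold tensor power is read in base \<open>d\<close>. The
  last digit belongs to the copy added last, as in the recursion of \<open>copies\<close>.\<close>

fun digit_prod :: "nat \<Rightarrow> (nat \<Rightarrow> real) \<Rightarrow> nat \<Rightarrow> nat \<Rightarrow> real" where
  "digit_prod d r 0 i = 1"
| "digit_prod d r (Suc n) i = digit_prod d r n (i div d) * r (i mod d)"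

fun digit_sum :: "nat \<Rightarrow> (nat \<Rightarrow> real) \<Rightarrow> nat \<Rightarrow> nat \<Rightarrow> real" where
  "digit_sum d f 0 i = 0"
| "digit_sum d f (Suc n) i = digit_sum d f n (i div d) + f (i mod d)"

lemma sum_digits:
  fixes F :: "nat \<Rightarrow> nat \<Rightarrow> 'a::comm_semiring_1"
  shows "(\<Sum>i<d ^ Suc n. F (i div d) (i mod d)) = (\<Sum>a<d ^ n. \<Sum>b<d. F a b)"
  unfolding power_Suc2 sum_mult_split by (intro sum.cong refl) auto

lemma digit_less: "i < d ^ Suc n \<Longrightarrow> i div d < d ^ n" "i < d ^ Suc n \<Longrightarrow> i mod d < (d :: nat)"
  by (auto simp: less_mult_imp_div_less mult.commute intro!: mod_less_divisor gr0I)

lemma digit_prod_nonneg: "(\<And>a. a < d \<Longrightarrow> 0 \<le> r a) \<Longrightarrow> i < d ^ n \<Longrightarrow> 0 \<le> digit_prod d r n i"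
proof (induction n arbitrary: i)
  case (Suc n)
  then show ?case using digit_less[OF Suc.prems(2)] by simp
qed simp

lemma digit_prod_sum:
  assumes "(\<Sum>a<d. r a) = 1"
  shows "(\<Sum>i<d ^ n. digit_prod d r n i) = 1"
proof (induction n)
  case (Suc n)
  have "(\<Sum>i<d ^ Suc n. digit_prod d r (Suc n) i) = (\<Sum>a<d ^ n. \<Sum>b<d. digit_prod d r n a * r b)"
    using sum_digits[of "\<lambda>a b. digit_prod d r n a * r b"] by simp
  then show ?case using Suc assms by (simp flip: sum_product)
qed simp

section \<open>Finite weights as probability mass functions\<close>

lemma finite_pmf:
  fixes w :: "nat \<Rightarrow> real"
  assumes "\<And>i. i < N \<Longrightarrow> 0 \<le> w i" "(\<Sum>i<N. w i) = 1"
  obtains q where "\<And>i. pmf q i = (if i < N then w i else 0)"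
proof
  define f where "f = (\<lambda>i. if i < N then w i else 0)"
  have "(\<integral>\<^sup>+x. ennreal (f x) \<partial>count_space UNIV) = (\<Sum>x<N. ennreal (f x))"
    by (rule nn_integral_count_space') (auto simp: f_def)
  also have "\<dots> = ennreal (\<Sum>x<N. f x)" by (rule sum_ennreal) (use assms in \<open>auto simp: f_def\<close>)
  also have "(\<Sum>x<N. f x) = 1" using assms(2) by (simp add: f_def)
  finally have "(\<integral>\<^sup>+x. ennreal (f x) \<partial>count_space UNIV) = 1" by simp
  then show "pmf (embed_pmf f) i = (if i < N then w i else 0)" for i
    by (subst pmf_embed_pmf) (use assms in \<open>auto simp: f_def\<close>)
qed

lemma integral_finite_pmf:
  fixes F :: "nat \<Rightarrow> 'b::{banach, second_countable_topology}"
  assumes "\<And>i. pmf q i = (if i < N then w i else 0)"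
  shows "(LINT x|measure_pmf q. F x) = (\<Sum>i<N. w i *\<^sub>R F i)"
proof -
  have "(LINT x|measure_pmf q. F x) = (\<Sum>i<N. pmf q i *\<^sub>R F i)"
    by (rule integral_measure_pmf) (use assms in \<open>auto simp: set_pmf_iff split: if_splits\<close>)
  then show ?thesis using assms by simp
qed

lemma char_finite_pmf:
  fixes q :: "nat pmf"
  assumes "\<And>i. pmf q i = (if i < N then w i else 0)"
  shows "char (distr (measure_pmf q) borel f) t = (\<Sum>i<N. w i *\<^sub>R iexp (t * f i))"
proof -
  have "char (distr (measure_pmf q) borel f) t = (LINT x|measure_pmf q. iexp (t * f x))"
    unfolding char_def by (subst integral_distr) auto
  then show ?thesis by (simp add: integral_finite_pmf[OF assms])
qed

lemma measure_finite_pmf: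
  fixes q :: "nat pmf"
  assumes "\<And>i. pmf q i = (if i < N then w i else 0)"
  shows "measure (measure_pmf q) A = (\<Sum>i | i < N \<and> i \<in> A. w i)"
proof -
  have "set_pmf q \<subseteq> {..<N}" using assms by (auto simp: set_pmf_iff split: if_splits)
  then have "A \<inter> set_pmf q = ({..<N} \<inter> A) \<inter> set_pmf q" by auto
  then have "measure (measure_pmf q) A = measure (measure_pmf q) ({..<N} \<inter> A)"
    by (metis measure_Int_set_pmf)
  also have "\<dots> = (\<Sum>i\<in>{..<N} \<inter> A. w i)"
    by (subst measure_measure_pmf_finite) (auto simp: assms)
  also have "{..<N} \<inter> A = {i. i < N \<and> i \<in> A}" by auto
  finally show ?thesis .
qed

lemma char_digits:
  fixes t :: real
  shows "(\<Sum>i<d ^ n. digit_prod d r n i *\<^sub>R iexp (t * digit_sum d f n i)) = (\<Sum>a<d. r a *\<^sub>R iexp (t * f a)) ^ n"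
proof (induction n)
  case (Suc n)
  have "(\<Sum>i<d ^ Suc n. digit_prod d r (Suc n) i *\<^sub>R iexp (t * digit_sum d f (Suc n) i))
    = (\<Sum>a<d ^ n. \<Sum>b<d. (digit_prod d r n a * r b) *\<^sub>R iexp (t * (digit_sum d f n a + f b)))"
    using sum_digits[of "\<lambda>a b. (digit_prod d r n a * r b) *\<^sub>R iexp (t * (digit_sum d f n a + f b))"] by simp
  also have "\<dots> = (\<Sum>a<d ^ n. \<Sum>b<d. (digit_prod d r n a *\<^sub>R iexp (t * digit_sum d f n a)) * (r b *\<^sub>R iexp (t * f b)))"
    by (intro sum.cong refl) (simp add: ring_distribs exp_add scaleR_conv_of_real)
  also have "\<dots> = (\<Sum>a<d. r a *\<^sub>R iexp (t * f a)) ^ n * (\<Sum>a<d. r a *\<^sub>R iexp (t * f a))"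
    unfolding Suc[symmetric] by (rule sum_product[symmetric])
  finally show ?case by (simp add: mult.commute)
qed simp

text \<open>Weak convergence gives convergence of distribution functions at continuity points, and
  by this lemma every point is one.\<close>

lemma isCont_cdf_std_normal: "isCont (cdf std_normal_distribution) x"
proof -
  interpret real_distribution std_normal_distribution by (rule real_dist_normal_dist)
  have "emeasure std_normal_distribution {x} = (\<integral>\<^sup>+y. ennreal (std_normal_density y) * indicator {x} y \<partial>lborel)"
    by (rule emeasure_density) auto
  also have "\<dots> = (\<integral>\<^sup>+(y::real). 0 \<partial>lborel)"
  proof (rule nn_integral_cong_AE)
    show "AE y in lborel. ennreal (std_normal_density y) * indicator {x} y = 0"
      using AE_lborel_singleton[of x] by eventually_elim (auto split: split_indicator)
  qed
  finally have "emeasure std_normal_distribution {x} = 0" by simp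
  then show ?thesis by (simp add: isCont_cdf measure_def)
qed

text \<open>The density is positive everywhere, so an interval of positive length cannot be a null
  set.\<close>

lemma cdf_std_normal_strict_mono:
  assumes "x < y"
  shows "cdf std_normal_distribution x < cdf std_normal_distribution y"
proof -
  interpret real_distribution std_normal_distribution by (rule real_dist_normal_dist)
  have "measure std_normal_distribution {x<..y} \<noteq> 0"
  proof
    assume "measure std_normal_distribution {x<..y} = 0"
    then have "emeasure std_normal_distribution {x<..y} = 0" by (simp add: emeasure_eq_measure)
    then have "{x<..y} \<in> null_sets (density lborel (\<lambda>x. ennreal (std_normal_density x)))"
      by (simp add: null_sets_def)
    then have "AE z in lborel. z \<in> {x<..y} \<longrightarrow> ennreal (std_normal_density z) = 0"
      by (subst (asm) null_sets_density_iff) auto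
    then have "AE z in lborel. z \<notin> {x<..y}"
    proof eventually_elim
      fix z assume "z \<in> {x<..y} \<longrightarrow> ennreal (std_normal_density z) = 0"
      moreover have "0 < std_normal_density z" by (rule normal_density_pos) simp
      ultimately show "z \<notin> {x<..y}" by (auto simp: ennreal_eq_0_iff)
    qed
    then have "{x<..y} \<in> null_sets lborel" by (subst AE_iff_null_sets) auto
    then show False using assms by (simp add: null_sets_def)
  qed
  then show ?thesis using cdf_diff_eq[OF assms] measure_nonneg[of std_normal_distribution "{x<..y}"] by linarith
qed

text \<open>The limits at both ends make the set in \<open>Phi_inv\<close> nonempty and bounded
  above. Strictness is the point: it yields the positive margins in
  \<open>digit_sum_quantile\<close>.\<close>

lemma Phi_inv_bounds:
  assumes p: "0 < p" "p < 1"
  shows "z < Phi_inv p \<Longrightarrow> cdf std_normal_distribution z < p"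
    "Phi_inv p < z \<Longrightarrow> p < cdf std_normal_distribution z"
proof -
  interpret real_distribution std_normal_distribution by (rule real_dist_normal_dist)
  let ?F = "cdf std_normal_distribution"
  have "\<forall>\<^sub>F x in at_bot. ?F x < p" by (rule order_tendstoD(2)[OF cdf_lim_at_bot p(1)])
  then obtain x0 where x0: "?F x0 < p" using eventually_happens[of _ "at_bot :: real filter"] by auto
  have "\<forall>\<^sub>F x in at_top. p < ?F x" by (rule order_tendstoD(1)[OF cdf_lim_at_top_prob p(2)])
  then obtain x1 where x1: "p < ?F x1" using eventually_happens[of _ "at_top :: real filter"] by auto
  have bdd: "bdd_above {z. ?F z \<le> p}"
  proof (rule bdd_aboveI[of _ x1])
    fix z assume "z \<in> {z. ?F z \<le> p}"
    then have "\<not> x1 \<le> z" using x1 cdf_nondecreasing[of x1 z] by force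
    then show "z \<le> x1" by simp
  qed
  show "?F z < p" if "z < Phi_inv p"
  proof -
    have "{z. ?F z \<le> p} \<noteq> {}" using x0 by (auto intro!: exI[of _ x0])
    from less_cSupD[OF this that[unfolded Phi_inv_def]] obtain y where "z < y" "?F y \<le> p" by blast
    then show ?thesis using cdf_std_normal_strict_mono[of z y] by linarith
  qed
  show "p < ?F z" if "Phi_inv p < z"
  proof (rule ccontr)
    assume "\<not> p < ?F z"
    then have "z \<le> Phi_inv p" unfolding Phi_inv_def by (intro cSup_upper bdd) auto
    then show False using that by simp
  qed
qed

text \<open>The central limit theorem concerns one sequence of independent variables, whereas the
  digit weights live on a different finite set for each \<open>n\<close>. The coordinates of an
  infinite product space supply the sequence, and equality of characteristic functions identifies
  the law of its partial sums with that of \<open>digit_sum\<close>.\<close>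

lemma digit_sum_tendsto_normal:
  assumes r: "\<And>a. a < d \<Longrightarrow> 0 \<le> r a" "(\<Sum>a<d. r a) = 1"
    and m: "(\<Sum>a<d. r a * f a) = 0" and s: "0 < s" "s\<^sup>2 = (\<Sum>a<d. r a * (f a)\<^sup>2)"
  shows "(\<lambda>n. \<Sum>i | i < d ^ n \<and> digit_sum d f n i \<le> c * sqrt (real n). digit_prod d r n i)
    \<longlonglongrightarrow> cdf std_normal_distribution (c / s)"
proof -
  obtain q where q: "\<And>i. pmf q i = (if i < d then r i else 0)" using finite_pmf[OF r] by blast
  define \<nu> where "\<nu> = distr (measure_pmf q) borel f"
  define M where "M = PiM (UNIV :: nat set) (\<lambda>_. \<nu>)"
  have \<nu>: "prob_space \<nu>" "sets \<nu> = sets borel"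
    unfolding \<nu>_def by (auto intro!: measure_pmf.prob_space_distr)
  interpret P: product_prob_space "\<lambda>_. \<nu>" "UNIV :: nat set"
    by (simp add: product_prob_space_def product_sigma_finite_def product_prob_space_axioms_def
        \<nu> prob_space_imp_sigma_finite)
  interpret M: prob_space M unfolding M_def by (rule P.prob_space_axioms)
  define X where "X = (\<lambda>(n::nat) (\<omega> :: nat \<Rightarrow> real). \<omega> n)"
  have Xm: "X n \<in> borel_measurable M" for n
  proof -
    have "X n \<in> measurable M \<nu>"
      unfolding X_def M_def by (rule measurable_component_singleton) simp
    then show ?thesis using measurable_cong_sets[OF refl \<nu>(2), of M] by simp
  qed
  have Xd: "distr M borel (X n) = \<nu>" for n
  proof -
    have "distr M borel (X n) = distr M \<nu> (\<lambda>\<omega>. \<omega> n)"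
      by (rule distr_cong) (auto simp: \<nu> X_def)
    then show ?thesis unfolding M_def by (simp add: P.PiM_component)
  qed
  have indep: "M.indep_vars (\<lambda>_. borel) X UNIV"
  proof (subst M.indep_vars_iff_distr_eq_PiM)
    have "distr M (PiM UNIV (\<lambda>_. borel)) (\<lambda>\<omega>. \<lambda>i\<in>UNIV. X i \<omega>) = distr M (PiM UNIV (\<lambda>_. borel)) (\<lambda>\<omega>. \<omega>)"
      by (simp add: X_def restrict_UNIV)
    also have "\<dots> = M"
      by (rule distr_id2) (auto simp: M_def intro!: sets_PiM_cong \<nu>(2)[symmetric])
    finally show "distr M (PiM UNIV (\<lambda>_. borel)) (\<lambda>\<omega>. \<lambda>i\<in>UNIV. X i \<omega>) = PiM UNIV (\<lambda>i. distr M borel (X i))"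
      unfolding Xd by (simp add: M_def)
  qed (use Xm in auto)
  have E: "M.expectation (\<lambda>\<omega>. h (X n \<omega>)) = (\<Sum>a<d. r a * h (f a))" if h: "h \<in> borel_measurable borel" for n and h :: "real \<Rightarrow> real"
  proof -
    have "M.expectation (\<lambda>\<omega>. h (X n \<omega>)) = (LINT x|\<nu>. h x)"
      unfolding Xd[of n, symmetric] by (rule integral_distr[symmetric]) (use Xm h in auto)
    also have "\<dots> = (LINT x|measure_pmf q. h (f x))"
      unfolding \<nu>_def by (rule integral_distr) (use h in auto)
    finally show ?thesis by (simp add: integral_finite_pmf[OF q])
  qed
  have sq: "integrable M (\<lambda>\<omega>. (X n \<omega>)\<^sup>2)" for n
  proof -
    have "integrable (measure_pmf q) (\<lambda>x. (f x)\<^sup>2)"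
      by (rule integrable_measure_pmf_finite, rule finite_subset[of _ "{..<d}"])
        (use q in \<open>auto simp: set_pmf_iff split: if_splits\<close>)
    then have "integrable \<nu> (\<lambda>x. x\<^sup>2)" unfolding \<nu>_def by (subst integrable_distr_eq) auto
    then show ?thesis unfolding Xd[of n, symmetric] by (subst (asm) integrable_distr_eq) (use Xm in auto)
  qed
  have mean: "M.expectation (X n) = 0" for n using E[of "\<lambda>x. x" n] m by simp
  have "weak_conv_m (\<lambda>n. distr M borel (\<lambda>\<omega>. (\<Sum>i<n. X i \<omega>) / sqrt (real n * s\<^sup>2))) std_normal_distribution"
  proof (rule M.central_limit_theorem_zero_mean[OF indep mean s(1) sq _ Xd])
    show "M.variance (X n) = s\<^sup>2" for n
      using E[of "\<lambda>x. x\<^sup>2" n] mean[of n] s(2) by simp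
  qed
  then have conv: "(\<lambda>n. cdf (distr M borel (\<lambda>\<omega>. (\<Sum>i<n. X i \<omega>) / sqrt (real n * s\<^sup>2))) (c / s))
      \<longlonglongrightarrow> cdf std_normal_distribution (c / s)"
    by (simp add: weak_conv_m_def weak_conv_def isCont_cdf_std_normal)
  have "cdf (distr M borel (\<lambda>\<omega>. (\<Sum>i<n. X i \<omega>) / sqrt (real n * s\<^sup>2))) (c / s)
      = (\<Sum>i | i < d ^ n \<and> digit_sum d f n i \<le> c * sqrt (real n). digit_prod d r n i)" if n: "0 < n" for n
  proof -
    obtain qn where qn: "\<And>i. pmf qn i = (if i < d ^ n then digit_prod d r n i else 0)"
    proof (rule finite_pmf)
      show "0 \<le> digit_prod d r n i" if "i < d ^ n" for i using digit_prod_nonneg[OF r(1) that] .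
    qed (use digit_prod_sum[OF r(2)] in auto)
    have Sm: "(\<lambda>\<omega>. \<Sum>i<n. X i \<omega>) \<in> borel_measurable M" using Xm by simp
    have "distr M borel (\<lambda>\<omega>. \<Sum>i<n. X i \<omega>) = distr (measure_pmf qn) borel (digit_sum d f n)"
    proof (rule Levy_uniqueness)
      show "real_distribution (distr M borel (\<lambda>\<omega>. \<Sum>i<n. X i \<omega>))"
        by (rule M.real_distribution_distr[OF Sm])
      show "real_distribution (distr (measure_pmf qn) borel (digit_sum d f n))"
        by (rule prob_space.real_distribution_distr[OF prob_space_measure_pmf]) simp
      show "char (distr M borel (\<lambda>\<omega>. \<Sum>i<n. X i \<omega>)) = char (distr (measure_pmf qn) borel (digit_sum d f n))"
      proof
        fix t
        have "char (distr M borel (\<lambda>\<omega>. \<Sum>i<n. X i \<omega>)) t = (\<Prod>i<n. char (distr M borel (X i)) t)"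
          by (rule M.char_distr_sum[OF M.indep_vars_subset[OF indep]]) simp
        also have "\<dots> = (\<Sum>a<d. r a *\<^sub>R iexp (t * f a)) ^ n"
          unfolding Xd \<nu>_def by (simp add: char_finite_pmf[OF q])
        also have "\<dots> = char (distr (measure_pmf qn) borel (digit_sum d f n)) t"
          unfolding char_finite_pmf[OF qn] char_digits ..
        finally show "char (distr M borel (\<lambda>\<omega>. \<Sum>i<n. X i \<omega>)) t
          = char (distr (measure_pmf qn) borel (digit_sum d f n)) t" .
      qed
    qed
    then have eq: "measure (distr M borel (\<lambda>\<omega>. \<Sum>i<n. X i \<omega>)) {..y}
      = measure (distr (measure_pmf qn) borel (digit_sum d f n)) {..y}" for y by simp
    have "cdf (distr M borel (\<lambda>\<omega>. (\<Sum>i<n. X i \<omega>) / sqrt (real n * s\<^sup>2))) (c / s)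
        = measure M ((\<lambda>\<omega>. (\<Sum>i<n. X i \<omega>) / sqrt (real n * s\<^sup>2)) -` {..c / s} \<inter> space M)"
      unfolding cdf_def2 by (rule measure_distr) (use Sm in auto)
    also have "(\<lambda>\<omega>. (\<Sum>i<n. X i \<omega>) / sqrt (real n * s\<^sup>2)) -` {..c / s} = (\<lambda>\<omega>. \<Sum>i<n. X i \<omega>) -` {..c * sqrt (real n)}"
      using s(1) n by (auto simp: real_sqrt_mult field_simps)
    also have "measure M ((\<lambda>\<omega>. \<Sum>i<n. X i \<omega>) -` {..c * sqrt (real n)} \<inter> space M)
        = measure (distr M borel (\<lambda>\<omega>. \<Sum>i<n. X i \<omega>)) {..c * sqrt (real n)}"
      by (rule measure_distr[symmetric]) (use Sm in auto)
    also have "\<dots> = measure (measure_pmf qn) (digit_sum d f n -` {..c * sqrt (real n)})"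
      unfolding eq by (subst measure_distr) auto
    also have "\<dots> = (\<Sum>i | i < d ^ n \<and> digit_sum d f n i \<le> c * sqrt (real n). digit_prod d r n i)"
      by (simp add: measure_finite_pmf[OF qn])
    finally show ?thesis .
  qed
  then have "\<forall>\<^sub>F n in sequentially. cdf (distr M borel (\<lambda>\<omega>. (\<Sum>i<n. X i \<omega>) / sqrt (real n * s\<^sup>2))) (c / s)
      = (\<Sum>i | i < d ^ n \<and> digit_sum d f n i \<le> c * sqrt (real n). digit_prod d r n i)"
    by (intro eventually_mono[OF eventually_gt_at_top[of 0]])
  then show ?thesis using conv by (rule Lim_transform_eventually[rotated])
qed

lemma digit_sum_degenerate:
  assumes "\<And>a. a < d \<Longrightarrow> r a \<noteq> 0 \<Longrightarrow> f a = 0" "i < d ^ n" "digit_prod d r n i \<noteq> 0"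
  shows "digit_sum d f n i = 0"
  using assms(2,3)
proof (induction n arbitrary: i)
  case (Suc n)
  then show ?case using digit_less[OF Suc.prems(1)] assms(1) by simp
qed simp

text \<open>For positive \<open>s\<close> the margin is half the gap between the limit and
  \<open>p\<close>. For \<open>s = 0\<close> there is no normal limit, but every index of nonzero
  weight then has digit sum 0, so the distribution function jumps from 0 to 1 at 0, which is again
  \<open>s * Phi_inv p\<close>.\<close>

lemma digit_sum_quantile:
  assumes r: "\<And>a. a < d \<Longrightarrow> 0 \<le> r a" "(\<Sum>a<d. r a) = 1"
    and m: "(\<Sum>a<d. r a * f a) = 0" and s: "0 \<le> s" "s\<^sup>2 = (\<Sum>a<d. r a * (f a)\<^sup>2)" and p: "0 < p" "p < 1"
  shows "s * Phi_inv p < c \<Longrightarrow> \<exists>\<kappa>>0. \<forall>\<^sub>F n in sequentially.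
      p + \<kappa> \<le> (\<Sum>i | i < d ^ n \<and> digit_sum d f n i \<le> c * sqrt (real n). digit_prod d r n i)" (is "_ \<Longrightarrow> ?above")
    and "c < s * Phi_inv p \<Longrightarrow> \<exists>\<kappa>>0. \<forall>\<^sub>F n in sequentially.
      (\<Sum>i | i < d ^ n \<and> digit_sum d f n i \<le> c * sqrt (real n). digit_prod d r n i) \<le> p - \<kappa>" (is "_ \<Longrightarrow> ?below")
proof -
  let ?F = "\<lambda>n. \<Sum>i | i < d ^ n \<and> digit_sum d f n i \<le> c * sqrt (real n). digit_prod d r n i"
  have "(s * Phi_inv p < c \<longrightarrow> ?above) \<and> (c < s * Phi_inv p \<longrightarrow> ?below)"
  proof (cases "s = 0")
    case True
    then have "(\<Sum>a<d. r a * (f a)\<^sup>2) = 0" using s by simp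
    then have f0: "f a = 0" if "a < d" "r a \<noteq> 0" for a
      using that r(1) by (subst (asm) sum_nonneg_eq_0_iff) auto
    have pos: "?F n = 1" if "0 < c" for n
    proof -
      have "?F n = (\<Sum>i<d ^ n. digit_prod d r n i)"
        by (rule sum.mono_neutral_left)
          (use that digit_sum_degenerate[of d r f, OF f0] in \<open>auto intro: ccontr\<close>)
      then show ?thesis by (simp add: digit_prod_sum[OF r(2)])
    qed
    have neg: "?F n = 0" if "c < 0" "0 < n" for n
    proof (rule sum.neutral, rule ballI, rule ccontr)
      fix i assume i: "i \<in> {i. i < d ^ n \<and> digit_sum d f n i \<le> c * sqrt (real n)}" "digit_prod d r n i \<noteq> 0"
      have "digit_sum d f n i = 0" by (rule digit_sum_degenerate[of d r f, OF f0]) (use i in auto)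
      then show False using i that by (simp add: zero_le_mult_iff)
    qed
    have "?above" if "0 < c"
      by (rule exI[of _ "1 - p"]) (use p pos[OF that] in auto)
    moreover have "?below" if "c < 0"
      by (rule exI[of _ p]) (use p neg[OF that] in \<open>auto intro: eventually_mono[OF eventually_gt_at_top[of 0]]\<close>)
    ultimately show ?thesis using True by simp
  next
    case False
    then have s0: "0 < s" using s by simp
    note lim = digit_sum_tendsto_normal[OF r m s0 s(2), of c]
    define y where "y = cdf std_normal_distribution (c / s)"
    have mid: "p + (y - p) / 2 < y" if "p < y"
      using that by (simp add: field_simps)
    have mid': "y < p - (p - y) / 2" if "y < p"
      using that by (simp add: field_simps)
    have "?above" if "s * Phi_inv p < c"
    proof -
      have "Phi_inv p < c / s" using that s0 by (simp add: field_simps)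
      then have "p < y" using Phi_inv_bounds(2)[OF p] by (simp add: y_def)
      then have "\<forall>\<^sub>F n in sequentially. p + (y - p) / 2 < ?F n"
        by (intro order_tendstoD(1)[OF lim[folded y_def]]) (use mid in auto)
      then show ?thesis using \<open>p < y\<close>
        by (intro exI[of _ "(y - p) / 2"]) (auto elim: eventually_mono)
    qed
    moreover have "?below" if "c < s * Phi_inv p"
    proof -
      have "c / s < Phi_inv p" using that s0 by (simp add: field_simps)
      then have "y < p" using Phi_inv_bounds(1)[OF p] by (simp add: y_def)
      then have "\<forall>\<^sub>F n in sequentially. ?F n < p - (p - y) / 2"
        by (intro order_tendstoD(2)[OF lim[folded y_def]]) (use mid' in auto)
      then show ?thesis using \<open>y < p\<close>
        by (intro exI[of _ "(p - y) / 2"]) (auto elim: eventually_mono)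
    qed
    ultimately show ?thesis by blast
  qed
  then show "s * Phi_inv p < c \<Longrightarrow> ?above" "c < s * Phi_inv p \<Longrightarrow> ?below" by blast+
qed

section \<open>Copies\<close>

lemma state_spectrum_cong:
  assumes "state_spectrum n P R r h \<nu>"
    and "\<And>i. i < n \<Longrightarrow> r i = r' i" "\<And>i. i < n \<Longrightarrow> h i = h' i" "\<And>i. i < n \<Longrightarrow> \<nu> i = \<nu>' i"
  shows "state_spectrum n P R r' h' \<nu>'"
  using assms unfolding state_spectrum_def by (auto intro: has_eigenvalues_cong)

lemma copies_spectrum:
  assumes R: "state_spectrum d P R r h \<nu>"
  shows "\<exists>Q. state_spectrum (d ^ Suc n) Q (copies (Suc n) R)
    (digit_prod d r (Suc n)) (digit_sum d h (Suc n)) (digit_sum d \<nu> (Suc n))"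
proof (induction n)
  case 0
  have "state_spectrum d P R (digit_prod d r (Suc 0)) (digit_sum d h (Suc 0)) (digit_sum d \<nu> (Suc 0))"
    by (rule state_spectrum_cong[OF R]) auto
  then show ?case unfolding power_Suc0_right copies.simps(2) by blast
next
  case (Suc n)
  then obtain Q where "state_spectrum (d ^ Suc n) Q (copies (Suc n) R)
    (digit_prod d r (Suc n)) (digit_sum d h (Suc n)) (digit_sum d \<nu> (Suc n))" by blast
  note compose = state_spectrum_compose[OF this R]
  have "state_spectrum (d ^ Suc (Suc n)) (kron Q P) (copies (Suc (Suc n)) R)
    (digit_prod d r (Suc (Suc n))) (digit_sum d h (Suc (Suc n))) (digit_sum d \<nu> (Suc (Suc n)))"
    unfolding copies.simps(3) power_Suc2[of d "Suc n"]
    by (rule state_spectrum_cong[OF compose]) (rule digit_prod.simps(2)[symmetric] digit_sum.simps(2)[symmetric])+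
  then show ?case by blast
qed

section \<open>Gibbs weights and likelihood ratios of copies\<close>

lemma gibbs_weight_digits:
  assumes "i < d ^ n"
  shows "gibbs_weight \<beta> (d ^ n) (\<lambda>i. digit_sum d h n i - \<mu> * digit_sum d \<nu> n i) i
    = digit_prod d (gibbs_weight \<beta> d (\<lambda>a. h a - \<mu> * \<nu> a)) n i"
  using assms
proof (induction n arbitrary: i)
  case 0
  then show ?case by (simp add: gibbs_weight_def)
next
  case (Suc n)
  have "(\<lambda>i. digit_sum d h (Suc n) i - \<mu> * digit_sum d \<nu> (Suc n) i)
    = (\<lambda>i. (digit_sum d h n (i div d) - \<mu> * digit_sum d \<nu> n (i div d)) + (h (i mod d) - \<mu> * \<nu> (i mod d)))"
    by (auto simp: ring_distribs)
  then show ?case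
    using Suc gibbs_weight_product[of i "d ^ n" d \<beta> "\<lambda>i. digit_sum d h n i - \<mu> * digit_sum d \<nu> n i" "\<lambda>a. h a - \<mu> * \<nu> a"]
      digit_less(1)[OF Suc.prems]
    by (simp add: power_Suc2 mult.commute del: power_Suc)
qed

lemma digit_prod_ratio:
  assumes "\<And>a. a < d \<Longrightarrow> 0 \<le> r a" "\<And>a. a < d \<Longrightarrow> 0 < g a" "i < d ^ n" "digit_prod d r n i \<noteq> 0"
  shows "digit_prod d r n i = exp (digit_sum d (\<lambda>a. ln (r a / g a)) n i) * digit_prod d g n i"
  using assms(3,4)
proof (induction n arbitrary: i)
  case (Suc n)
  note i = digit_less[OF Suc.prems(1)]
  have "0 < r (i mod d)" using Suc.prems(2) assms(1)[OF i(2)] by (simp add: less_le)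
  then have "r (i mod d) = exp (ln (r (i mod d) / g (i mod d))) * g (i mod d)"
    using assms(2)[OF i(2)] by simp
  moreover have "digit_prod d r n (i div d) = exp (digit_sum d (\<lambda>a. ln (r a / g a)) n (i div d)) * digit_prod d g n (i div d)"
    by (rule Suc.IH) (use i Suc.prems(2) in auto)
  ultimately show ?case by (simp add: exp_add)
qed simp

lemma digit_prod_pos: "(\<And>a. a < d \<Longrightarrow> 0 < g a) \<Longrightarrow> i < d ^ n \<Longrightarrow> 0 < digit_prod d g n i"
proof (induction n arbitrary: i)
  case (Suc n)
  then show ?case using digit_less[OF Suc.prems(2)] by simp
qed simp

lemma digit_sum_shift: "digit_sum d (\<lambda>a. f a - m) n i = digit_sum d f n i - real n * m"
  by (induction n arbitrary: i) (auto simp: ring_distribs)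

lemma digit_sum_minus: "digit_sum d (\<lambda>a. - f a) n i = - digit_sum d f n i"
  by (induction n arbitrary: i) auto

text \<open>The index sets may differ where the product weight is zero and the logarithm carries no
  information, but such terms add nothing. In the second equation the logarithm is negated, so that
  an upper tail takes the lower-tail form of the limit theorem.\<close>

lemma likelihood_sets:
  fixes r g :: "nat \<Rightarrow> real" and m c :: real
  assumes r: "\<And>a. a < d \<Longrightarrow> 0 \<le> r a" and g: "\<And>a. a < d \<Longrightarrow> 0 < g a"
    and G: "\<And>i. i < d ^ n \<Longrightarrow> G i = digit_prod d g n i"
  shows "(\<Sum>i | i < d ^ n \<and> digit_prod d r n i \<le> exp (real n * m + c) * G i. digit_prod d r n i)
      = (\<Sum>i | i < d ^ n \<and> digit_sum d (\<lambda>a. ln (r a / g a) - m) n i \<le> c. digit_prod d r n i)"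
    and "(\<Sum>i | i < d ^ n \<and> exp (real n * m - c) * G i \<le> digit_prod d r n i. digit_prod d r n i)
      = (\<Sum>i | i < d ^ n \<and> digit_sum d (\<lambda>a. - (ln (r a / g a) - m)) n i \<le> c. digit_prod d r n i)"
proof -
  have filter: "(\<Sum>i | i < d ^ n \<and> A i. digit_prod d r n i) = (\<Sum>i | i < d ^ n \<and> B i. digit_prod d r n i)"
    if "\<And>i. i < d ^ n \<Longrightarrow> digit_prod d r n i \<noteq> 0 \<Longrightarrow> A i = B i" for A B
  proof -
    have "(\<Sum>i | i \<in> {..<d ^ n} \<and> A i. digit_prod d r n i) = (\<Sum>i | i \<in> {..<d ^ n} \<and> B i. digit_prod d r n i)"
      unfolding sum.inter_filter[OF finite_lessThan] by (rule sum.cong) (use that in auto)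
    then show ?thesis by simp
  qed
  define l where "l = digit_sum d (\<lambda>a. ln (r a / g a)) n"
  have *: "digit_prod d r n i = exp (l i) * G i" "0 < G i" if "i < d ^ n" "digit_prod d r n i \<noteq> 0" for i
    using digit_prod_ratio[OF r g that] G[OF that(1)] digit_prod_pos[OF g that(1)] by (auto simp: l_def)
  show "(\<Sum>i | i < d ^ n \<and> digit_prod d r n i \<le> exp (real n * m + c) * G i. digit_prod d r n i)
      = (\<Sum>i | i < d ^ n \<and> digit_sum d (\<lambda>a. ln (r a / g a) - m) n i \<le> c. digit_prod d r n i)"
  proof (rule filter)
    fix i assume i: "i < d ^ n" "digit_prod d r n i \<noteq> 0"
    show "(digit_prod d r n i \<le> exp (real n * m + c) * G i) = (digit_sum d (\<lambda>a. ln (r a / g a) - m) n i \<le> c)"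
      unfolding *(1)[OF i] digit_sum_shift l_def[symmetric] using *(2)[OF i] by auto
  qed
  show "(\<Sum>i | i < d ^ n \<and> exp (real n * m - c) * G i \<le> digit_prod d r n i. digit_prod d r n i)
      = (\<Sum>i | i < d ^ n \<and> digit_sum d (\<lambda>a. - (ln (r a / g a) - m)) n i \<le> c. digit_prod d r n i)"
  proof (rule filter)
    fix i assume i: "i < d ^ n" "digit_prod d r n i \<noteq> 0"
    show "(exp (real n * m - c) * G i \<le> digit_prod d r n i) = (digit_sum d (\<lambda>a. - (ln (r a / g a) - m)) n i \<le> c)"
      unfolding *(1)[OF i] digit_sum_minus digit_sum_shift l_def[symmetric] using *(2)[OF i] by auto
  qed
qed

text \<open>The bounds on work have additive constants that grow without bound as the threshold
  approaches the quantile. So \<open>C\<close> may depend on \<open>c\<close>, which stays fixed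
  while \<open>n\<close> grows.\<close>

lemma tendsto_second_order:
  fixes x :: "nat \<Rightarrow> real"
  assumes upper: "\<And>c. a < c \<Longrightarrow> \<exists>C. \<forall>\<^sub>F n in sequentially. x n \<le> c + C / sqrt (real n)"
    and lower: "\<And>c. c < a \<Longrightarrow> \<exists>C. \<forall>\<^sub>F n in sequentially. c + C / sqrt (real n) \<le> x n"
  shows "x \<longlonglongrightarrow> a"
proof (rule order_tendstoI)
  have lim: "(\<lambda>n. c + C / sqrt (real n)) \<longlonglongrightarrow> c" for c C
  proof -
    have "filterlim (\<lambda>n. sqrt (real n)) at_top sequentially"
      by (rule filterlim_compose[OF sqrt_at_top filterlim_real_sequentially])
    then have "(\<lambda>n. C / sqrt (real n)) \<longlonglongrightarrow> 0"
      by (rule tendsto_divide_0[OF tendsto_const filterlim_at_top_imp_at_infinity])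
    from tendsto_add[OF tendsto_const[of c] this] show ?thesis by simp
  qed
  fix u
  show "\<forall>\<^sub>F n in sequentially. x n < u" if "a < u"
  proof -
    from dense[OF that] obtain c where c: "a < c" "c < u" by blast
    then obtain C where "\<forall>\<^sub>F n in sequentially. x n \<le> c + C / sqrt (real n)" using upper by blast
    then show ?thesis using order_tendstoD(2)[OF lim c(2), of C] by eventually_elim (rule le_less_trans)
  qed
  show "\<forall>\<^sub>F n in sequentially. u < x n" if "u < a"
  proof -
    from dense[OF that] obtain c where c: "u < c" "c < a" by blast
    then obtain C where "\<forall>\<^sub>F n in sequentially. c + C / sqrt (real n) \<le> x n" using lower by blast
    then show ?thesis using order_tendstoD(1)[OF lim c(1), of C] by eventually_elim (rule less_le_trans)
  qed
qed

section \<open>The work of many copies\<close>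

locale copies_setting =
  fixes \<beta> \<mu> \<epsilon> :: real and R :: qsystem and d :: nat and P :: "complex mat" and r h \<nu> g :: "nat \<Rightarrow> real"
  assumes \<beta>: "0 < \<beta>" and \<epsilon>: "0 < \<epsilon>" "\<epsilon> < 1" and R: "state_spectrum d P R r h \<nu>"
    and g: "\<And>a. a < d \<Longrightarrow> g a = gibbs_weight \<beta> d (\<lambda>a. h a - \<mu> * \<nu> a) a"
begin

text \<open>The coefficient of \<open>sqrt n\<close> in \<open>\<beta> * W\<close>, common to both
  limits.\<close>

definition deviation :: real where "deviation = rel_entropy_sd d r g * Phi_inv (1 - \<epsilon>)"

text \<open>Centred, because the limit theorem is stated for mean zero.\<close>

definition log_ratio :: "nat \<Rightarrow> real" where
  "log_ratio a = ln (r a / g a) - rel_entropy d r g"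

definition gain_set :: "nat \<Rightarrow> real set" where
  "gain_set n = {W. \<forall>\<^sub>F E in at_top. \<exists>B B'. battery_pair \<beta> \<mu> E W B B' \<and>
     equilibrating_approx \<beta> \<mu> \<epsilon> (compose (copies n R) B) B'}"

definition cost_set :: "nat \<Rightarrow> real set" where
  "cost_set n = {W. \<forall>\<^sub>F E in at_top. \<exists>B B'. battery_pair \<beta> \<mu> E W B B' \<and>
     equilibrating_approx \<beta> \<mu> \<epsilon> B' (compose (copies n R) B)}"

definition copies_gibbs :: "nat \<Rightarrow> nat \<Rightarrow> real" where
  "copies_gibbs n = gibbs_weight \<beta> (d ^ n) (\<lambda>i. digit_sum d h n i - \<mu> * digit_sum d \<nu> n i)"

lemma r: "\<And>a. a < d \<Longrightarrow> 0 \<le> r a" "(\<Sum>a<d. r a) = 1"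
  using state_spectrumD(4,5)[OF R] by auto

lemma g_pos: "a < d \<Longrightarrow> 0 < g a"
  using g gibbs_weight_pos by simp

lemma copies_gibbs_digits: "i < d ^ n \<Longrightarrow> copies_gibbs n i = digit_prod d g n i"
proof -
  have "i < d ^ n \<Longrightarrow> digit_prod d (gibbs_weight \<beta> d (\<lambda>a. h a - \<mu> * \<nu> a)) n i = digit_prod d g n i" for i
  proof (induction n arbitrary: i)
    case (Suc n)
    then show ?case using digit_less[OF Suc.prems] g by simp
  qed simp
  then show "i < d ^ n \<Longrightarrow> copies_gibbs n i = digit_prod d g n i"
    unfolding copies_gibbs_def by (simp add: gibbs_weight_digits)
qed

lemma rel_entropy_sum: "rel_entropy d r g = (\<Sum>a<d. r a * ln (r a / g a))"
  unfolding rel_entropy_def by (intro sum.cong) auto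

lemma log_ratio_mean: "(\<Sum>a<d. r a * log_ratio a) = 0"
  using r(2) by (simp add: log_ratio_def right_diff_distrib sum_subtractf rel_entropy_sum flip: sum_distrib_right)

lemma log_ratio_variance:
  "0 \<le> rel_entropy_sd d r g" "(rel_entropy_sd d r g)\<^sup>2 = (\<Sum>a<d. r a * (log_ratio a)\<^sup>2)"
proof -
  define D where "D = rel_entropy d r g"
  have "(\<Sum>a<d. if r a = 0 then 0 else r a * (ln (r a) - ln (g a))\<^sup>2) = (\<Sum>a<d. r a * (ln (r a / g a))\<^sup>2)"
  proof (rule sum.cong[OF refl])
    fix a assume "a \<in> {..<d}"
    then show "(if r a = 0 then 0 else r a * (ln (r a) - ln (g a))\<^sup>2) = r a * (ln (r a / g a))\<^sup>2"
      using r(1)[of a] g_pos[of a] by (auto simp: ln_div)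
  qed
  also have "\<dots> = (\<Sum>a<d. r a * (log_ratio a)\<^sup>2 + 2 * D * (r a * log_ratio a) + D\<^sup>2 * r a)"
    by (intro sum.cong refl) (simp add: log_ratio_def D_def power2_eq_square algebra_simps)
  also have "\<dots> = (\<Sum>a<d. r a * (log_ratio a)\<^sup>2) + D\<^sup>2"
    using log_ratio_mean r(2) by (simp add: sum.distrib flip: sum_distrib_left)
  finally have *: "rel_entropy_sd d r g = sqrt (\<Sum>a<d. r a * (log_ratio a)\<^sup>2)"
    by (simp add: rel_entropy_sd_def D_def)
  have "0 \<le> (\<Sum>a<d. r a * (log_ratio a)\<^sup>2)" by (intro sum_nonneg mult_nonneg_nonneg) (use r in auto)
  then show "0 \<le> rel_entropy_sd d r g" "(rel_entropy_sd d r g)\<^sup>2 = (\<Sum>a<d. r a * (log_ratio a)\<^sup>2)"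
    unfolding * by auto
qed

abbreviation (input) threshold :: "nat \<Rightarrow> real \<Rightarrow> real" where
  "threshold n c \<equiv> real n * rel_entropy d r g + c * sqrt (real n)"

text \<open>\<open>likely\<close> governs gain and \<open>unlikely\<close> governs cost. The
  threshold lies \<open>c * sqrt n\<close> below the mean for the former and above it for the
  latter, and so the same quantile at \<open>1 - \<epsilon>\<close> appears in both limits.\<close>

definition likely :: "nat \<Rightarrow> real \<Rightarrow> real" where
  "likely n \<theta> = (\<Sum>i | i < d ^ n \<and> exp \<theta> * copies_gibbs n i \<le> digit_prod d r n i. digit_prod d r n i)"

definition unlikely :: "nat \<Rightarrow> real \<Rightarrow> real" where
  "unlikely n \<theta> = (\<Sum>i | i < d ^ n \<and> digit_prod d r n i \<le> exp \<theta> * copies_gibbs n i. digit_prod d r n i)"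

lemma unlikely_digit_sum:
  "unlikely n (threshold n c)
    = (\<Sum>i | i < d ^ n \<and> digit_sum d log_ratio n i \<le> c * sqrt (real n). digit_prod d r n i)"
  unfolding unlikely_def log_ratio_def[abs_def]
  by (rule likelihood_sets(1)) (use r g_pos copies_gibbs_digits in auto)

lemma likely_digit_sum:
  "likely n (real n * rel_entropy d r g - c * sqrt (real n))
    = (\<Sum>i | i < d ^ n \<and> digit_sum d (\<lambda>a. - log_ratio a) n i \<le> c * sqrt (real n). digit_prod d r n i)"
  unfolding likely_def log_ratio_def
  by (rule likelihood_sets(2)) (use r g_pos copies_gibbs_digits in auto)

lemma unlikely_bounds:
  "deviation < c \<Longrightarrow> \<exists>\<kappa>>0. \<forall>\<^sub>F n in sequentially. 1 - \<epsilon> + \<kappa> \<le> unlikely n (threshold n c)"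
  "c < deviation \<Longrightarrow> \<exists>\<kappa>>0. \<forall>\<^sub>F n in sequentially. unlikely n (threshold n c) \<le> 1 - \<epsilon> - \<kappa>"
  unfolding deviation_def unlikely_digit_sum
  using digit_sum_quantile[OF r log_ratio_mean log_ratio_variance, of "1 - \<epsilon>" c] \<epsilon> by auto

text \<open>The negated log ratio also has mean zero and has the same variance, so its quantile is
  the same.\<close>

lemma likely_bounds:
  "deviation < c \<Longrightarrow> \<exists>\<kappa>>0. \<forall>\<^sub>F n in sequentially. 1 - \<epsilon> + \<kappa> \<le> likely n (real n * rel_entropy d r g - c * sqrt (real n))"
  "c < deviation \<Longrightarrow> \<exists>\<kappa>>0. \<forall>\<^sub>F n in sequentially. likely n (real n * rel_entropy d r g - c * sqrt (real n)) \<le> 1 - \<epsilon> - \<kappa>"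
proof -
  have m: "(\<Sum>a<d. r a * - log_ratio a) = 0" using log_ratio_mean by (simp add: sum_negf)
  have v: "(rel_entropy_sd d r g)\<^sup>2 = (\<Sum>a<d. r a * (- log_ratio a)\<^sup>2)"
    using log_ratio_variance(2) by simp
  show
    "deviation < c \<Longrightarrow> \<exists>\<kappa>>0. \<forall>\<^sub>F n in sequentially. 1 - \<epsilon> + \<kappa> \<le> likely n (real n * rel_entropy d r g - c * sqrt (real n))"
    "c < deviation \<Longrightarrow> \<exists>\<kappa>>0. \<forall>\<^sub>F n in sequentially. likely n (real n * rel_entropy d r g - c * sqrt (real n)) \<le> 1 - \<epsilon> - \<kappa>"
    unfolding deviation_def likely_digit_sum
    using digit_sum_quantile[OF r m log_ratio_variance(1) v, of "1 - \<epsilon>" c] \<epsilon> by auto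
qed

lemma likely_le: "likely n \<theta> \<le> 1"
proof -
  have "likely n \<theta> \<le> (\<Sum>i<d ^ n. digit_prod d r n i)"
    unfolding likely_def by (rule sum_mono2) (use digit_prod_nonneg[OF r(1)] in auto)
  then show ?thesis by (simp add: digit_prod_sum[OF r(2)])
qed

lemma unlikely_complement:
  "(\<Sum>i | i < d ^ n \<and> exp \<theta> * copies_gibbs n i < digit_prod d r n i. digit_prod d r n i) = 1 - unlikely n \<theta>"
proof -
  have "(\<Sum>i<d ^ n. digit_prod d r n i) = (\<Sum>i\<in>{i. i < d ^ n \<and> digit_prod d r n i \<le> exp \<theta> * copies_gibbs n i}
      \<union> {i. i < d ^ n \<and> exp \<theta> * copies_gibbs n i < digit_prod d r n i}. digit_prod d r n i)"
    by (rule sum.cong) auto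
  also have "\<dots> = unlikely n \<theta> + (\<Sum>i | i < d ^ n \<and> exp \<theta> * copies_gibbs n i < digit_prod d r n i. digit_prod d r n i)"
    unfolding unlikely_def by (rule sum.union_disjoint) auto
  finally show ?thesis by (simp add: digit_prod_sum[OF r(2)])
qed

lemma spectrum:
  assumes "0 < n"
  obtains Q where "state_spectrum (d ^ n) Q (copies n R) (digit_prod d r n) (digit_sum d h n) (digit_sum d \<nu> n)"
  using copies_spectrum[OF R, of "n - 1"] assms by auto

lemma gain_set_upper:
  assumes n: "0 < n" and W: "W \<in> gain_set n" and \<kappa>: "0 < \<kappa>" "likely n \<theta> \<le> 1 - \<epsilon> - \<kappa>"
  shows "\<beta> * W \<le> \<theta> - ln \<kappa>"
proof -
  obtain Q where Q: "state_spectrum (d ^ n) Q (copies n R) (digit_prod d r n) (digit_sum d h n) (digit_sum d \<nu> n)"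
    by (rule spectrum[OF n])
  obtain E B B' where "battery_pair \<beta> \<mu> E W B B'" "equilibrating_approx \<beta> \<mu> \<epsilon> (compose (copies n R) B) B'"
    using W eventually_happens[of _ "at_top :: real filter"] unfolding gain_set_def by fastforce
  from gain_converse[OF Q copies_gibbs_def this, of \<theta>] have "\<kappa> \<le> exp (\<theta> - \<beta> * W)"
    using \<kappa>(2) unfolding likely_def by simp
  then have "ln \<kappa> \<le> \<theta> - \<beta> * W" using \<kappa>(1) by (metis exp_gt_zero ln_exp ln_le_cancel_iff)
  then show ?thesis by simp
qed

lemma gain_set_element:
  assumes n: "0 < n" and \<kappa>: "0 < \<kappa>" "1 - \<epsilon> + \<kappa> \<le> likely n \<theta>"
  obtains W where "W \<in> gain_set n" "\<theta> + ln (\<kappa> / 2) \<le> \<beta> * W"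
proof -
  obtain Q where Q: "state_spectrum (d ^ n) Q (copies n R) (digit_prod d r n) (digit_sum d h n) (digit_sum d \<nu> n)"
    by (rule spectrum[OF n])
  have le: "likely n \<theta> \<le> 1" by (rule likely_le)
  \<comment> \<open>Taking \<open>\<kappa> / 2\<close> for the failure probability
    \<open>\<delta>\<close> leaves strict room above \<open>1 - \<epsilon>\<close>, which the ladder
    needs.\<close>
  have "\<kappa> / 2 * likely n \<theta> \<le> \<kappa> / 2 * 1" using \<kappa> le by (intro mult_left_mono) auto
  moreover have "(1 - \<kappa> / 2) * likely n \<theta> = likely n \<theta> - \<kappa> / 2 * likely n \<theta>"
    by (simp add: left_diff_distrib)
  ultimately have "1 - \<epsilon> < (1 - \<kappa> / 2) * likely n \<theta>" using \<kappa> by linarith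
  moreover have "\<kappa> / 2 < 1" using \<kappa> le \<epsilon> by simp
  ultimately obtain W where "\<theta> + ln (\<kappa> / 2) \<le> \<beta> * W" "\<And>E. \<exists>B B'. battery_pair \<beta> \<mu> E W B B' \<and>
      equilibrating_approx \<beta> \<mu> \<epsilon> (compose (copies n R) B) B'"
    using gain_achievable[OF \<beta> Q copies_gibbs_def, of \<epsilon> "\<kappa> / 2" \<theta>] \<kappa>(1) \<epsilon> unfolding likely_def by auto
  then show thesis using that[of W] by (simp add: gain_set_def)
qed

lemma cost_set_lower:
  assumes n: "0 < n" and W: "W \<in> cost_set n" and \<kappa>: "0 < \<kappa>" "unlikely n \<theta> \<le> 1 - \<epsilon> - \<kappa>"
  shows "\<theta> + ln \<kappa> \<le> \<beta> * W"
proof -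
  obtain Q where Q: "state_spectrum (d ^ n) Q (copies n R) (digit_prod d r n) (digit_sum d h n) (digit_sum d \<nu> n)"
    by (rule spectrum[OF n])
  obtain E B B' where "battery_pair \<beta> \<mu> E W B B'" "equilibrating_approx \<beta> \<mu> \<epsilon> B' (compose (copies n R) B)"
    using W eventually_happens[of _ "at_top :: real filter"] unfolding cost_set_def by fastforce
  from cost_converse[OF Q copies_gibbs_def this, of \<theta>] have "\<kappa> \<le> exp (\<beta> * W - \<theta>)"
    using \<kappa>(2) unfolding unlikely_complement by simp
  then have "ln \<kappa> \<le> \<beta> * W - \<theta>" using \<kappa>(1) by (metis exp_gt_zero ln_exp ln_le_cancel_iff)
  then show ?thesis by simp
qed

lemma cost_set_element:
  assumes n: "0 < n" and \<kappa>: "0 < \<kappa>" "\<kappa> < 1" "1 - \<epsilon> + \<kappa> \<le> unlikely n \<theta>"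
  obtains W where "W \<in> cost_set n" "\<beta> * W \<le> \<theta> + ln (4 / (3 * \<kappa>) * ln (4 / \<kappa>) + 2 / \<kappa>)"
proof -
  obtain Q where Q: "state_spectrum (d ^ n) Q (copies n R) (digit_prod d r n) (digit_sum d h n) (digit_sum d \<nu> n)"
    by (rule spectrum[OF n])
  obtain W where "\<beta> * W \<le> \<theta> + ln (4 / (3 * \<kappa>) * ln (4 / \<kappa>) + 2 / \<kappa>)"
    "\<And>E. \<exists>B B'. battery_pair \<beta> \<mu> E W B B' \<and> equilibrating_approx \<beta> \<mu> \<epsilon> B' (compose (copies n R) B)"
    by (rule cost_achievable[OF \<beta> Q copies_gibbs_def \<epsilon>(2) \<kappa>(1,2) \<kappa>(3)[unfolded unlikely_def]]) (rule that)
  then show thesis using that[of W] by (simp add: cost_set_def)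
qed

lemma gain_limit:
  "(\<lambda>n. 1 / sqrt (real n) * (real n / \<beta> * rel_entropy d r g - W_gain \<beta> \<mu> \<epsilon> (copies n R)))
    \<longlonglongrightarrow> 1 / \<beta> * deviation"
proof -
  define x where "x = (\<lambda>n. (real n * rel_entropy d r g - \<beta> * Sup (gain_set n)) / sqrt (real n))"
  define \<theta> where "\<theta> = (\<lambda>n c. real n * rel_entropy d r g - c * sqrt (real n))"
  \<comment> \<open>\<open>Sup\<close> says nothing about an empty or unbounded set. The offsets -1
    and +1 secure boundedness and nonemptiness for large \<open>n\<close>, independently of the
    sharp offset \<open>c\<close> used later.\<close>
  obtain \<kappa>1 where \<kappa>1: "0 < \<kappa>1" "\<forall>\<^sub>F n in sequentially. likely n (\<theta> n (deviation - 1)) \<le> 1 - \<epsilon> - \<kappa>1"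
    using likely_bounds(2)[of "deviation - 1"] unfolding \<theta>_def by auto
  obtain \<kappa>2 where \<kappa>2: "0 < \<kappa>2" "\<forall>\<^sub>F n in sequentially. 1 - \<epsilon> + \<kappa>2 \<le> likely n (\<theta> n (deviation + 1))"
    using likely_bounds(1)[of "deviation + 1"] unfolding \<theta>_def by auto
  have bdd: "bdd_above (gain_set n)" if "0 < n" "likely n (\<theta> n (deviation - 1)) \<le> 1 - \<epsilon> - \<kappa>1" for n
    by (rule bdd_aboveI[of _ "(\<theta> n (deviation - 1) - ln \<kappa>1) / \<beta>"])
      (use gain_set_upper[OF that(1) _ \<kappa>1(1) that(2)] \<beta> in \<open>simp add: pos_le_divide_eq mult.commute\<close>)
  have ne: "gain_set n \<noteq> {}" if "0 < n" "1 - \<epsilon> + \<kappa>2 \<le> likely n (\<theta> n (deviation + 1))" for n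
    using gain_set_element[OF that(1) \<kappa>2(1) that(2)] by blast
  have "x \<longlonglongrightarrow> deviation"
  proof (rule tendsto_second_order)
    fix c assume "deviation < c"
    then obtain \<kappa> where \<kappa>: "0 < \<kappa>" "\<forall>\<^sub>F n in sequentially. 1 - \<epsilon> + \<kappa> \<le> likely n (\<theta> n c)"
      using likely_bounds(1) unfolding \<theta>_def by blast
    have "\<forall>\<^sub>F n in sequentially. x n \<le> c + (- ln (\<kappa> / 2)) / sqrt (real n)"
      using \<kappa>(2) \<kappa>1(2) eventually_gt_at_top[of 0]
    proof eventually_elim
      fix n assume *: "1 - \<epsilon> + \<kappa> \<le> likely n (\<theta> n c)" "likely n (\<theta> n (deviation - 1)) \<le> 1 - \<epsilon> - \<kappa>1" and n: "0 < (n::nat)"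
      obtain W where W: "W \<in> gain_set n" "\<theta> n c + ln (\<kappa> / 2) \<le> \<beta> * W"
        by (rule gain_set_element[OF n \<kappa>(1) *(1)])
      have "\<beta> * W \<le> \<beta> * Sup (gain_set n)"
        by (intro mult_left_mono cSup_upper W bdd n *) (use \<beta> in simp)
      then have "real n * rel_entropy d r g - \<beta> * Sup (gain_set n) \<le> c * sqrt (real n) - ln (\<kappa> / 2)"
        using W(2) unfolding \<theta>_def by linarith
      then have "x n \<le> (c * sqrt (real n) - ln (\<kappa> / 2)) / sqrt (real n)"
        unfolding x_def by (rule divide_right_mono) simp
      then show "x n \<le> c + (- ln (\<kappa> / 2)) / sqrt (real n)"
        using n by (simp add: diff_divide_distrib)
    qed
    then show "\<exists>C. \<forall>\<^sub>F n in sequentially. x n \<le> c + C / sqrt (real n)" by blast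
  next
    fix c assume "c < deviation"
    then obtain \<kappa> where \<kappa>: "0 < \<kappa>" "\<forall>\<^sub>F n in sequentially. likely n (\<theta> n c) \<le> 1 - \<epsilon> - \<kappa>"
      using likely_bounds(2) unfolding \<theta>_def by blast
    have "\<forall>\<^sub>F n in sequentially. c + ln \<kappa> / sqrt (real n) \<le> x n"
      using \<kappa>(2) \<kappa>2(2) eventually_gt_at_top[of 0]
    proof eventually_elim
      fix n assume *: "likely n (\<theta> n c) \<le> 1 - \<epsilon> - \<kappa>" "1 - \<epsilon> + \<kappa>2 \<le> likely n (\<theta> n (deviation + 1))" and n: "0 < (n::nat)"
      have "Sup (gain_set n) \<le> (\<theta> n c - ln \<kappa>) / \<beta>"
        by (rule cSup_least[OF ne[OF n *(2)]])
          (use gain_set_upper[OF n _ \<kappa>(1) *(1)] \<beta> in \<open>simp add: pos_le_divide_eq mult.commute\<close>)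
      then have "\<beta> * Sup (gain_set n) \<le> \<theta> n c - ln \<kappa>" using \<beta> by (simp add: pos_le_divide_eq mult.commute)
      then have "c * sqrt (real n) + ln \<kappa> \<le> real n * rel_entropy d r g - \<beta> * Sup (gain_set n)"
        unfolding \<theta>_def by linarith
      then have "(c * sqrt (real n) + ln \<kappa>) / sqrt (real n) \<le> x n"
        unfolding x_def by (rule divide_right_mono) simp
      then show "c + ln \<kappa> / sqrt (real n) \<le> x n"
        using n by (simp add: add_divide_distrib)
    qed
    then show "\<exists>C. \<forall>\<^sub>F n in sequentially. c + C / sqrt (real n) \<le> x n" by blast
  qed
  then have "(\<lambda>n. 1 / \<beta> * x n) \<longlonglongrightarrow> 1 / \<beta> * deviation" by (intro tendsto_intros)
  moreover have "1 / \<beta> * x n = 1 / sqrt (real n) * (real n / \<beta> * rel_entropy d r g - W_gain \<beta> \<mu> \<epsilon> (copies n R))" for n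
    using \<beta> unfolding x_def W_gain_def gain_set_def[symmetric] by (simp add: diff_divide_distrib right_diff_distrib)
  ultimately show ?thesis by simp
qed

lemma cost_limit:
  "(\<lambda>n. 1 / sqrt (real n) * (W_cost \<beta> \<mu> \<epsilon> (copies n R) - real n / \<beta> * rel_entropy d r g))
    \<longlonglongrightarrow> 1 / \<beta> * deviation"
proof -
  define x where "x = (\<lambda>n. (\<beta> * Inf (cost_set n) - real n * rel_entropy d r g) / sqrt (real n))"
  define \<theta> where "\<theta> = (\<lambda>n c. real n * rel_entropy d r g + c * sqrt (real n))"
  \<comment> \<open>The margin is capped at 1/2 because \<open>cost_achievable\<close> requires it
    to be less than 1.\<close>
  have above: "\<exists>\<kappa>>0. \<kappa> < 1 \<and> (\<forall>\<^sub>F n in sequentially. 1 - \<epsilon> + \<kappa> \<le> unlikely n (\<theta> n c))" if "deviation < c" for c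
  proof -
    from unlikely_bounds(1)[OF that] obtain \<kappa>
      where \<kappa>: "0 < \<kappa>" "\<forall>\<^sub>F n in sequentially. 1 - \<epsilon> + \<kappa> \<le> unlikely n (\<theta> n c)"
      unfolding \<theta>_def by blast
    have "\<forall>\<^sub>F n in sequentially. 1 - \<epsilon> + min \<kappa> (1 / 2) \<le> unlikely n (\<theta> n c)"
      by (rule eventually_mono[OF \<kappa>(2)]) (use min.cobounded1[of \<kappa> "1 / 2"] in linarith)
    moreover have "0 < min \<kappa> (1 / 2)" "min \<kappa> (1 / 2) < 1" using \<kappa>(1) by simp_all
    ultimately show ?thesis by blast
  qed
  have q1: "deviation - 1 < deviation" and q2: "deviation < deviation + 1" by simp_all
  obtain \<kappa>1 where \<kappa>1: "0 < \<kappa>1" "\<forall>\<^sub>F n in sequentially. unlikely n (\<theta> n (deviation - 1)) \<le> 1 - \<epsilon> - \<kappa>1"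
    using unlikely_bounds(2)[of "deviation - 1", OF q1] unfolding \<theta>_def by blast
  obtain \<kappa>2 where \<kappa>2: "0 < \<kappa>2" "\<kappa>2 < 1" "\<forall>\<^sub>F n in sequentially. 1 - \<epsilon> + \<kappa>2 \<le> unlikely n (\<theta> n (deviation + 1))"
    using above[OF q2] by blast
  have bdd: "bdd_below (cost_set n)" if "0 < n" "unlikely n (\<theta> n (deviation - 1)) \<le> 1 - \<epsilon> - \<kappa>1" for n
    by (rule bdd_belowI[of _ "(\<theta> n (deviation - 1) + ln \<kappa>1) / \<beta>"])
      (use cost_set_lower[OF that(1) _ \<kappa>1(1) that(2)] \<beta> in \<open>simp add: pos_divide_le_eq mult.commute\<close>)
  have ne: "cost_set n \<noteq> {}" if "0 < n" "1 - \<epsilon> + \<kappa>2 \<le> unlikely n (\<theta> n (deviation + 1))" for n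
    using cost_set_element[OF that(1) \<kappa>2(1,2) that(2)] by blast
  have "x \<longlonglongrightarrow> deviation"
  proof (rule tendsto_second_order)
    fix c assume "deviation < c"
    then obtain \<kappa> where \<kappa>: "0 < \<kappa>" "\<kappa> < 1" "\<forall>\<^sub>F n in sequentially. 1 - \<epsilon> + \<kappa> \<le> unlikely n (\<theta> n c)"
      using above by blast
    define C where "C = ln (4 / (3 * \<kappa>) * ln (4 / \<kappa>) + 2 / \<kappa>)"
    have "\<forall>\<^sub>F n in sequentially. x n \<le> c + C / sqrt (real n)"
      using \<kappa>(3) \<kappa>1(2) eventually_gt_at_top[of 0]
    proof eventually_elim
      fix n assume *: "1 - \<epsilon> + \<kappa> \<le> unlikely n (\<theta> n c)" "unlikely n (\<theta> n (deviation - 1)) \<le> 1 - \<epsilon> - \<kappa>1" and n: "0 < (n::nat)"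
      obtain W where W: "W \<in> cost_set n" "\<beta> * W \<le> \<theta> n c + C"
        unfolding C_def by (rule cost_set_element[OF n \<kappa>(1,2) *(1)])
      have "\<beta> * Inf (cost_set n) \<le> \<beta> * W"
        by (intro mult_left_mono cInf_lower W bdd n *) (use \<beta> in simp)
      then have "\<beta> * Inf (cost_set n) - real n * rel_entropy d r g \<le> c * sqrt (real n) + C"
        using W(2) unfolding \<theta>_def by linarith
      then have "x n \<le> (c * sqrt (real n) + C) / sqrt (real n)"
        unfolding x_def by (rule divide_right_mono) simp
      then show "x n \<le> c + C / sqrt (real n)"
        using n by (simp add: add_divide_distrib)
    qed
    then show "\<exists>C. \<forall>\<^sub>F n in sequentially. x n \<le> c + C / sqrt (real n)" by blast
  next
    fix c assume "c < deviation"
    then obtain \<kappa> where \<kappa>: "0 < \<kappa>" "\<forall>\<^sub>F n in sequentially. unlikely n (\<theta> n c) \<le> 1 - \<epsilon> - \<kappa>"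
      using unlikely_bounds(2) unfolding \<theta>_def by blast
    have "\<forall>\<^sub>F n in sequentially. c + ln \<kappa> / sqrt (real n) \<le> x n"
      using \<kappa>(2) \<kappa>2(3) eventually_gt_at_top[of 0]
    proof eventually_elim
      fix n assume *: "unlikely n (\<theta> n c) \<le> 1 - \<epsilon> - \<kappa>" "1 - \<epsilon> + \<kappa>2 \<le> unlikely n (\<theta> n (deviation + 1))" and n: "0 < (n::nat)"
      have "(\<theta> n c + ln \<kappa>) / \<beta> \<le> Inf (cost_set n)"
        by (rule cInf_greatest[OF ne[OF n *(2)]])
          (use cost_set_lower[OF n _ \<kappa>(1) *(1)] \<beta> in \<open>simp add: pos_divide_le_eq mult.commute\<close>)
      then have "\<theta> n c + ln \<kappa> \<le> \<beta> * Inf (cost_set n)" using \<beta> by (simp add: pos_divide_le_eq mult.commute)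
      then have "c * sqrt (real n) + ln \<kappa> \<le> \<beta> * Inf (cost_set n) - real n * rel_entropy d r g"
        unfolding \<theta>_def by linarith
      then have "(c * sqrt (real n) + ln \<kappa>) / sqrt (real n) \<le> x n"
        unfolding x_def by (rule divide_right_mono) simp
      then show "c + ln \<kappa> / sqrt (real n) \<le> x n"
        using n by (simp add: add_divide_distrib)
    qed
    then show "\<exists>C. \<forall>\<^sub>F n in sequentially. c + C / sqrt (real n) \<le> x n" by blast
  qed
  then have "(\<lambda>n. 1 / \<beta> * x n) \<longlonglongrightarrow> 1 / \<beta> * deviation" by (intro tendsto_intros)
  moreover have "1 / \<beta> * x n = 1 / sqrt (real n) * (W_cost \<beta> \<mu> \<epsilon> (copies n R) - real n / \<beta> * rel_entropy d r g)" for n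
    using \<beta> unfolding x_def W_cost_def cost_set_def[symmetric] by (simp add: diff_divide_distrib right_diff_distrib)
  ultimately show ?thesis by simp
qed

end

theorem mainTheorem6:
  fixes \<beta> \<mu> \<epsilon> :: real and R :: qsystem and P :: "complex mat" and r h \<nu> g :: "nat \<Rightarrow> real"
  assumes "\<beta> > 0" and "0 < \<epsilon>" and "\<epsilon> < 1"
    and "is_state R"
    and "has_eigenvalues (hdim R) P (dens R) r"
    and "has_eigenvalues (hdim R) P (ham R) h"
    and "has_eigenvalues (hdim R) P (numop R) \<nu>"
    and "has_eigenvalues (hdim R) P (dens (equilibrium \<beta> \<mu> R)) g"
  shows "((\<lambda>n. 1 / sqrt (real n) *
            (real n / \<beta> * rel_entropy (hdim R) r g - W_gain \<beta> \<mu> \<epsilon> (copies n R)))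
          \<longlonglongrightarrow> 1 / \<beta> * rel_entropy_sd (hdim R) r g * Phi_inv (1 - \<epsilon>)) \<and>
         ((\<lambda>n. 1 / sqrt (real n) *
            (W_cost \<beta> \<mu> \<epsilon> (copies n R) - real n / \<beta> * rel_entropy (hdim R) r g))
          \<longlonglongrightarrow> 1 / \<beta> * rel_entropy_sd (hdim R) r g * Phi_inv (1 - \<epsilon>))"
proof -
  \<comment> \<open>\<open>g\<close> is listed in the same basis \<open>P\<close> as
    \<open>h\<close> and \<open>\<nu>\<close>, so its entries are the Gibbs weights in matching
    order.\<close>
  have "g a = gibbs_weight \<beta> (hdim R) (\<lambda>a. h a - \<mu> * \<nu> a) a" if "a < hdim R" for a
    by (rule has_eigenvalues_unique[OF _ has_eigenvalues_gibbs[OF has_eigenvalues_grand[OF assms(6,7)]] that])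
      (use assms(8) in \<open>simp add: equilibrium_def\<close>)
  then interpret copies_setting \<beta> \<mu> \<epsilon> R "hdim R" P r h \<nu> g
    by unfold_locales (use assms state_spectrumI in auto)
  show ?thesis using gain_limit cost_limit unfolding deviation_def by (simp add: mult.assoc)
qed

end
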